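(* The sliding-window algorithm WindowHB specified in the context, run with window size $w\in\mathbb{N}$ on a trace $\sigma$, correctly solves the short happens-before-race detection problem: given $\sigma$ and $w$, decide whether there are conflicting events $e_i,e_j$ of $\sigma$ with $i<j$ that form a happens-before race in $\sigma$ and satisfy $j-i+1\le w$. WindowHB runs in time $O(N\,T)$ and uses space $O\big(w+(\min(w,V+L)+T)\,T\log w\big)$, where $N$ is the length of $\sigma$, $T$ the number of threads, $V$ the number of memory locations (variables) and $L$ the number of locks of $\sigma$.
   Context: TRACES AND RACES. An event is a pair $e=(t,o)$ with $t=\mathrm{thr}(e)$ a thread and $o$ an operation: a read $\mathtt{r}(x)$ or write $\mathtt{w}(x)$ of a memory location $x$, or an acquire $\mathtt{acq}(\ell)$ or release $\mathtt{rel}(\ell)$ of a lock $\ell$. A trace is a finite sequence $\sigma=e_0e_1\cdots e_{N-1}$ of events; traces are well-formed, i.e. no thread acquires a lock held by another thread and no thread releases a lock it does not hold. Two memory accesses are conflicting if they access the same location, at least one is a write, and they are by different threads. The happens-before order $\le_{\mathrm{HB}}^{\sigma}$ is the smallest partial order on the events of $\sigma$ such that $e\le_{\mathrm{HB}}^{\sigma}e'$ whenever $e$ equals or precedes $e'$ in $\sigma$ and either $\mathrm{thr}(e)=\mathrm{thr}(e')$, or $e$ is a release and $e'$ an acquire of the same lock. A conflicting pair is a happens-before race if its two events are incomparable under $\le_{\mathrm{HB}}^{\sigma}$. STATE OF WindowHB. A circular array $W[0..w-1]$ of events, initially all null; a head position $h$, initially $-1$; for every thread $t$ a vector clock $C_t$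 (a map from threads to $\{-1,0,\dots,w-1\}$), initially $\bot$ (all entries $-1$). Allocated on demand and null when unset: for every lock $\ell$ a vector clock $C_\ell$; for every location $x$ a vector clock $R_x$ (reads) and an epoch $\mathsf{e}_x$ (last write) of the form $t@c$ with $t$ a thread and $c$ a window index; for each window index $i$ holding a release, a set $S_i$ of threads and locks, namely those whose clock has an entry referring to the release stored at $W[i]$. Operations on $S_{-1}$ do nothing, and a null clock or epoch imposes no constraint in a comparison. WINDOW ORDER. For window indices $a,b$ (or $-1$), $a\le_W b$ iff $a=-1$, or $a\le b\le h$, or $h<a\le b$, or $b\le h<a$; $<_W$ is its strict part. Clocks are compared pointwise with $\le_W$ (written $\sqsubseteq_W$), and $t'@c\sqsubseteq_W C$ means $c\le_W C[t']$. When thread $t$ compares $R_x$ or $\mathsf{e}_x$ with $C_t$ to look for a race, only components of threads other than $t$ matter. STEPS OF WindowHB. The events of $\sigma$ are processed in order. For each incoming event $e$: set $h\leftarrow(h+1)\bmod w$; if $e_{\mathrm{out}}=W[h]$ is not null, run the post-handler of $e_{\mathrm{out}}$; then run the handler of $e$; then set $W[h]\leftarrow e$. Handlers: - read of $x$ by $t$: if $\mathsf{e}_x\not\sqsubseteq_W C_t$, declare a race. If $R_x$ is null, set $R_x\leftarrow\bot$. Set $R_x[t]\leftarrow h$. - write of $x$ by $t$: if $R_x\not\sqsubseteq_W C_t$ or $\mathsf{e}_x\not\sqsubseteq_W C_t$, declare a race. Set $\mathsf{e}_x\leftarrow t@h$. - acquire of $\ell$ by $t$ (when $C_\ell$ is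 not null): for every thread $s$, if $C_t[s]<_W C_\ell[s]$ then add $t$ to $S_{C_\ell[s]}$, remove $t$ from $S_{C_t[s]}$ and set $C_t[s]\leftarrow C_\ell[s]$; in either case remove $\ell$ from $S_{C_\ell[s]}$. Finally set $C_\ell\leftarrow$ null. - release of $\ell$ by $t$: remove $t$ from $S_{C_t[t]}$; set $S_h\leftarrow\{t\}$ and $C_t[t]\leftarrow h$; set $C_\ell\leftarrow\bot$; for every thread $s$ add $\ell$ to $S_{C_t[s]}$ and set $C_\ell[s]\leftarrow C_t[s]$. Post-handlers: - read of $x$ by $t$: if $R_x[t]=h$, set $R_x[t]\leftarrow-1$; if after the eviction no read of $x$ remains in $W$, set $R_x\leftarrow$ null. - write of $x$ by $t$: if $\mathsf{e}_x=t@h$, set $\mathsf{e}_x\leftarrow$ null. - acquire: nothing. - release of $\ell$ by $t$: for every thread $s\in S_h$ set $C_s[t]\leftarrow-1$, and for every lock $m\in S_h$ set $C_m[t]\leftarrow-1$; if $C_\ell[t]=h$ held at the start of this post-handler, remove $\ell$ from $S_{C_\ell[s]}$ for every thread $s$ and set $C_\ell\leftarrow$ null. Then set $S_h\leftarrow$ null. The answer to the decision problem is "yes" exactly if some race is declared.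
   Formalization: WindowHB is corrected: in the window order -1 is strictly least (case b≤h<a needs b≥0), and a release's post-handler sets C_ℓ to null only if, besides C_ℓ[t]=h, all entries of C_ℓ are -1 after clearing. As specified it misses or falsely declares races. Also w≥1, and log w means max(1, log w). *)

theory Defs
  imports Complex_Main
begin

datatype ('x, 'l) operation = Read 'x | Write 'x | Acq 'l | Rel 'l

type_synonym ('t, 'x, 'l) event = "'t \<times> ('x, 'l) operation"
type_synonym ('t, 'x, 'l) trace = "('t, 'x, 'l) event list"

definition thr :: "('t, 'x, 'l) event \<Rightarrow> 't"
  where "thr e = fst e"

definition opn :: "('t, 'x, 'l) event \<Rightarrow> ('x, 'l) operation"
  where "opn e = snd e"

definition holds :: "('t, 'x, 'l) trace \<Rightarrow> nat \<Rightarrow> 't \<Rightarrow> 'l \<Rightarrow> bool"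
  where "holds \<sigma> i t l \<longleftrightarrow>
    (\<exists>j<i. \<sigma> ! j = (t, Acq l) \<and> (\<forall>k. j < k \<and> k < i \<longrightarrow> \<sigma> ! k \<noteq> (t, Rel l)))"

definition well_formed :: "('t, 'x, 'l) trace \<Rightarrow> bool"
  where "well_formed \<sigma> \<longleftrightarrow> (\<forall>i<length \<sigma>. \<forall>t l.
    (\<sigma> ! i = (t, Acq l) \<longrightarrow> \<not> (\<exists>u. u \<noteq> t \<and> holds \<sigma> i u l)) \<and>
    (\<sigma> ! i = (t, Rel l) \<longrightarrow> holds \<sigma> i t l))"

definition conflicting :: "('t, 'x, 'l) event \<Rightarrow> ('t, 'x, 'l) event \<Rightarrow> bool"
  where "conflicting e f \<longleftrightarrow> thr e \<noteq> thr f \<and>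
    (\<exists>x. opn e \<in> {Read x, Write x} \<and> opn f \<in> {Read x, Write x} \<and>
         (opn e = Write x \<or> opn f = Write x))"

(* Events are identified with their positions in the trace, because equal pairs
   (thread, operation) may occur several times. *)

definition hb_base :: "('t, 'x, 'l) trace \<Rightarrow> (nat \<times> nat) set"
  where "hb_base \<sigma> = {(i, j). i \<le> j \<and> j < length \<sigma> \<and>
    (thr (\<sigma> ! i) = thr (\<sigma> ! j) \<or>
     (\<exists>l. opn (\<sigma> ! i) = Rel l \<and> opn (\<sigma> ! j) = Acq l))}"

definition hb :: "('t, 'x, 'l) trace \<Rightarrow> (nat \<times> nat) set"
  where "hb \<sigma> = \<Inter> {r. partial_order_on {..<length \<sigma>} r \<and> hb_base \<sigma> \<subseteq> r}"

definition hb_race :: "('t, 'x, 'l) trace \<Rightarrow> nat \<Rightarrow> nat \<Rightarrow> bool"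
  where "hb_race \<sigma> i j \<longleftrightarrow>
    conflicting (\<sigma> ! i) (\<sigma> ! j) \<and> (i, j) \<notin> hb \<sigma> \<and> (j, i) \<notin> hb \<sigma>"

definition short_hb_race :: "('t, 'x, 'l) trace \<Rightarrow> nat \<Rightarrow> bool"
  where "short_hb_race \<sigma> w \<longleftrightarrow>
    (\<exists>i j. i < j \<and> j < length \<sigma> \<and> hb_race \<sigma> i j \<and> j - i + 1 \<le> w)"

definition threads :: "('t, 'x, 'l) trace \<Rightarrow> 't set"
  where "threads \<sigma> = thr ` set \<sigma>"

definition locations :: "('t, 'x, 'l) trace \<Rightarrow> 'x set"
  where "locations \<sigma> = {x. \<exists>e\<in>set \<sigma>. opn e \<in> {Read x, Write x}}"

definition locks :: "('t, 'x, 'l) trace \<Rightarrow> 'l set"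
  where "locks \<sigma> = {l. \<exists>e\<in>set \<sigma>. opn e \<in> {Acq l, Rel l}}"

record ('t, 'x, 'l) state =
  win :: "int \<Rightarrow> ('t, 'x, 'l) event option"
  head :: int
  tclock :: "'t \<Rightarrow> 't \<Rightarrow> int"
  lclock :: "'l \<Rightarrow> ('t \<Rightarrow> int) option"
  rclock :: "'x \<Rightarrow> ('t \<Rightarrow> int) option"
  epoch :: "'x \<Rightarrow> ('t \<times> int) option"
  refs :: "int \<Rightarrow> ('t + 'l) set option"
  race :: bool

definition bot_clock :: "'t \<Rightarrow> int"
  where "bot_clock = (\<lambda>_. -1)"

definition init_state :: "('t, 'x, 'l) state"
  where "init_state = \<lparr>win = (\<lambda>_. None), head = -1, tclock = (\<lambda>_. bot_clock),
    lclock = (\<lambda>_. None), rclock = (\<lambda>_. None), epoch = (\<lambda>_. None), refs = (\<lambda>_. None),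
    race = False\<rparr>"

(* Window order for head h. The value -1 is the least element, hence the conjunct
   0 \<le> b in the last case: b \<le> h < a alone would also admit b = -1 there and
   put every index above h below -1. *)

definition le_win :: "int \<Rightarrow> int \<Rightarrow> int \<Rightarrow> bool"
  where "le_win h a b \<longleftrightarrow>
    a = -1 \<or> (a \<le> b \<and> b \<le> h) \<or> (h < a \<and> a \<le> b) \<or> (0 \<le> b \<and> b \<le> h \<and> h < a)"

definition less_win :: "int \<Rightarrow> int \<Rightarrow> int \<Rightarrow> bool"
  where "less_win h a b \<longleftrightarrow> le_win h a b \<and> \<not> le_win h b a"

definition lentry :: "('t, 'x, 'l) state \<Rightarrow> 'l \<Rightarrow> 't \<Rightarrow> int option"
  where "lentry s l u = map_option (\<lambda>C. C u) (lclock s l)"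

definition rentry :: "('t, 'x, 'l) state \<Rightarrow> 'x \<Rightarrow> 't \<Rightarrow> int option"
  where "rentry s x u = map_option (\<lambda>R. R u) (rclock s x)"

definition set_tentry :: "'t \<Rightarrow> 't \<Rightarrow> int \<Rightarrow> ('t, 'x, 'l) state \<Rightarrow> ('t, 'x, 'l) state"
  where "set_tentry t u c s = s\<lparr>tclock := (tclock s)(t := (tclock s t)(u := c))\<rparr>"

definition set_lentry :: "'l \<Rightarrow> 't \<Rightarrow> int \<Rightarrow> ('t, 'x, 'l) state \<Rightarrow> ('t, 'x, 'l) state"
  where "set_lentry l u c s =
    s\<lparr>lclock := (lclock s)(l := map_option (\<lambda>C. C(u := c)) (lclock s l))\<rparr>"

definition set_rentry :: "'x \<Rightarrow> 't \<Rightarrow> int \<Rightarrow> ('t, 'x, 'l) state \<Rightarrow> ('t, 'x, 'l) state"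
  where "set_rentry x u c s =
    s\<lparr>rclock := (rclock s)(x := map_option (\<lambda>R. R(u := c)) (rclock s x))\<rparr>"

definition upd_refs ::
  "(('t + 'l) set \<Rightarrow> ('t + 'l) set) \<Rightarrow> int \<Rightarrow> ('t, 'x, 'l) state \<Rightarrow> ('t, 'x, 'l) state"
  where "upd_refs f i s =
    (if i = -1 then s else s\<lparr>refs := (refs s)(i := map_option f (refs s i))\<rparr>)"

definition epoch_ok :: "'t \<Rightarrow> 'x \<Rightarrow> ('t, 'x, 'l) state \<Rightarrow> bool"
  where "epoch_ok t x s \<longleftrightarrow> (case epoch s x of None \<Rightarrow> True
    | Some (u, c) \<Rightarrow> u = t \<or> le_win (head s) c (tclock s t u))"

definition elems :: "'a set \<Rightarrow> 'a list"
  where "elems A = (SOME xs. set xs = A \<and> distinct xs)"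

(* Cost model. The algorithm is a program over a machine which counts the elementary
   steps done so far and records the largest memory footprint of all states passed
   through, including those inside a handler. An elementary step reads or writes O(1)
   cells, or adds or removes one element of a set S_i; an operation on a whole vector
   clock is a loop over the threads or is charged one step per thread. *)

record ('t, 'x, 'l) machine =
  mem :: "('t, 'x, 'l) state"
  ticks :: nat
  peak :: nat

type_synonym ('t, 'x, 'l) prog = "('t, 'x, 'l) machine \<Rightarrow> ('t, 'x, 'l) machine"

definition spend :: "nat \<Rightarrow> ('t, 'x, 'l) prog"
  where "spend k m = m\<lparr>ticks := ticks m + k\<rparr>"

definition skip :: "('t, 'x, 'l) prog"
  where "skip m = m"

definition seq :: "('t, 'x, 'l) prog \<Rightarrow> ('t, 'x, 'l) prog \<Rightarrow> ('t, 'x, 'l) prog"  (infixr ";;" 50)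
  where "(p ;; q) m = q (p m)"

definition fetch ::
  "nat \<Rightarrow> (('t, 'x, 'l) state \<Rightarrow> 'b) \<Rightarrow> ('b \<Rightarrow> ('t, 'x, 'l) prog) \<Rightarrow> ('t, 'x, 'l) prog"
  where "fetch k g p m = p (g (mem m)) (spend k m)"

definition for_each :: "'b list \<Rightarrow> ('b \<Rightarrow> ('t, 'x, 'l) prog) \<Rightarrow> ('t, 'x, 'l) prog"
  where "for_each xs p = fold (\<lambda>x m. p x (spend 1 m)) xs"

(* bits w is the length of a code for the w + 1 values -1, ..., w - 1. *)

definition bits :: "nat \<Rightarrow> nat"
  where "bits w = nat \<lceil>log 2 (real w + 1)\<rceil>"

locale window_hb =
  fixes w :: nat and ts :: "'t list"
begin

abbreviation (input) nT :: nat
  where "nT \<equiv> length ts"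

(* An event, a name (of a thread, location or lock) and a cell of the arrays W and S
   count 1, a window index counts bits w. The summands: W and S, head and race flag,
   thread clocks, the tables of lock clocks, read clocks and epochs (only non-null
   entries are stored, under the name of the lock or location), and the elements of
   the sets S_i. *)

definition footprint :: "('t, 'x, 'l) state \<Rightarrow> nat"
  where "footprint s =
    2 * w + (bits w + 1)
    + nT * (1 + nT * bits w)
    + card (dom (lclock s)) * (1 + nT * bits w)
    + card (dom (rclock s)) * (1 + nT * bits w)
    + card (dom (epoch s)) * (2 + bits w)
    + (\<Sum>i\<in>{0..<int w}. case refs s i of None \<Rightarrow> 0 | Some A \<Rightarrow> card A)"

definition exec :: "nat \<Rightarrow> (('t, 'x, 'l) state \<Rightarrow> ('t, 'x, 'l) state) \<Rightarrow> ('t, 'x, 'l) prog"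
  where "exec k f m = (let s = f (mem m)
    in \<lparr>mem = s, ticks = ticks m + k, peak = max (peak m) (footprint s)\<rparr>)"

definition add_ref :: "int \<Rightarrow> 't + 'l \<Rightarrow> ('t, 'x, 'l) prog"
  where "add_ref i z = exec 1 (upd_refs (insert z) i)"

definition del_ref :: "int \<Rightarrow> 't + 'l \<Rightarrow> ('t, 'x, 'l) prog"
  where "del_ref i z = exec 1 (upd_refs (\<lambda>A. A - {z}) i)"

definition reads_ok :: "'t \<Rightarrow> 'x \<Rightarrow> ('t, 'x, 'l) state \<Rightarrow> bool"
  where "reads_ok t x s \<longleftrightarrow> (case rclock s x of None \<Rightarrow> True
    | Some R \<Rightarrow> (\<forall>u\<in>set ts. u \<noteq> t \<longrightarrow> le_win (head s) (R u) (tclock s t u)))"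

definition declare_race :: "('t, 'x, 'l) prog"
  where "declare_race = exec 1 (\<lambda>s. s\<lparr>race := True\<rparr>)"

definition null_rclock :: "'x \<Rightarrow> ('t, 'x, 'l) prog"
  where "null_rclock x = exec 1 (\<lambda>s. s\<lparr>rclock := (rclock s)(x := None)\<rparr>)"

definition null_lclock :: "'l \<Rightarrow> ('t, 'x, 'l) prog"
  where "null_lclock l = exec 1 (\<lambda>s. s\<lparr>lclock := (lclock s)(l := None)\<rparr>)"

definition handle_read :: "'t \<Rightarrow> 'x \<Rightarrow> ('t, 'x, 'l) prog"
  where "handle_read t x =
    (fetch 1 (epoch_ok t x) (\<lambda>ok. if ok then skip else declare_race) ;;
     fetch 1 (\<lambda>s. rclock s x = None) (\<lambda>null. if null
       then exec nT (\<lambda>s. s\<lparr>rclock := (rclock s)(x := Some bot_clock)\<rparr>) else skip) ;;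
     exec 1 (\<lambda>s. set_rentry x t (head s) s))"

definition handle_write :: "'t \<Rightarrow> 'x \<Rightarrow> ('t, 'x, 'l) prog"
  where "handle_write t x =
    (fetch (nT + 1) (\<lambda>s. reads_ok t x s \<and> epoch_ok t x s)
       (\<lambda>ok. if ok then skip else declare_race) ;;
     exec 1 (\<lambda>s. s\<lparr>epoch := (epoch s)(x := Some (t, head s))\<rparr>))"

definition handle_acq :: "'t \<Rightarrow> 'l \<Rightarrow> ('t, 'x, 'l) prog"
  where "handle_acq t l =
    fetch 1 (\<lambda>s. lclock s l = None) (\<lambda>null. if null then skip else
      (for_each ts (\<lambda>u.
         fetch 1 (\<lambda>s. the (lentry s l u)) (\<lambda>c.
         fetch 1 (\<lambda>s. tclock s t u) (\<lambda>a.
         fetch 1 (\<lambda>s. less_win (head s) a c) (\<lambda>newer. if newer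
           then (add_ref c (Inl t) ;; del_ref a (Inl t) ;; exec 1 (set_tentry t u c))
           else skip) ;;
         del_ref c (Inr l)))) ;;
       null_lclock l))"

definition handle_rel :: "'t \<Rightarrow> 'l \<Rightarrow> ('t, 'x, 'l) prog"
  where "handle_rel t l =
    (fetch 1 (\<lambda>s. tclock s t t) (\<lambda>a. del_ref a (Inl t)) ;;
     exec 1 (\<lambda>s. s\<lparr>refs := (refs s)(head s := Some {Inl t})\<rparr>) ;;
     exec 1 (\<lambda>s. set_tentry t t (head s) s) ;;
     exec nT (\<lambda>s. s\<lparr>lclock := (lclock s)(l := Some bot_clock)\<rparr>) ;;
     for_each ts (\<lambda>u.
       fetch 1 (\<lambda>s. tclock s t u) (\<lambda>a. add_ref a (Inr l) ;; exec 1 (set_lentry l u a))))"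

definition handle :: "('t, 'x, 'l) event \<Rightarrow> ('t, 'x, 'l) prog"
  where "handle e = (case opn e of
      Read x \<Rightarrow> handle_read (thr e) x
    | Write x \<Rightarrow> handle_write (thr e) x
    | Acq l \<Rightarrow> handle_acq (thr e) l
    | Rel l \<Rightarrow> handle_rel (thr e) l)"

(* R_x[u] is the index of the last read of x by u in the window, and -1 if there is
   none; so once the entry for the evicted read is cleared, no read of x remains in the
   window iff R_x has no component different from -1. *)

definition post_read :: "'t \<Rightarrow> 'x \<Rightarrow> ('t, 'x, 'l) prog"
  where "post_read t x =
    (fetch 1 (\<lambda>s. rentry s x t = Some (head s)) (\<lambda>last.
       if last then exec 1 (set_rentry x t (-1)) else skip) ;;
     fetch nT (\<lambda>s. \<forall>u\<in>set ts. rentry s x u = Some (-1)) (\<lambda>none. if none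
       then null_rclock x else skip))"

definition post_write :: "'t \<Rightarrow> 'x \<Rightarrow> ('t, 'x, 'l) prog"
  where "post_write t x =
    fetch 1 (\<lambda>s. epoch s x = Some (t, head s)) (\<lambda>last. if last
      then exec 1 (\<lambda>s. s\<lparr>epoch := (epoch s)(x := None)\<rparr>) else skip)"

(* C_l may only be dropped if the evicted release is the one that created it. The
   equation C_l[t] = h does not ensure this: if t releases l, u acquires and releases
   l, and then the release of t is evicted, C_l[t] = h holds since the release of u
   has copied the entry from C_u, and dropping C_l would lose the release of u, which is
   still in the window. With w = 6 the trace
     (t, acq l), (t, rel l), (u, acq l), (u, w x), (u, rel l), (t, r y), (t, r y),
     (v, acq l), (v, w x)
   would be reported although it has no race. Therefore it is also required that no
   entry of C_l is left after the entries referring to the evicted release are cleared;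
   if C_l stems from a later release by u, then C_l[u] is left. *)

definition post_rel :: "'t \<Rightarrow> 'l \<Rightarrow> ('t, 'x, 'l) prog"
  where "post_rel t l =
    (fetch 1 (\<lambda>s. lentry s l t = Some (head s)) (\<lambda>own.
       fetch 1 (\<lambda>s. case refs s (head s) of None \<Rightarrow> {} | Some A \<Rightarrow> A) (\<lambda>A.
         for_each (elems A) (\<lambda>z. case z of
             Inl u \<Rightarrow> exec 1 (set_tentry u t (-1))
           | Inr m \<Rightarrow> exec 1 (set_lentry m t (-1)))) ;;
       fetch nT (\<lambda>s. \<forall>u\<in>set ts. lentry s l u = Some (-1)) (\<lambda>cleared.
         if own \<and> cleared
         then (for_each ts (\<lambda>u. fetch 1 (\<lambda>s. the (lentry s l u)) (\<lambda>c. del_ref c (Inr l))) ;;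
               null_lclock l)
         else skip)) ;;
     exec 1 (\<lambda>s. s\<lparr>refs := (refs s)(head s := None)\<rparr>))"

definition post_handle :: "('t, 'x, 'l) event \<Rightarrow> ('t, 'x, 'l) prog"
  where "post_handle e = (case opn e of
      Read x \<Rightarrow> post_read (thr e) x
    | Write x \<Rightarrow> post_write (thr e) x
    | Acq l \<Rightarrow> skip
    | Rel l \<Rightarrow> post_rel (thr e) l)"

definition process :: "('t, 'x, 'l) event \<Rightarrow> ('t, 'x, 'l) prog"
  where "process e =
    (exec 1 (\<lambda>s. s\<lparr>head := (head s + 1) mod int w\<rparr>) ;;
     fetch 1 (\<lambda>s. win s (head s)) (\<lambda>out. case out of None \<Rightarrow> skip | Some e' \<Rightarrow> post_handle e') ;;
     handle e ;;
     exec 1 (\<lambda>s. s\<lparr>win := (win s)(head s := Some e)\<rparr>))"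

(* Initialising the thread clocks is charged; arrays are allocated as null. *)

definition init_machine :: "('t, 'x, 'l) machine"
  where "init_machine =
    \<lparr>mem = init_state, ticks = nT * nT, peak = footprint (init_state :: ('t, 'x, 'l) state)\<rparr>"

end

definition WindowHB :: "nat \<Rightarrow> ('t, 'x, 'l) trace \<Rightarrow> ('t, 'x, 'l) machine"
  where "WindowHB w \<sigma> = (let ts = remdups (map thr \<sigma>)
    in fold (window_hb.process w ts) \<sigma> (window_hb.init_machine w ts))"

definition answer :: "nat \<Rightarrow> ('t, 'x, 'l) trace \<Rightarrow> bool"
  where "answer w \<sigma> \<longleftrightarrow> race (mem (WindowHB w \<sigma>))"

definition running_time :: "nat \<Rightarrow> ('t, 'x, 'l) trace \<Rightarrow> nat"
  where "running_time w \<sigma> = ticks (WindowHB w \<sigma>)"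

definition space :: "nat \<Rightarrow> ('t, 'x, 'l) trace \<Rightarrow> nat"
  where "space w \<sigma> = peak (WindowHB w \<sigma>)"

end

theory Submission
  imports Defs
begin

text \<open>A path of the happens-before order leaves a thread only through a release. So an access
  \<open>i\<close> of thread \<open>u\<close> is ordered before an access of another thread \<open>t\<close> iff some release of \<open>u\<close>
  after \<open>i\<close> is ordered before an earlier event of \<open>t\<close>. It therefore suffices that \<open>C\<^sub>t[u]\<close> points
  to the last such release inside the window: happens-before itself need not be cut down to the
  window. While a lock clock is not null, it belongs to the last release of the lock, since
  well-formedness puts an acquire between two releases; an acquire which finds it null learns
  nothing new about the window, as the last release is evicted or was already acquired by the same
  thread. Checking only the last write is enough, because a masked race implies another short race
  which ends earlier.

  For the running time, every element of a set \<open>S\<^sub>i\<close> pays in advance for its removal when the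
  release at \<open>i\<close> is evicted.\<close>

section \<open>Window positions\<close>

text \<open>The array is circular, but the reasoning is linear: a prescribed clock entry is the last
  absolute position of an interval \<open>lo..<n\<close> with some property, and \<open>idx\<close>
  reduces it modulo \<open>w\<close> only at the end. Eviction and handling then move one end of the
  interval each, and joining two clocks becomes the union of two properties. The ends move
  separately because the handler of event \<open>n\<close> runs after the eviction: at that time at
  most \<open>w - 1\<close> old positions remain, none congruent to \<open>n\<close>, and the window
  order with head \<open>n mod w\<close> agrees with the order of positions.

  An evicted \<open>S_i\<close> may have many more than \<open>T\<close> elements, since lock clocks
  refer to releases too; the weight 2 of the potential is one loop step and one clearing step per
  element. For space, \<open>peak\<close> also sees states in the middle of a handler, which satisfy
  no invariant. So the cost calculus bounds the growth within one event, while the invariant bounds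
  the footprint between events, where each element of an \<open>S_i\<close> corresponds to one clock
  entry.\<close>

primrec lastpos :: "nat \<Rightarrow> nat \<Rightarrow> (nat \<Rightarrow> bool) \<Rightarrow> nat option" where
  "lastpos lo 0 P = None"
| "lastpos lo (Suc n) P = (if lo \<le> n \<and> P n then Some n else lastpos lo n P)"

lemma lastpos_None: "lastpos lo hi P = None \<longleftrightarrow> (\<forall>p. lo \<le> p \<and> p < hi \<longrightarrow> \<not> P p)"
  by (induction hi) (auto simp: less_Suc_eq)

lemma lastpos_Some:
  "lastpos lo hi P = Some p \<longleftrightarrow> lo \<le> p \<and> p < hi \<and> P p \<and> (\<forall>q. p < q \<and> q < hi \<longrightarrow> \<not> P q)"
  by (induction hi) (auto simp: less_Suc_eq)

text \<open>Raising the lower end can only lose a last position equal to \<open>lo\<close>; any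
  larger one survives. This is the effect of an eviction on every entry.\<close>

lemma lastpos_Suc_lo:
  "lastpos (Suc lo) hi P = (if lastpos lo hi P = Some lo then None else lastpos lo hi P)"
  by (induction hi) (auto simp: le_Suc_eq not_less_eq_eq lastpos_None lastpos_Some)

lemma lastpos_cong:
  assumes "\<And>p. lo \<le> p \<Longrightarrow> p < hi \<Longrightarrow> P p = Q p"
  shows "lastpos lo hi P = lastpos lo hi Q"
  using assms by (induction hi) auto

text \<open>The difference would be a multiple of \<open>w\<close> smaller than \<open>w\<close>. So
  within a window an index names a single position.\<close>

lemma mod_eq_window:
  fixes p q w :: nat
  assumes "p mod w = q mod w" "p < q + w" "q < p + w"
  shows "p = q"
proof -
  have *: "a = b" if "a mod w = b mod w" "a \<le> b" "b < a + w" for a b :: nat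
  proof -
    have "w dvd b - a" using that by (metis mod_eq_dvd_iff_nat)
    then show ?thesis using that by (auto dest: dvd_imp_le)
  qed
  show ?thesis using *[of p q] *[of q p] assms by linarith
qed

text \<open>The index of \<open>r\<close> is \<open>n mod w\<close> minus the age
  \<open>n - r\<close>, plus \<open>w\<close> if this is negative. Indices up to the head thus hold
  the newer positions and indices above it the older ones, each group in increasing order, which is
  how \<open>le_win\<close> reads them.\<close>

lemma le_win_mod:
  assumes "p \<le> n" "q \<le> n" "n < p + w" "n < q + w"
  shows "le_win (int (n mod w)) (int (p mod w)) (int (q mod w)) \<longleftrightarrow> p \<le> q"
proof -
  have w: "w > 0" using assms by linarith
  \<comment> \<open>Both branches add before they subtract \<open>n\<close>, so subtraction on
    naturals never truncates.\<close>
  have *: "r mod w = (if n mod w + r \<ge> n then r + n mod w - n else r + n mod w + w - n)"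
    if "r \<le> n" "n < r + w" for r
  proof -
    let ?d = "n - r"
    have n: "n = w * (n div w) + n mod w" by simp
    show ?thesis
    proof (cases "n mod w + r \<ge> n")
      case True
      then have "r = w * (n div w) + (r + n mod w - n)" using n by linarith
      moreover have "r + n mod w - n < w" using that w mod_less_divisor[OF w, of n] by linarith
      ultimately have "r mod w = r + n mod w - n" by (metis mod_mult_self4 mod_less)
      then show ?thesis using True by simp
    next
      case False
      then have "n div w \<noteq> 0" using n by (metis add.left_neutral le_add1 mult_0_right)
      then obtain k where k: "n div w = Suc k" by (cases "n div w") auto
      have "r = w * k + (r + n mod w + w - n)" using n k that by simp
      moreover have "r + n mod w + w - n < w" using False w by linarith
      ultimately have "r mod w = r + n mod w + w - n" by (metis mod_mult_self4 mod_less)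
      then show ?thesis using False by simp
    qed
  qed
  have "n mod w < w" using w by simp
  then show ?thesis
    using *[OF assms(1,3)] *[OF assms(2,4)] assms unfolding le_win_def
    by (auto split: if_splits)
qed

definition idx :: "nat \<Rightarrow> nat option \<Rightarrow> int"
  where "idx w = case_option (-1) (\<lambda>p. int (p mod w))"

lemma idx_simps [simp]: "idx w None = -1" "idx w (Some p) = int (p mod w)"
  by (simp_all add: idx_def)

lemma idx_eq_minus1 [simp]: "idx w z = -1 \<longleftrightarrow> z = None"
  by (cases z) auto

lemma idx_eq_mod:
  assumes "lo \<le> p" "p < hi" "hi \<le> lo + w"
  shows "idx w (lastpos lo hi P) = int (p mod w) \<longleftrightarrow> lastpos lo hi P = Some p"
proof (cases "lastpos lo hi P")
  case (Some q)
  then have "lo \<le> q" "q < hi" by (auto simp: lastpos_Some)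
  then show ?thesis using Some assms mod_eq_window[of q w p] by auto
qed auto

lemma idx_Suc_lo:
  assumes "lo < hi" "hi \<le> lo + w"
  shows "idx w (lastpos (Suc lo) hi P) =
    (if idx w (lastpos lo hi P) = int (lo mod w) then -1 else idx w (lastpos lo hi P))"
  using assms by (simp add: idx_eq_mod lastpos_Suc_lo)

text \<open>The comparison a handler makes between an access \<open>i\<close> and a clock entry. The
  strict bound \<open>n < lo + w\<close> expresses that the slot of \<open>n\<close> was vacated
  before the test.\<close>

lemma le_win_idx:
  assumes "lo \<le> i" "i < n" "n < lo + w"
  shows "le_win (int (n mod w)) (int (i mod w)) (idx w (lastpos lo n P)) \<longleftrightarrow>
    (\<exists>p. i \<le> p \<and> p < n \<and> P p)"
proof (cases "lastpos lo n P")
  case None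
  then have "\<not> (\<exists>p. i \<le> p \<and> p < n \<and> P p)" using assms by (auto simp: lastpos_None)
  then show ?thesis using None by (auto simp: le_win_def)
next
  case (Some q)
  then have q: "lo \<le> q" "q < n" "P q" "\<forall>p. q < p \<and> p < n \<longrightarrow> \<not> P p" by (auto simp: lastpos_Some)
  have "le_win (int (n mod w)) (int (i mod w)) (int (q mod w)) \<longleftrightarrow> i \<le> q"
    using q assms by (intro le_win_mod) auto
  moreover have "i \<le> q \<longleftrightarrow> (\<exists>p. i \<le> p \<and> p < n \<and> P p)"
    using q by (meson leI order_trans)
  ultimately show ?thesis using Some by simp
qed

text \<open>Domination of one set of positions by another replaces the comparison of two optional
  positions: a missing entry is an empty set and needs no case of its own later.\<close>

lemma le_win_idx_idx:
  assumes "n < lo + w"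
  shows "le_win (int (n mod w)) (idx w (lastpos lo n P)) (idx w (lastpos lo n Q)) \<longleftrightarrow>
    (\<forall>p. lo \<le> p \<and> p < n \<and> P p \<longrightarrow> (\<exists>q. p \<le> q \<and> q < n \<and> Q q))"
proof (cases "lastpos lo n P")
  case None
  then show ?thesis by (auto simp add: le_win_def lastpos_None)
next
  case (Some p)
  then have p: "lo \<le> p" "p < n" "P p" "\<And>q. q < n \<Longrightarrow> P q \<Longrightarrow> q \<le> p"
    by (auto simp: lastpos_Some) (meson not_less)
  have "le_win (int (n mod w)) (int (p mod w)) (idx w (lastpos lo n Q)) \<longleftrightarrow>
    (\<exists>q. p \<le> q \<and> q < n \<and> Q q)"
    using p assms by (intro le_win_idx) auto
  also have "\<dots> \<longleftrightarrow> (\<forall>p. lo \<le> p \<and> p < n \<and> P p \<longrightarrow> (\<exists>q. p \<le> q \<and> q < n \<and> Q q))"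
  proof
    assume "\<exists>q. p \<le> q \<and> q < n \<and> Q q"
    then obtain q where "p \<le> q" "q < n" "Q q" by blast
    then have "p' \<le> q" if "p' < n" "P p'" for p' using p(4)[OF that] by simp
    then show "\<forall>p. lo \<le> p \<and> p < n \<and> P p \<longrightarrow> (\<exists>q. p \<le> q \<and> q < n \<and> Q q)"
      using \<open>q < n\<close> \<open>Q q\<close> by blast
  qed (use p in blast)
  finally show ?thesis using Some by simp
qed

lemma lastpos_disj:
  assumes "\<forall>p. lo \<le> p \<and> p < n \<and> P p \<longrightarrow> (\<exists>q. p \<le> q \<and> q < n \<and> Q q)"
  shows "lastpos lo n (\<lambda>p. P p \<or> Q p) = lastpos lo n Q"
proof (cases "lastpos lo n Q")
  case None
  then have "\<not> Q q" if "lo \<le> q" "q < n" for q using that by (simp add: lastpos_None)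
  then show ?thesis using assms by (intro lastpos_cong) (meson le_trans)
next
  case (Some a)
  then have a: "lo \<le> a" "a < n" "Q a" "\<And>q. a < q \<Longrightarrow> q < n \<Longrightarrow> \<not> Q q" by (auto simp: lastpos_Some)
  have "\<not> P q" if q: "a < q" "q < n" for q
  proof
    assume "P q"
    moreover have "lo \<le> q" using a(1) q by simp
    ultimately obtain r where "q \<le> r" "r < n" "Q r" using assms q by blast
    then show False using a(4)[of r] q by simp
  qed
  with a have "lastpos lo n (\<lambda>p. P p \<or> Q p) = Some a" by (auto simp: lastpos_Some)
  with Some show ?thesis by simp
qed

text \<open>The conditional update of an acquire computes the last position of a union of two sets,
  which is the join of two clock components.\<close>

lemma idx_disj:
  assumes "n < lo + w"
  shows "idx w (lastpos lo n (\<lambda>p. P p \<or> Q p)) =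
    (if less_win (int (n mod w)) (idx w (lastpos lo n P)) (idx w (lastpos lo n Q))
     then idx w (lastpos lo n Q) else idx w (lastpos lo n P))"
proof (cases "less_win (int (n mod w)) (idx w (lastpos lo n P)) (idx w (lastpos lo n Q))")
  case True
  then have "\<forall>p. lo \<le> p \<and> p < n \<and> P p \<longrightarrow> (\<exists>q. p \<le> q \<and> q < n \<and> Q q)"
    by (simp add: less_win_def le_win_idx_idx[OF assms])
  then have "lastpos lo n (\<lambda>p. P p \<or> Q p) = lastpos lo n Q" by (rule lastpos_disj)
  with True show ?thesis by simp
next
  case False
  \<comment> \<open>If neither set dominated the other, each would have a position beyond all of the
    other.\<close>
  have tot: "(\<forall>p. lo \<le> p \<and> p < n \<and> P p \<longrightarrow> (\<exists>q. p \<le> q \<and> q < n \<and> Q q)) \<or>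
     (\<forall>p. lo \<le> p \<and> p < n \<and> Q p \<longrightarrow> (\<exists>q. p \<le> q \<and> q < n \<and> P q))"
  proof (rule ccontr)
    assume "\<not> ?thesis"
    then obtain p q where "p < n" "P p" "\<forall>q. p \<le> q \<and> q < n \<longrightarrow> \<not> Q q"
      "q < n" "Q q" "\<forall>p. q \<le> p \<and> p < n \<longrightarrow> \<not> P p" by blast
    then show False using linear[of p q] by blast
  qed
  with False have "\<forall>p. lo \<le> p \<and> p < n \<and> Q p \<longrightarrow> (\<exists>q. p \<le> q \<and> q < n \<and> P q)"
    by (auto simp add: less_win_def le_win_idx_idx[OF assms])
  then have "lastpos lo n (\<lambda>p. P p \<or> Q p) = lastpos lo n P"
    using lastpos_disj[of lo n Q P] by (simp add: disj_commute)
  with False show ?thesis by simp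
qed

section \<open>The happens-before order\<close>

text \<open>Base edges never point backwards and include all loops \<open>(i, i)\<close>, so their
  transitive closure is already antisymmetric and reflexive: it is one of the partial orders
  intersected in \<open>hb\<close>, and the smallest.\<close>

lemma hb_eq: "hb \<sigma> = (hb_base \<sigma>)\<^sup>+"
proof
  have le: "i \<le> j" if "(i, j) \<in> (hb_base \<sigma>)\<^sup>+" for i j
    using that by (induction rule: trancl_induct) (auto simp: hb_base_def)
  have sub: "(hb_base \<sigma>)\<^sup>+ \<subseteq> {..<length \<sigma>} \<times> {..<length \<sigma>}"
    by (rule trancl_subset_Sigma) (auto simp: hb_base_def)
  have "partial_order_on {..<length \<sigma>} ((hb_base \<sigma>)\<^sup>+)"
    unfolding partial_order_on_def preorder_on_def
    using sub by (auto simp: refl_on_def hb_base_def intro!: antisymI dest!: le[unfolded hb_base_def])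
  then show "hb \<sigma> \<subseteq> (hb_base \<sigma>)\<^sup>+"
    unfolding hb_def by (intro Inter_lower) auto
  show "(hb_base \<sigma>)\<^sup>+ \<subseteq> hb \<sigma>"
    unfolding hb_def
  proof (intro Inter_greatest)
    fix r assume "r \<in> {r. partial_order_on {..<length \<sigma>} r \<and> hb_base \<sigma> \<subseteq> r}"
    then have "trans r" "hb_base \<sigma> \<subseteq> r" by (auto simp: order_on_defs)
    then show "(hb_base \<sigma>)\<^sup>+ \<subseteq> r" by (metis trancl_id trancl_mono_subset)
  qed
qed

lemma hb_le: "(i, j) \<in> hb \<sigma> \<Longrightarrow> i \<le> j \<and> j < length \<sigma>"
  unfolding hb_eq by (induction rule: trancl_induct) (auto simp: hb_base_def)

lemma hb_trans: "(i, j) \<in> hb \<sigma> \<Longrightarrow> (j, k) \<in> hb \<sigma> \<Longrightarrow> (i, k) \<in> hb \<sigma>"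
  unfolding hb_eq by (rule trancl_trans)

lemma hb_base_hb: "(i, j) \<in> hb_base \<sigma> \<Longrightarrow> (i, j) \<in> hb \<sigma>"
  unfolding hb_eq by blast

lemma hb_thr: "i \<le> j \<Longrightarrow> j < length \<sigma> \<Longrightarrow> thr (\<sigma> ! i) = thr (\<sigma> ! j) \<Longrightarrow> (i, j) \<in> hb \<sigma>"
  by (rule hb_base_hb) (auto simp: hb_base_def)

lemma hb_lock:
  "i \<le> j \<Longrightarrow> j < length \<sigma> \<Longrightarrow> opn (\<sigma> ! i) = Rel l \<Longrightarrow> opn (\<sigma> ! j) = Acq l \<Longrightarrow> (i, j) \<in> hb \<sigma>"
  by (rule hb_base_hb) (auto simp: hb_base_def)

text \<open>As \<open>hb_base\<close> contains loops, the last edge of a path may stand still; such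
  edges are dropped until one starts strictly before \<open>j\<close>.\<close>

lemma hb_last_step:
  assumes "(i, j) \<in> hb \<sigma>" "i \<noteq> j"
  shows "\<exists>k<j. (i, k) \<in> hb \<sigma> \<and> (k, j) \<in> hb_base \<sigma>"
  using assms unfolding hb_eq
proof (induction rule: trancl_induct)
  case (base j)
  moreover have "i < j" "(i, i) \<in> hb_base \<sigma>" using base by (auto simp: hb_base_def)
  ultimately show ?case by blast
next
  case (step k j)
  show ?case
  proof (cases "k = j")
    case False
    then have "k < j" using step by (auto simp: hb_base_def)
    then show ?thesis using step by blast
  qed (use step in simp)
qed

text \<open>The induction takes as \<open>p\<close> the source of the last edge by which the path
  leaves the thread of \<open>i\<close>; such an edge can only lead from a release to an
  acquire.\<close>

lemma hb_leaves_thread: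
  assumes "(i, j) \<in> hb \<sigma>" "thr (\<sigma> ! j) \<noteq> thr (\<sigma> ! i)"
  shows "\<exists>p\<ge>i. thr (\<sigma> ! p) = thr (\<sigma> ! i) \<and> (\<exists>l. opn (\<sigma> ! p) = Rel l) \<and> (p, j) \<in> hb \<sigma>"
  using assms unfolding hb_eq
proof (induction rule: trancl_induct)
  case (base j)
  then show ?case by (auto simp: hb_base_def intro!: exI[of _ i])
next
  case (step k j)
  show ?case
  proof (cases "thr (\<sigma> ! k) = thr (\<sigma> ! i)")
    case True
    have "i \<le> k" using step hb_le[of i k \<sigma>] by (simp add: hb_eq)
    moreover have "\<exists>l. opn (\<sigma> ! k) = Rel l" using step True by (auto simp: hb_base_def)
    ultimately show ?thesis using True step by blast
  next
    case False
    then show ?thesis using step by (meson trancl.trancl_into_trancl)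
  qed
qed

lemma event_eq_iff: "e = (t, o') \<longleftrightarrow> thr e = t \<and> opn e = o'"
  by (cases e) (auto simp: thr_def opn_def)

lemma well_formed_acqD:
  assumes "well_formed \<sigma>" "i < length \<sigma>" "\<sigma> ! i = (t, Acq l)" "holds \<sigma> i u l"
  shows "u = t"
  using assms(1)[unfolded well_formed_def, rule_format, OF assms(2), of t l] assms(3,4) by auto

lemma well_formed_relD:
  assumes "well_formed \<sigma>" "i < length \<sigma>" "\<sigma> ! i = (t, Rel l)"
  shows "holds \<sigma> i t l"
  using assms(1)[unfolded well_formed_def, rule_format, OF assms(2), of t l] assms(3) by auto

text \<open>A release of \<open>l\<close> between the acquire \<open>j\<close> and \<open>r\<close>
  would belong to another thread, which needs an acquire \<open>i\<close> of its own. Whichever of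
  \<open>i\<close> and \<open>j\<close> comes later finds the lock held by the other thread, against
  mutual exclusion.\<close>

lemma rel_preceded_by_acq:
  assumes wf: "well_formed \<sigma>" and r: "r < length \<sigma>" "opn (\<sigma> ! r) = Rel l"
  shows "\<exists>j<r. \<sigma> ! j = (thr (\<sigma> ! r), Acq l) \<and> (\<forall>q. j < q \<and> q < r \<longrightarrow> opn (\<sigma> ! q) \<noteq> Rel l)"
proof -
  let ?t = "thr (\<sigma> ! r)"
  have excl: False if "i < r" "\<sigma> ! i = (t, Acq l)" "u \<noteq> t" "holds \<sigma> i u l" for i t u
    using well_formed_acqD[OF wf _ that(2,4)] that r by auto
  have hold: "holds \<sigma> q (thr (\<sigma> ! q)) l" if "q \<le> r" "opn (\<sigma> ! q) = Rel l" for q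
  proof -
    have "\<sigma> ! q = (thr (\<sigma> ! q), Rel l)" using that by (simp add: event_eq_iff)
    then show ?thesis using well_formed_relD[OF wf] that r by auto
  qed
  obtain j where j: "j < r" "\<sigma> ! j = (?t, Acq l)" "\<And>k. j < k \<Longrightarrow> k < r \<Longrightarrow> \<sigma> ! k \<noteq> (?t, Rel l)"
    using hold[of r] r by (auto simp: holds_def)
  have "opn (\<sigma> ! q) \<noteq> Rel l" if q: "j < q" "q < r" for q
  proof
    assume rel: "opn (\<sigma> ! q) = Rel l"
    let ?u = "thr (\<sigma> ! q)"
    have ut: "?u \<noteq> ?t" using j(3)[OF q] rel by (auto simp: event_eq_iff)
    obtain i where i: "i < q" "\<sigma> ! i = (?u, Acq l)" "\<And>k. i < k \<Longrightarrow> k < q \<Longrightarrow> \<sigma> ! k \<noteq> (?u, Rel l)"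
      using hold[of q] rel q by (auto simp: holds_def)
    have "i \<noteq> j" using i j ut by auto
    then consider "j < i" | "i < j" by linarith
    then show False
    proof cases
      case 1
      then have "holds \<sigma> i ?t l" using j i q by (auto simp: holds_def)
      then show False using excl[of i ?u ?t] i q ut by auto
    next
      case 2
      then have "holds \<sigma> j ?u l" using j i q by (auto simp: holds_def)
      then show False using excl[of j ?t ?u] j ut by auto
    qed
  qed
  then show ?thesis using j by blast
qed

text \<open>The acquire belonging to the later release has no release of \<open>l\<close> between
  itself and \<open>r\<close>, so \<open>q\<close> precedes it and the order passes through it.
  Hence the last release of a lock stands for all earlier ones.\<close>

lemma hb_rel_rel:
  assumes "well_formed \<sigma>" "q \<le> r" "r < length \<sigma>" "opn (\<sigma> ! q) = Rel l" "opn (\<sigma> ! r) = Rel l"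
  shows "(q, r) \<in> hb \<sigma>"
proof (cases "q = r")
  case True
  then show ?thesis using assms by (simp add: hb_thr)
next
  case False
  obtain j where j: "j < r" "\<sigma> ! j = (thr (\<sigma> ! r), Acq l)"
      "\<forall>q. j < q \<and> q < r \<longrightarrow> opn (\<sigma> ! q) \<noteq> Rel l"
    using rel_preceded_by_acq[OF assms(1,3,5)] by blast
  have "q \<noteq> j" "\<not> j < q" using j assms False by (auto simp: opn_def)
  then have "(q, j) \<in> hb \<sigma>" using j assms by (intro hb_lock) (auto simp: opn_def)
  moreover have "(j, r) \<in> hb \<sigma>" using j assms by (intro hb_thr) (auto simp: thr_def)
  ultimately show ?thesis by (rule hb_trans)
qed

text \<open>Well-formedness lets a thread acquire a lock it already holds, so two acquires without a
  release in between are possible, but only by one thread. This settles the acquire whose lock clock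
  was consumed by an earlier acquire.\<close>

lemma acq_acq_same_thread:
  assumes "well_formed \<sigma>" "a < n" "n < length \<sigma>" "opn (\<sigma> ! a) = Acq l" "opn (\<sigma> ! n) = Acq l"
    "\<And>k. a < k \<Longrightarrow> k < n \<Longrightarrow> opn (\<sigma> ! k) \<noteq> Rel l"
  shows "thr (\<sigma> ! a) = thr (\<sigma> ! n)"
proof (rule ccontr)
  assume ne: "thr (\<sigma> ! a) \<noteq> thr (\<sigma> ! n)"
  have "holds \<sigma> n (thr (\<sigma> ! a)) l"
    unfolding holds_def using assms by (auto simp: event_eq_iff)
  moreover have "\<sigma> ! n = (thr (\<sigma> ! n), Acq l)" using assms by (simp add: event_eq_iff)
  ultimately show False using well_formed_acqD[OF assms(1,3)] ne by blast
qed

section \<open>Resource consumption\<close>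

lemma mem_spend [simp]: "mem (spend k m) = mem m"
  and ticks_spend [simp]: "ticks (spend k m) = ticks m + k"
  and peak_spend [simp]: "peak (spend k m) = peak m"
  by (simp_all add: spend_def)

section \<open>Potential and footprint under single state updates\<close>

definition pot :: "nat \<Rightarrow> int set \<Rightarrow> ('t, 'x, 'l) state \<Rightarrow> nat"
  where "pot w X s = (\<Sum>i\<in>{0..<int w} - X. case refs s i of None \<Rightarrow> 0 | Some A \<Rightarrow> card A)"

text \<open>Infinite sets have cardinality 0 and no enumeration by \<open>elems\<close>, so
  amortised bounds are claimed only from states whose sets are finite.\<close>

definition fin_refs :: "('t, 'x, 'l) state \<Rightarrow> bool"
  where "fin_refs s \<longleftrightarrow> (\<forall>i A. refs s i = Some A \<longrightarrow> finite A)"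

lemma fin_refs_upd_refs:
  "fin_refs s \<Longrightarrow> (\<And>A. finite A \<Longrightarrow> finite (f A)) \<Longrightarrow> fin_refs (upd_refs f i s)"
  by (auto simp: fin_refs_def upd_refs_def)

lemma pot_refs_cong: "refs s = refs s' \<Longrightarrow> pot w X s = pot w X s'"
  by (simp add: pot_def)

lemma pot_upd_le:
  assumes "\<And>i. i \<noteq> j \<Longrightarrow> refs s' i = refs s i"
    "(case refs s' j of None \<Rightarrow> 0 | Some A \<Rightarrow> card A) \<le> (case refs s j of None \<Rightarrow> 0 | Some A \<Rightarrow> card A) + d"
  shows "pot w X s' \<le> pot w X s + d"
proof -
  let ?I = "{0..<int w} - X"
  let ?f = "\<lambda>s i. case refs s i of None \<Rightarrow> 0 | Some A \<Rightarrow> card A"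
  have eq: "sum (?f s') (?I - {j}) = sum (?f s) (?I - {j})"
    using assms(1) by (intro sum.cong) auto
  show ?thesis
  proof (cases "j \<in> ?I")
    case True
    then show ?thesis using assms(2) eq by (simp add: pot_def sum.remove[of ?I j])
  next
    case False
    then have "sum (?f s') ?I = sum (?f s) ?I" using eq by (simp add: Diff_triv)
    then show ?thesis by (simp add: pot_def)
  qed
qed

lemma pot_upd_refs_insert: "pot w X (upd_refs (insert z) i s) \<le> Suc (pot w X s)"
  unfolding Suc_eq_plus1
  by (rule pot_upd_le[of i]) (auto simp: upd_refs_def card_insert_le_m1 card_insert_if split: option.split)

lemma pot_upd_refs_remove: "pot w X (upd_refs (\<lambda>A. A - {z}) i s) \<le> pot w X s"
  using pot_upd_le[of i "upd_refs (\<lambda>A. A - {z}) i s" s 0 w X]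
  by (auto simp: upd_refs_def card_Diff1_le split: option.split)

lemma pot_remove:
  assumes "h \<in> {0..<int w}"
  shows "pot w {} s = pot w {h} s + (case refs s h of None \<Rightarrow> 0 | Some A \<Rightarrow> card A)"
  using assms by (simp add: pot_def sum.remove[of "{0..<int w}" h])

lemma card_dom_update: "card (dom (f(x := y))) \<le> Suc (card (dom f))"
proof -
  have "dom (f(x := y)) \<subseteq> insert x (dom f)" by auto
  show ?thesis
  proof (cases "finite (dom f)")
    case True
    have "card (dom (f(x := y))) \<le> card (insert x (dom f))"
      using True by (intro card_mono) auto
    also have "\<dots> \<le> Suc (card (dom f))" using True by (simp add: card_insert_if)
    finally show ?thesis .
  next
    \<comment> \<open>The cost rules quantify over all states, also those with infinite tables; the
      updated table is then infinite too and has cardinality 0.\<close>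
    case False
    moreover have "dom f \<subseteq> insert x (dom (f(x := y)))" by auto
    ultimately have "infinite (dom (f(x := y)))" by (meson finite_insert finite_subset)
    then show ?thesis by (simp del: dom_fun_upd)
  qed
qed

lemma card_dom_None: "card (dom (f(x := None))) \<le> card (dom f)"
  by (simp add: card_Diff1_le)

lemma dom_set_lentry [simp]: "dom (lclock (set_lentry l u c s)) = dom (lclock s)"
  and dom_set_rentry [simp]: "dom (rclock (set_rentry x u c s)) = dom (rclock s)"
  by (auto simp: set_lentry_def set_rentry_def split: if_splits)

lemma state_upd_refs [simp]:
  "head (upd_refs f i s) = head s" "win (upd_refs f i s) = win s"
  "tclock (upd_refs f i s) = tclock s" "lclock (upd_refs f i s) = lclock s"
  "rclock (upd_refs f i s) = rclock s" "epoch (upd_refs f i s) = epoch s"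
  "race (upd_refs f i s) = race s"
  by (simp_all add: upd_refs_def)

lemma state_set_tentry [simp]:
  "head (set_tentry t u c s) = head s" "win (set_tentry t u c s) = win s"
  "refs (set_tentry t u c s) = refs s" "lclock (set_tentry t u c s) = lclock s"
  "rclock (set_tentry t u c s) = rclock s" "epoch (set_tentry t u c s) = epoch s"
  "race (set_tentry t u c s) = race s"
  by (simp_all add: set_tentry_def)

lemma state_set_lentry [simp]:
  "head (set_lentry l u c s) = head s" "win (set_lentry l u c s) = win s"
  "refs (set_lentry l u c s) = refs s" "tclock (set_lentry l u c s) = tclock s"
  "rclock (set_lentry l u c s) = rclock s" "epoch (set_lentry l u c s) = epoch s"
  "race (set_lentry l u c s) = race s"
  by (simp_all add: set_lentry_def)

lemma state_set_rentry [simp]: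
  "head (set_rentry x u c s) = head s" "win (set_rentry x u c s) = win s"
  "refs (set_rentry x u c s) = refs s" "tclock (set_rentry x u c s) = tclock s"
  "lclock (set_rentry x u c s) = lclock s" "epoch (set_rentry x u c s) = epoch s"
  "race (set_rentry x u c s) = race s"
  by (simp_all add: set_rentry_def)

lemma elems:
  assumes "finite A"
  shows "set (elems A) = A" "length (elems A) = card A" "distinct (elems A)"
proof -
  have "\<exists>xs. set xs = A \<and> distinct xs" using finite_distinct_list[OF assms] .
  then have "set (elems A) = A \<and> distinct (elems A)"
    unfolding elems_def by (rule someI_ex)
  then show "set (elems A) = A" "length (elems A) = card A" "distinct (elems A)"
    by (auto dest: distinct_card)
qed

context window_hb
begin

section \<open>Amortised cost calculus\<close>

lemma mem_exec [simp]: "mem (exec k f m) = f (mem m)"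
  and ticks_exec [simp]: "ticks (exec k f m) = ticks m + k"
  and peak_exec [simp]: "peak (exec k f m) = max (peak m) (footprint (f (mem m)))"
  by (simp_all add: exec_def Let_def)

text \<open>The sets \<open>S\<^sub>i\<close> with \<open>i \<in> X\<close> are left out of the potential: the loop over the set of an
  evicted release costs as many steps as that set has elements, and these are paid for by
  clearing the set at the end.\<close>

definition cost_on :: "int set \<Rightarrow> nat \<Rightarrow> nat \<Rightarrow> ('t, 'x, 'l) machine \<Rightarrow> ('t, 'x, 'l) machine \<Rightarrow> bool"
  where "cost_on X a g m m' \<longleftrightarrow> (fin_refs (mem m) \<longrightarrow>
    fin_refs (mem m') \<and> head (mem m') = head (mem m) \<and>
    ticks m' + 2 * pot w X (mem m') \<le> ticks m + 2 * pot w X (mem m) + a \<and>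
    footprint (mem m') \<le> footprint (mem m) + g \<and>
    peak m' \<le> max (peak m) (footprint (mem m) + g))"

definition cost :: "nat \<Rightarrow> nat \<Rightarrow> ('t, 'x, 'l) prog \<Rightarrow> bool"
  where "cost a g p \<longleftrightarrow> (\<forall>X m. cost_on X a g m (p m))"

lemma cost_onD: "cost a g p \<Longrightarrow> cost_on X a g m (p m)"
  by (simp add: cost_def)

lemma cost_on_refl: "cost_on X 0 0 m m"
  by (simp add: cost_on_def)

text \<open>Growth bounds add: the peak of the second program is measured from a footprint which may
  already have grown by \<open>g\<close>.\<close>

lemma cost_on_trans:
  "cost_on X a g m m' \<Longrightarrow> cost_on X a' g' m' m'' \<Longrightarrow> cost_on X (a + a') (g + g') m m''"
  unfolding cost_on_def by (auto simp: max_def split: if_splits)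

lemma cost_on_mono: "cost_on X a g m m' \<Longrightarrow> a \<le> a' \<Longrightarrow> g \<le> g' \<Longrightarrow> cost_on X a' g' m m'"
  unfolding cost_on_def by (auto simp: max_def split: if_splits)

lemma cost_on_spend: "cost_on X k 0 m (spend k m)"
  by (simp add: cost_on_def)

lemma cost_mono: "cost a g p \<Longrightarrow> a \<le> a' \<Longrightarrow> g \<le> g' \<Longrightarrow> cost a' g' p"
  unfolding cost_def by (blast intro: cost_on_mono)

lemma cost_skip: "cost 0 0 skip"
  by (simp add: cost_def skip_def cost_on_refl)

lemma cost_seq: "cost a g p \<Longrightarrow> cost a' g' q \<Longrightarrow> cost (a + a') (g + g') (p ;; q)"
  unfolding cost_def seq_def by (blast intro: cost_on_trans)

lemma cost_fetch: "(\<And>v. cost a g (p v)) \<Longrightarrow> cost (k + a) g (fetch k f p)"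
  unfolding cost_def fetch_def
  using cost_on_trans[OF cost_on_spend] by fastforce

lemma cost_if:
  "cost a g p \<Longrightarrow> cost a' g' q \<Longrightarrow> cost (max a a') (max g g') (if b then p else q)"
  by (auto intro: cost_mono)

lemma cost_for_each:
  assumes "\<And>x. cost a g (p x)"
  shows "cost (length xs * (1 + a)) (length xs * g) (for_each xs p)"
proof -
  have "cost_on X (length xs * (1 + a)) (length xs * g) m (fold (\<lambda>x m. p x (spend 1 m)) xs m)" for X m
  proof (induction xs arbitrary: m)
    case Nil
    then show ?case by (simp add: cost_on_refl)
  next
    case (Cons x xs)
    have "cost_on X (1 + a) (0 + g) m (p x (spend 1 m))"
      by (rule cost_on_trans[OF cost_on_spend cost_onD[OF assms]])
    from cost_on_trans[OF this Cons.IH[of "p x (spend 1 m)"]] show ?case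
      by (simp add: algebra_simps)
  qed
  then show ?thesis by (simp add: cost_def for_each_def)
qed

lemma cost_exec:
  assumes "\<And>s. fin_refs s \<Longrightarrow> fin_refs (f s)" "\<And>s. head (f s) = head s"
    "\<And>s X. pot w X (f s) \<le> pot w X s + d" "\<And>s. footprint (f s) \<le> footprint s + g"
  shows "cost (k + 2 * d) g (exec k f)"
proof -
  have "k + (ticks m + 2 * pot w X (f (mem m))) \<le> k + (ticks m + (2 * pot w X (mem m) + 2 * d))" for m X
    using assms(3)[of X "mem m"] by simp
  then show ?thesis
    unfolding cost_def cost_on_def
    using assms(1,2,4) by (auto simp: algebra_simps max_def intro: order_trans)
qed

lemma footprint_pot:
  "footprint s = 2 * w + (bits w + 1) + length ts * (1 + length ts * bits w)
    + card (dom (lclock s)) * (1 + length ts * bits w)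
    + card (dom (rclock s)) * (1 + length ts * bits w)
    + card (dom (epoch s)) * (2 + bits w) + pot w {} s"
  by (simp add: footprint_def pot_def)

lemma footprint_grow:
  assumes "card (dom (lclock s')) \<le> card (dom (lclock s)) + a"
    "card (dom (rclock s')) \<le> card (dom (rclock s)) + b"
    "card (dom (epoch s')) \<le> card (dom (epoch s)) + c"
    "pot w {} s' \<le> pot w {} s + d"
    "(a + b) * (1 + length ts * bits w) + c * (2 + bits w) + d \<le> g"
  shows "footprint s' \<le> footprint s + g"
proof -
  have *: "x * k \<le> y * k + z * k" if "x \<le> y + z" for x y z k :: nat
    using mult_le_mono1[OF that, of k] by (simp add: distrib_right)
  show ?thesis
    using *[OF assms(1), of "1 + length ts * bits w"] *[OF assms(2), of "1 + length ts * bits w"]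
      *[OF assms(3), of "2 + bits w"]
    using assms(4,5) unfolding footprint_pot distrib_right by linarith
qed

text \<open>One step for the insertion and two deposited with the new element: when the release it
  refers to is evicted, visiting the element costs a loop step and a step that clears the clock
  entry.\<close>

lemma cost_add_ref:
  fixes z :: "'t + 'l"
  shows "cost 3 1 (add_ref i z)"
proof -
  have "footprint (upd_refs (insert z) i s) \<le> footprint s + 1" for s :: "('t, 'x, 'l) state"
    by (rule footprint_grow[of _ _ 0 0 0 1]) (simp_all add: pot_upd_refs_insert)
  then have "cost (1 + 2 * 1) 1 (add_ref i z)"
    unfolding add_ref_def
    by (intro cost_exec) (simp_all add: fin_refs_upd_refs pot_upd_refs_insert)
  then show ?thesis by (simp add: numeral_3_eq_3)
qed

lemma cost_del_ref:
  fixes z :: "'t + 'l"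
  shows "cost 1 0 (del_ref i z)"
proof -
  have "footprint (upd_refs (\<lambda>A. A - {z}) i s) \<le> footprint s + 0" for s :: "('t, 'x, 'l) state"
    by (rule footprint_grow[of _ _ 0 0 0 0]) (simp_all add: pot_upd_refs_remove)
  then have "cost (1 + 2 * 0) 0 (del_ref i z)"
    unfolding del_ref_def
    by (intro cost_exec) (simp_all add: fin_refs_upd_refs pot_upd_refs_remove)
  then show ?thesis by simp
qed

lemma cost_exec_refs_unchanged:
  assumes "\<And>s. refs (f s) = refs s" "\<And>s. head (f s) = head s"
    "\<And>s. card (dom (lclock (f s))) \<le> card (dom (lclock s)) + a"
    "\<And>s. card (dom (rclock (f s))) \<le> card (dom (rclock s)) + b"
    "\<And>s. card (dom (epoch (f s))) \<le> card (dom (epoch s)) + c"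
  shows "cost k ((a + b) * (1 + length ts * bits w) + c * (2 + bits w)) (exec k f)"
proof -
  have "footprint (f s) \<le> footprint s + ((a + b) * (1 + length ts * bits w) + c * (2 + bits w))" for s
    by (rule footprint_grow[of _ _ a b c 0]) (simp_all add: assms pot_refs_cong[OF assms(1)])
  then have "cost (k + 2 * 0) ((a + b) * (1 + length ts * bits w) + c * (2 + bits w)) (exec k f)"
    by (intro cost_exec) (simp_all add: assms fin_refs_def pot_refs_cong[OF assms(1)])
  then show ?thesis by simp
qed

lemma cost_exec_neutral:
  assumes "\<And>s. refs (f s) = refs s" "\<And>s. head (f s) = head s"
    "\<And>s. card (dom (lclock (f s))) \<le> card (dom (lclock s))"
    "\<And>s. card (dom (rclock (f s))) \<le> card (dom (rclock s))"
    "\<And>s. card (dom (epoch (f s))) \<le> card (dom (epoch s))"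
  shows "cost k 0 (exec k f)"
  using cost_exec_refs_unchanged[of f 0 0 0 k] assms by simp

lemma cost_exec_new_release:
  fixes z :: "'t + 'l"
  shows "cost 3 1 (exec 1 (\<lambda>s. s\<lparr>refs := (refs s)(head s := Some {z})\<rparr>))"
proof -
  let ?f = "\<lambda>s :: ('t, 'x, 'l) state. s\<lparr>refs := (refs s)(head s := Some {z})\<rparr>"
  have pot: "pot w X (?f s) \<le> pot w X s + 1" for X s
    by (rule pot_upd_le[of "head s"]) (auto split: option.split)
  have "footprint (?f s) \<le> footprint s + 1" for s
    by (rule footprint_grow[of _ _ 0 0 0 1]) (simp_all add: pot[simplified])
  then have "cost (1 + 2 * 1) 1 (exec 1 ?f)"
    by (intro cost_exec) (use pot in \<open>auto simp: fin_refs_def split: if_splits\<close>)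
  then show ?thesis by (simp add: numeral_3_eq_3)
qed

section \<open>Costs of handlers and post-handlers\<close>

abbreviation "clock_size \<equiv> 1 + length ts * bits w"

lemma cost_rclock_bot:
  "cost k clock_size (exec k (\<lambda>s. s\<lparr>rclock := (rclock s)(x := Some bot_clock)\<rparr>))"
  by (rule cost_mono[OF cost_exec_refs_unchanged[of _ 0 1 0]])
    (simp_all add: card_dom_update del: dom_fun_upd)

lemma cost_lclock_bot:
  "cost k clock_size (exec k (\<lambda>s. s\<lparr>lclock := (lclock s)(l := Some bot_clock)\<rparr>))"
  by (rule cost_mono[OF cost_exec_refs_unchanged[of _ 1 0 0]])
    (simp_all add: card_dom_update del: dom_fun_upd)

lemma cost_epoch:
  "cost k (2 + bits w) (exec k (\<lambda>s. s\<lparr>epoch := (epoch s)(x := Some (t, head s))\<rparr>))"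
  by (rule cost_mono[OF cost_exec_refs_unchanged[of _ 0 0 1]])
    (simp_all add: card_dom_update del: dom_fun_upd)

lemma cost_handle_read: "cost (3 + length ts + 1) clock_size (handle_read t x)"
proof -
  have d: "cost 1 0 declare_race" unfolding declare_race_def by (rule cost_exec_neutral) auto
  have s: "cost 1 0 (exec 1 (\<lambda>s. set_rentry x t (head s) s))" by (rule cost_exec_neutral) auto
  show ?thesis unfolding handle_read_def
    \<comment> \<open>\<open>cost_mono\<close> leaves the bounds schematic; the rules assemble them
      along the structure of the program, and only the last call compares them with the stated
      constants.\<close>
    by (rule cost_mono, (rule cost_seq cost_fetch cost_if cost_skip cost_rclock_bot d s)+) simp_all
qed

lemma cost_handle_write: "cost (length ts + 3) (2 + bits w) (handle_write t x)"
proof -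
  have d: "cost 1 0 declare_race" unfolding declare_race_def by (rule cost_exec_neutral) auto
  show ?thesis unfolding handle_write_def
    by (rule cost_mono, (rule cost_seq cost_fetch cost_if cost_skip cost_epoch d)+) simp_all
qed

lemma cost_null_lclock: "cost 1 0 (null_lclock l)"
  and cost_null_rclock: "cost 1 0 (null_rclock x)"
  unfolding null_lclock_def null_rclock_def
  by (rule cost_exec_neutral; auto simp: card_dom_None simp del: dom_fun_upd)+

text \<open>An iteration costs 10: the loop step, three fetches, 5 for taking over a newer entry
  (insertion 3, deletion 1, assignment 1) and a final deletion. Only the insertion enlarges the
  footprint, once per thread.\<close>

lemma cost_handle_acq: "cost (2 + 10 * length ts) (length ts) (handle_acq t l)"
proof -
  have s: "cost 1 0 (exec 1 (set_tentry t u c))" for u c by (rule cost_exec_neutral) auto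
  show ?thesis unfolding handle_acq_def
    by (rule cost_mono, (rule cost_seq cost_fetch cost_if cost_skip cost_add_ref cost_del_ref
       cost_null_lclock cost_for_each s)+) simp_all
qed

lemma cost_handle_rel: "cost (6 + 7 * length ts) (1 + clock_size + length ts) (handle_rel t l)"
proof -
  have s: "cost 1 0 (exec 1 (\<lambda>s. set_tentry t t (head s) s))" by (rule cost_exec_neutral) auto
  have s': "cost 1 0 (exec 1 (set_lentry l u a))" for u a by (rule cost_exec_neutral) auto
  show ?thesis unfolding handle_rel_def
    by (rule cost_mono, (rule cost_seq cost_fetch cost_if cost_skip cost_add_ref cost_del_ref
       cost_exec_new_release cost_lclock_bot cost_for_each s s')+) simp_all
qed

lemma cost_handle: "cost (6 + 10 * length ts) (3 + bits w + clock_size + length ts) (handle e)"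
  unfolding handle_def
  by (cases "opn e")
    (auto intro!: cost_mono[OF cost_handle_read] cost_mono[OF cost_handle_write]
      cost_mono[OF cost_handle_acq] cost_mono[OF cost_handle_rel])

lemma cost_post_read: "cost (3 + length ts) 0 (post_read t x)"
proof -
  have s: "cost 1 0 (exec 1 (set_rentry x t (-1)))" by (rule cost_exec_neutral) auto
  show ?thesis unfolding post_read_def
    by (rule cost_mono, (rule cost_seq cost_fetch cost_if cost_skip cost_null_rclock s)+) simp_all
qed

lemma cost_post_write: "cost 2 0 (post_write t x)"
proof -
  have s: "cost 1 0 (exec 1 (\<lambda>s. s\<lparr>epoch := (epoch s)(x := None)\<rparr>))"
    by (rule cost_exec_neutral) (auto simp: card_dom_None simp del: dom_fun_upd)
  show ?thesis unfolding post_write_def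
    by (rule cost_mono, (rule cost_seq cost_fetch cost_if cost_skip s)+) simp_all
qed

lemma cost_on_post_rel:
  assumes h: "head (mem m) \<in> {0..<int w}"
  shows "cost_on {} (4 + 4 * length ts) 0 m (post_rel t l m)"
proof (cases "fin_refs (mem m)")
  case True
  let ?h = "head (mem m)"
  let ?A = "case refs (mem m) ?h of None \<Rightarrow> {} | Some A \<Rightarrow> A"
  let ?n = "case refs (mem m) ?h of None \<Rightarrow> 0 | Some A \<Rightarrow> card A"
  let ?clear = "for_each (elems ?A) (\<lambda>z. case z of
      Inl u \<Rightarrow> exec 1 (set_tentry u t (-1)) | Inr m \<Rightarrow> exec 1 (set_lentry m t (-1)))"
  let ?drop = "\<lambda>own. fetch (length ts) (\<lambda>s. \<forall>u\<in>set ts. lentry s l u = Some (-1)) (\<lambda>cleared.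
         if own \<and> cleared
         then (for_each ts (\<lambda>u. fetch 1 (\<lambda>s. the (lentry s l u)) (\<lambda>c. del_ref c (Inr l))) ;;
               null_lclock l)
         else skip)"
  let ?last = "exec 1 (\<lambda>s. s\<lparr>refs := (refs s)(head s := None)\<rparr>)"
  \<comment> \<open>\<open>m1\<close> is the machine just before \<open>S_h\<close> is set to
    null.\<close>
  define m1 where "m1 = ?drop (lentry (mem m) l t = Some ?h) (?clear (spend 1 (spend 1 m)))"
  have m': "post_rel t l m = ?last m1"
    unfolding post_rel_def seq_def fetch_def m1_def by simp
  have n: "length (elems ?A) = ?n"
    using True by (auto simp: elems(2) fin_refs_def split: option.split)
  have c1: "cost 1 0 (case z of Inl u \<Rightarrow> exec 1 (set_tentry u t (-1))
      | Inr m \<Rightarrow> exec 1 (set_lentry m t (-1)))" for z :: "'t + 'l"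
    by (cases z) (auto intro!: cost_exec_neutral)
  have "cost (length (elems ?A) * (1 + 1)) (length (elems ?A) * 0) ?clear"
    by (rule cost_for_each[OF c1])
  then have clear: "cost (2 * ?n) 0 ?clear" by (simp add: n mult_2 mult_2_right)
  have drop: "cost (length ts * 4 + 1) 0 (?drop own)" for own
    by (rule cost_mono, (rule cost_seq cost_fetch cost_if cost_skip cost_del_ref
       cost_null_lclock cost_for_each)+) simp_all
  have m1: "cost_on X (2 + 2 * ?n + (length ts * 4 + 1)) 0 m m1" for X
    using cost_on_trans[OF cost_on_trans[OF cost_on_trans[OF cost_on_spend cost_on_spend]
      cost_onD[OF clear]] cost_onD[OF drop]]
    unfolding m1_def by (rule cost_on_mono) simp_all
  let ?s' = "(mem m1)\<lparr>refs := (refs (mem m1))(head (mem m1) := None)\<rparr>"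
  have hd: "head (mem m1) = ?h" using m1 True by (simp add: cost_on_def)
  have "pot w {} ?s' = pot w {?h} ?s'" using pot_remove[OF h, of ?s'] hd by simp
  also have "\<dots> = pot w {?h} (mem m1)" using hd by (auto simp: pot_def intro!: sum.cong)
  finally have p: "pot w {} ?s' = pot w {?h} (mem m1)" .
  \<comment> \<open>Time is bounded with \<open>S_h\<close> left out of the potential, so that
    setting it to null releases \<open>2 * ?n\<close>, exactly the cost of the clearing loop. Space
    is bounded with nothing left out, since the footprint counts every set.\<close>
  have t: "ticks m1 + 2 * pot w {?h} (mem m1) \<le>
      ticks m + 2 * pot w {?h} (mem m) + (2 + 2 * ?n + (length ts * 4 + 1))"
    using m1[of "{?h}"] True by (simp add: cost_on_def)
  have le: "pot w {} ?s' \<le> pot w {} (mem m1)"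
    using p pot_remove[OF h, of "mem m1"] by simp
  then have fp: "footprint ?s' \<le> footprint (mem m1)" by (simp add: footprint_pot)
  have fp': "footprint (mem m1) \<le> footprint (mem m)" "peak m1 \<le> max (peak m) (footprint (mem m))"
    "fin_refs (mem m1)"
    using m1[of "{}"] True by (simp_all add: cost_on_def)
  have "fin_refs ?s'" using fp'(3) by (auto simp: fin_refs_def split: if_splits)
  then show ?thesis
    using True p t fp fp' pot_remove[OF h, of "mem m"] hd
    unfolding cost_on_def m' by (auto simp: max_def split: if_splits)
qed (simp add: cost_on_def)

lemma cost_on_post_handle:
  assumes "head (mem m) \<in> {0..<int w}"
  shows "cost_on {} (4 + 4 * length ts) 0 m (post_handle e m)"
  unfolding post_handle_def
  using assms by (cases "opn e")
    (auto intro!: cost_on_mono[OF cost_onD[OF cost_post_read]]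
      cost_on_mono[OF cost_onD[OF cost_post_write]] cost_on_mono[OF cost_onD[OF cost_skip]]
      cost_on_post_rel)

text \<open>The peak is bounded relative to the footprint at the start of the event. Summing this
  growth over the trace would give a bound depending on its length; the footprint between events is
  therefore bounded through the invariant instead.\<close>

lemma process_cost:
  assumes "fin_refs (mem m)" "w \<ge> 1"
  shows "fin_refs (mem (process e m))"
    "ticks (process e m) + 2 * pot w {} (mem (process e m)) \<le>
      ticks m + 2 * pot w {} (mem m) + (13 + 14 * length ts)"
    "peak (process e m) \<le> max (peak m) (footprint (mem m) + (3 + bits w + clock_size + length ts))"
proof -
  define m1 where "m1 = exec 1 (\<lambda>s. s\<lparr>head := (head s + 1) mod int w\<rparr>) m"
  define m2 where "m2 = (case win (mem m1) (head (mem m1)) of None \<Rightarrow> skip | Some e' \<Rightarrow> post_handle e') (spend 1 m1)"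
  have eq: "process e m = exec 1 (\<lambda>s. s\<lparr>win := (win s)(head s := Some e)\<rparr>) (handle e m2)"
    by (simp add: process_def seq_def fetch_def m1_def m2_def)
  have h: "head (mem m1) \<in> {0..<int w}" using assms by (simp add: m1_def)
  have m1: "fin_refs (mem m1)" "ticks m1 = ticks m + 1" "pot w {} (mem m1) = pot w {} (mem m)"
    "footprint (mem m1) = footprint (mem m)" "peak m1 = max (peak m) (footprint (mem m))"
    using assms by (simp_all add: m1_def fin_refs_def footprint_pot pot_def)
  have a: "cost_on {} (1 + (4 + 4 * length ts)) (0 + 0) m1 m2"
    unfolding m2_def
  proof (rule cost_on_trans[OF cost_on_spend])
    show "cost_on {} (4 + 4 * length ts) 0 (spend 1 m1)
     ((case win (mem m1) (head (mem m1)) of None \<Rightarrow> skip | Some e' \<Rightarrow> post_handle e') (spend 1 m1))"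
      using h by (auto split: option.split intro!: cost_on_post_handle cost_on_mono[OF cost_onD[OF cost_skip]])
  qed
  have w: "cost 1 0 (exec 1 (\<lambda>s. s\<lparr>win := (win s)(head s := Some e)\<rparr>))"
    by (rule cost_exec_neutral) auto
  have "cost_on {} (1 + (4 + 4 * length ts) + ((6 + 10 * length ts) + 1)) (3 + bits w + clock_size + length ts) m1 (process e m)"
    using cost_on_trans[OF a cost_on_trans[OF cost_onD[OF cost_handle] cost_onD[OF w]]]
    unfolding eq by simp
  then show "fin_refs (mem (process e m))"
    "ticks (process e m) + 2 * pot w {} (mem (process e m)) \<le>
      ticks m + 2 * pot w {} (mem m) + (13 + 14 * length ts)"
    "peak (process e m) \<le> max (peak m) (footprint (mem m) + (3 + bits w + clock_size + length ts))"
    using m1 by (auto simp: cost_on_def max_def split: if_splits)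
qed

end

section \<open>The state prescribed by the happens-before order\<close>

locale windowed_trace = window_hb w ts
  for w :: nat and ts :: "'t list" +
  fixes \<sigma> :: "('t, 'x, 'l) trace"
  assumes wf: "well_formed \<sigma>" and w: "w \<ge> 1"
    and distinct_ts: "distinct ts" and set_ts: "set ts = threads \<sigma>"
begin

definition rel_by :: "'t \<Rightarrow> nat \<Rightarrow> bool"
  where "rel_by u p \<longleftrightarrow> thr (\<sigma> ! p) = u \<and> (\<exists>l. opn (\<sigma> ! p) = Rel l)"

text \<open>The order of the whole trace can be used: edges never run backwards, so a path ending at
  \<open>k < n\<close> involves no event from \<open>n\<close> on.\<close>

definition known :: "nat \<Rightarrow> 't \<Rightarrow> 't \<Rightarrow> nat \<Rightarrow> bool"
  where "known n t u p \<longleftrightarrow> rel_by u p \<and> (\<exists>k<n. thr (\<sigma> ! k) = t \<and> (p, k) \<in> hb \<sigma>)"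

definition thread_clock :: "nat \<Rightarrow> nat \<Rightarrow> 't \<Rightarrow> 't \<Rightarrow> int"
  where "thread_clock lo n t u = idx w (lastpos lo n (known n t u))"

text \<open>The release that owns the current lock clock. An acquire consumes the clock, so there is
  no owner if the last operation on the lock in the window is an acquire.\<close>

definition open_rel :: "nat \<Rightarrow> nat \<Rightarrow> 'l \<Rightarrow> nat option"
  where "open_rel lo n l =
    (case lastpos lo n (\<lambda>p. opn (\<sigma> ! p) \<in> {Acq l, Rel l}) of None \<Rightarrow> None
     | Some r \<Rightarrow> if opn (\<sigma> ! r) = Rel l then Some r else None)"

definition rel_clock :: "nat \<Rightarrow> nat \<Rightarrow> nat \<Rightarrow> 't \<Rightarrow> int"
  where "rel_clock lo n r u = idx w (lastpos lo n (\<lambda>p. rel_by u p \<and> (p, r) \<in> hb \<sigma>))"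

definition lock_clock :: "nat \<Rightarrow> nat \<Rightarrow> 'l \<Rightarrow> ('t \<Rightarrow> int) option"
  where "lock_clock lo n l = map_option (rel_clock lo n) (open_rel lo n l)"

definition last_read :: "nat \<Rightarrow> nat \<Rightarrow> 'x \<Rightarrow> 't \<Rightarrow> nat option"
  where "last_read lo n x u = lastpos lo n (\<lambda>p. \<sigma> ! p = (u, Read x))"

definition read_clock :: "nat \<Rightarrow> nat \<Rightarrow> 'x \<Rightarrow> ('t \<Rightarrow> int) option"
  where "read_clock lo n x =
    (if \<exists>u. last_read lo n x u \<noteq> None then Some (\<lambda>u. idx w (last_read lo n x u)) else None)"

definition last_write :: "nat \<Rightarrow> nat \<Rightarrow> 'x \<Rightarrow> nat option"
  where "last_write lo n x = lastpos lo n (\<lambda>p. opn (\<sigma> ! p) = Write x)"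

definition write_epoch :: "nat \<Rightarrow> nat \<Rightarrow> 'x \<Rightarrow> ('t \<times> int) option"
  where "write_epoch lo n x =
    map_option (\<lambda>p. (thr (\<sigma> ! p), int (p mod w))) (last_write lo n x)"

text \<open>Only the component of the releasing thread is inspected, because a prescribed entry for
  \<open>u\<close> can refer only to a release by \<open>u\<close>.\<close>

definition pointers :: "('t, 'x, 'l) state \<Rightarrow> nat \<Rightarrow> ('t + 'l) set"
  where "pointers s p =
    Inl ` {t. tclock s t (thr (\<sigma> ! p)) = int (p mod w)} \<union>
    Inr ` {l. lentry s l (thr (\<sigma> ! p)) = Some (int (p mod w))}"

text \<open>The second conjunct keeps vacant slots null: an arriving event other than a release
  finds its slot already correct, and vacant slots add nothing to the footprint.\<close>

definition refs_ok :: "nat \<Rightarrow> nat \<Rightarrow> ('t, 'x, 'l) state \<Rightarrow> bool"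
  where "refs_ok lo n s \<longleftrightarrow>
    (\<forall>p. lo \<le> p \<and> p < n \<longrightarrow>
       refs s (int (p mod w)) = (if \<exists>l. opn (\<sigma> ! p) = Rel l then Some (pointers s p) else None)) \<and>
    (\<forall>i<w. (\<forall>p. lo \<le> p \<and> p < n \<longrightarrow> p mod w \<noteq> i) \<longrightarrow> refs s (int i) = None)"

definition race_before :: "nat \<Rightarrow> bool"
  where "race_before n \<longleftrightarrow> (\<exists>i j. i < j \<and> j < n \<and> hb_race \<sigma> i j \<and> j - i + 1 \<le> w)"

text \<open>\<open>good lo n s\<close>: the events before \<open>n\<close> have been handled, those before \<open>lo\<close> evicted.\<close>

definition good :: "nat \<Rightarrow> nat \<Rightarrow> ('t, 'x, 'l) state \<Rightarrow> bool"
  where "good lo n s \<longleftrightarrow> tclock s = thread_clock lo n \<and> lclock s = lock_clock lo n \<and>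
    rclock s = read_clock lo n \<and> epoch s = write_epoch lo n \<and> refs_ok lo n s \<and>
    race s = race_before n"

lemma open_rel_SomeD:
  "open_rel lo n l = Some r \<Longrightarrow> lo \<le> r \<and> r < n \<and> opn (\<sigma> ! r) = Rel l \<and>
    (\<forall>k. r < k \<and> k < n \<longrightarrow> opn (\<sigma> ! k) \<notin> {Acq l, Rel l})"
  by (auto simp: open_rel_def lastpos_Some split: option.splits if_splits)

section \<open>Prescribed clocks when the oldest event is evicted\<close>

context
  fixes lo n :: nat
  assumes lo: "lo < n" and n: "n \<le> lo + w" "n \<le> length \<sigma>"
begin

lemma thread_clock_Suc_lo:
  "thread_clock (Suc lo) n t u =
    (if thread_clock lo n t u = int (lo mod w) then -1 else thread_clock lo n t u)"
  unfolding thread_clock_def by (rule idx_Suc_lo[OF lo n(1)])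

lemma thread_clock_eq_lo:
  "thread_clock lo n t u = int (lo mod w) \<Longrightarrow> u = thr (\<sigma> ! lo) \<and> (\<exists>l. opn (\<sigma> ! lo) = Rel l)"
  using lo n by (auto simp: thread_clock_def idx_eq_mod lastpos_Some known_def rel_by_def)

lemma rel_clock_Suc_lo:
  "rel_clock (Suc lo) n r u =
    (if rel_clock lo n r u = int (lo mod w) then -1 else rel_clock lo n r u)"
  unfolding rel_clock_def by (rule idx_Suc_lo[OF lo n(1)])

lemma rel_clock_eq_lo:
  "rel_clock lo n r u = int (lo mod w) \<Longrightarrow> u = thr (\<sigma> ! lo) \<and> (\<exists>l. opn (\<sigma> ! lo) = Rel l)"
  using lo n by (auto simp: rel_clock_def idx_eq_mod lastpos_Some rel_by_def)

lemma open_rel_Suc_lo: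
  "open_rel (Suc lo) n l = (if open_rel lo n l = Some lo then None else open_rel lo n l)"
  by (auto simp: open_rel_def lastpos_Suc_lo split: option.split)

text \<open>No release of the window other than \<open>lo\<close> itself precedes \<open>lo\<close>.
  So a lock clock owned by the evicted release has a single entry, and clearing that entry leaves
  only -1.\<close>

lemma rel_clock_open_lo:
  assumes "opn (\<sigma> ! lo) = Rel l"
  shows "rel_clock lo n lo u = (if u = thr (\<sigma> ! lo) then int (lo mod w) else -1)"
proof -
  have "rel_by u p \<and> (p, lo) \<in> hb \<sigma> \<longleftrightarrow> p = lo \<and> u = thr (\<sigma> ! lo)" if "lo \<le> p" for p
    using that assms lo n hb_le[of p lo \<sigma>] hb_thr[of lo lo \<sigma>] by (auto simp: rel_by_def)
  then have "lastpos lo n (\<lambda>p. rel_by u p \<and> (p, lo) \<in> hb \<sigma>) = lastpos lo n (\<lambda>p. p = lo \<and> u = thr (\<sigma> ! lo))"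
    by (intro lastpos_cong) simp
  also have "\<dots> = (if u = thr (\<sigma> ! lo) then Some lo else None)"
    using lo by (auto simp: lastpos_Some lastpos_None)
  finally show ?thesis by (simp add: rel_clock_def)
qed

lemma last_read_Suc_lo:
  "last_read (Suc lo) n x u = (if last_read lo n x u = Some lo then None else last_read lo n x u)"
  unfolding last_read_def by (rule lastpos_Suc_lo)

lemma last_write_Suc_lo:
  "last_write (Suc lo) n x = (if last_write lo n x = Some lo then None else last_write lo n x)"
  unfolding last_write_def by (rule lastpos_Suc_lo)

text \<open>The counterpart: an owner other than \<open>lo\<close> keeps its own component after the
  eviction, so the test of \<open>post_rel\<close> for a cleared clock fails.\<close>

lemma rel_clock_creator:
  assumes "open_rel lo n l = Some r" "r \<noteq> lo"
  shows "rel_clock (Suc lo) n r (thr (\<sigma> ! r)) \<noteq> -1" "thr (\<sigma> ! r) \<in> set ts"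
proof -
  have r: "lo \<le> r" "r < n" "opn (\<sigma> ! r) = Rel l"
    using assms(1) by (auto simp: open_rel_def lastpos_Some split: option.splits if_splits)
  then have "(r, r) \<in> hb \<sigma>" using n by (auto intro: hb_thr)
  then have "lastpos (Suc lo) n (\<lambda>p. rel_by (thr (\<sigma> ! r)) p \<and> (p, r) \<in> hb \<sigma>) \<noteq> None"
    using r assms(2) by (auto simp: lastpos_None rel_by_def intro!: exI[of _ r])
  then show "rel_clock (Suc lo) n r (thr (\<sigma> ! r)) \<noteq> -1" by (simp add: rel_clock_def)
  show "thr (\<sigma> ! r) \<in> set ts" using r n by (auto simp: set_ts threads_def)
qed

end

section \<open>Prescribed clocks when the next event arrives\<close>

context
  fixes lo n :: nat
  assumes lo: "lo \<le> n" "n < lo + w" and n: "n < length \<sigma>"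
begin

lemma thr_n [simp]: "thr (\<sigma> ! n) \<in> set ts"
  using n by (auto simp: set_ts threads_def)

text \<open>Only an acquire has an incoming base edge from another thread; every path to another
  event passes through an earlier event of its own thread.\<close>

lemma hb_nonlock_iff:
  assumes "p < n" "\<And>l. opn (\<sigma> ! n) \<noteq> Acq l"
  shows "(p, n) \<in> hb \<sigma> \<longleftrightarrow> (\<exists>k<n. thr (\<sigma> ! k) = thr (\<sigma> ! n) \<and> (p, k) \<in> hb \<sigma>)"
proof
  assume "(p, n) \<in> hb \<sigma>"
  then obtain k where "k < n" "(p, k) \<in> hb \<sigma>" "(k, n) \<in> hb_base \<sigma>"
    using hb_last_step[of p n \<sigma>] assms(1) by auto
  then show "\<exists>k<n. thr (\<sigma> ! k) = thr (\<sigma> ! n) \<and> (p, k) \<in> hb \<sigma>"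
    using assms(2) by (auto simp: hb_base_def)
next
  assume "\<exists>k<n. thr (\<sigma> ! k) = thr (\<sigma> ! n) \<and> (p, k) \<in> hb \<sigma>"
  then show "(p, n) \<in> hb \<sigma>" using hb_trans hb_thr n by (metis less_imp_le)
qed

lemma known_Suc:
  assumes "p < n"
  shows "known (Suc n) t u p \<longleftrightarrow> known n t u p \<or> t = thr (\<sigma> ! n) \<and> rel_by u p \<and> (p, n) \<in> hb \<sigma>"
  by (auto simp: known_def less_Suc_eq)

lemma known_Suc_self:
  "known (Suc n) t u n \<longleftrightarrow> t = thr (\<sigma> ! n) \<and> rel_by u n"
  using hb_le[of n] hb_thr[of n n \<sigma>] n by (fastforce simp: known_def less_Suc_eq)

lemma thread_clock_Suc_nonacq:
  assumes "\<And>l. opn (\<sigma> ! n) \<noteq> Acq l"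
  shows "thread_clock lo (Suc n) t u =
    (if t = thr (\<sigma> ! n) \<and> rel_by u n then int (n mod w) else thread_clock lo n t u)"
proof -
  have "known (Suc n) t u p = known n t u p" if "p < n" for p
    using known_Suc[OF that] hb_nonlock_iff[OF that assms] by (auto simp: known_def)
  then have "lastpos lo n (known (Suc n) t u) = lastpos lo n (known n t u)"
    by (intro lastpos_cong) simp
  then show ?thesis using lo by (simp add: thread_clock_def known_Suc_self)
qed

lemma open_rel_Suc:
  "open_rel lo (Suc n) l =
    (if opn (\<sigma> ! n) = Rel l then Some n else if opn (\<sigma> ! n) = Acq l then None else open_rel lo n l)"
  using lo by (auto simp: open_rel_def)

lemma rel_clock_Suc:
  assumes "r < n"
  shows "rel_clock lo (Suc n) r u = rel_clock lo n r u"
  using assms hb_le[of n r \<sigma>] by (auto simp: rel_clock_def)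

text \<open>An acquire by the releasing thread comes after any earlier release. Therefore a release
  overwrites a null clock, and no stale reference to \<open>l\<close> stays behind in any
  \<open>S_i\<close>.\<close>

lemma open_rel_before_rel:
  assumes "opn (\<sigma> ! n) = Rel l"
  shows "open_rel lo n l = None"
proof (rule ccontr)
  assume "open_rel lo n l \<noteq> None"
  then obtain r where "open_rel lo n l = Some r" by auto
  then have r: "r < n" "opn (\<sigma> ! r) = Rel l" "\<And>k. r < k \<Longrightarrow> k < n \<Longrightarrow> opn (\<sigma> ! k) \<notin> {Acq l, Rel l}"
    using open_rel_SomeD by blast+
  obtain j where j: "j < n" "\<sigma> ! j = (thr (\<sigma> ! n), Acq l)" "\<forall>q. j < q \<and> q < n \<longrightarrow> opn (\<sigma> ! q) \<noteq> Rel l"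
    using rel_preceded_by_acq[OF wf n assms] by blast
  have "opn (\<sigma> ! j) = Acq l" using j by (simp add: opn_def)
  then have "j \<noteq> r" "\<not> j < r" "\<not> r < j" using r(1,2) r(3)[of j] j by auto
  then show False by linarith
qed

lemma thread_clock_Suc_acq_None:
  assumes "opn (\<sigma> ! n) = Acq l" "open_rel lo n l = None"
  shows "thread_clock lo (Suc n) t u = thread_clock lo n t u"
proof -
  have "known (Suc n) t u p = known n t u p" if p: "lo \<le> p" "p < n" for p
  proof -
    have "\<exists>k<n. thr (\<sigma> ! k) = thr (\<sigma> ! n) \<and> (p, k) \<in> hb \<sigma>" if pn: "(p, n) \<in> hb \<sigma>"
    proof -
      obtain k where k: "k < n" "(p, k) \<in> hb \<sigma>" "(k, n) \<in> hb_base \<sigma>"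
        using hb_last_step[OF pn] p by auto
      show ?thesis
      proof (cases "thr (\<sigma> ! k) = thr (\<sigma> ! n)")
        case False
        then have kr: "opn (\<sigma> ! k) = Rel l" using k assms by (auto simp: hb_base_def)
        \<comment> \<open>The release \<open>k\<close> lies in the window because \<open>p\<close>
          does. As the lock clock is null, the last operation on \<open>l\<close> in the window is
          an acquire \<open>a\<close>, which comes after \<open>k\<close> and belongs to the thread
          of \<open>n\<close>.\<close>
        have "lo \<le> k" using k hb_le[of p k \<sigma>] p by simp
        then obtain a where la: "lastpos lo n (\<lambda>p. opn (\<sigma> ! p) \<in> {Acq l, Rel l}) = Some a"
          using k kr by (metis (no_types, lifting) insertCI lastpos_None not_None_eq)
        then have a: "lo \<le> a" "a < n" "opn (\<sigma> ! a) = Acq l"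
            "\<And>q. a < q \<Longrightarrow> q < n \<Longrightarrow> opn (\<sigma> ! q) \<notin> {Acq l, Rel l}"
          using assms(2) la[unfolded lastpos_Some] unfolding open_rel_def la
          by (auto split: if_splits)
        have "\<not> a < k" using a(4)[of k] k kr by auto
        then have "(k, a) \<in> hb \<sigma>" using a kr n by (intro hb_lock) auto
        moreover have "thr (\<sigma> ! a) = thr (\<sigma> ! n)"
          using a assms n by (intro acq_acq_same_thread[OF wf]) auto
        ultimately show ?thesis using k a by (meson hb_trans)
      qed (use k in blast)
    qed
    then show ?thesis using known_Suc[OF p(2)] by (auto simp: known_def)
  qed
  then have "lastpos lo n (known (Suc n) t u) = lastpos lo n (known n t u)"
    by (intro lastpos_cong) simp
  moreover have "\<not> known (Suc n) t u n" using assms by (auto simp: known_Suc_self rel_by_def)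
  ultimately show ?thesis by (simp add: thread_clock_def)
qed

text \<open>An acquire has base edges from all earlier releases of its lock, but
  \<open>hb_rel_rel\<close> reroutes them through the last one, \<open>r\<close>. What the thread
  learns is exactly what precedes \<open>r\<close>, and \<open>idx_disj\<close> turns this union
  into the conditional update.\<close>

lemma thread_clock_Suc_acq_Some:
  assumes "opn (\<sigma> ! n) = Acq l" "open_rel lo n l = Some r"
  shows "thread_clock lo (Suc n) t u =
    (if t = thr (\<sigma> ! n) \<and> less_win (int (n mod w)) (thread_clock lo n t u) (rel_clock lo n r u)
     then rel_clock lo n r u else thread_clock lo n t u)"
proof -
  have r: "r < n" "opn (\<sigma> ! r) = Rel l" "\<And>k. r < k \<Longrightarrow> k < n \<Longrightarrow> opn (\<sigma> ! k) \<noteq> Rel l"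
    using open_rel_SomeD[OF assms(2)] by auto
  have *: "known (Suc n) t u p \<longleftrightarrow> known n t u p \<or> t = thr (\<sigma> ! n) \<and> rel_by u p \<and> (p, r) \<in> hb \<sigma>"
    if p: "p < n" for p
  proof -
    have "(\<exists>k<n. thr (\<sigma> ! k) = thr (\<sigma> ! n) \<and> (p, k) \<in> hb \<sigma>) \<or> (p, r) \<in> hb \<sigma>" if pn: "(p, n) \<in> hb \<sigma>"
    proof -
      obtain k where k: "k < n" "(p, k) \<in> hb \<sigma>" "(k, n) \<in> hb_base \<sigma>"
        using hb_last_step[OF pn] p by auto
      show ?thesis
      proof (cases "thr (\<sigma> ! k) = thr (\<sigma> ! n)")
        case False
        then have kr: "opn (\<sigma> ! k) = Rel l" using k assms by (auto simp: hb_base_def)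
        have "k \<le> r" using r(3)[of k] k kr by (meson not_less)
        then have "(k, r) \<in> hb \<sigma>" using r kr n by (intro hb_rel_rel[OF wf]) auto
        then show ?thesis using k hb_trans by blast
      qed (use k in blast)
    qed
    moreover have "(p, n) \<in> hb \<sigma>" if "(p, r) \<in> hb \<sigma>"
      using that hb_lock[of r n \<sigma> l] r assms n hb_trans by auto
    ultimately show ?thesis using known_Suc[OF p] by (auto simp: known_def)
  qed
  have nn: "\<not> known (Suc n) t u n" using assms by (auto simp: known_Suc_self rel_by_def)
  show ?thesis
  proof (cases "t = thr (\<sigma> ! n)")
    case True
    have "lastpos lo n (known (Suc n) t u) =
        lastpos lo n (\<lambda>p. known n t u p \<or> rel_by u p \<and> (p, r) \<in> hb \<sigma>)"
      using * True by (intro lastpos_cong) simp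
    then show ?thesis
      using nn True idx_disj[OF lo(2), of "known n t u" "\<lambda>p. rel_by u p \<and> (p, r) \<in> hb \<sigma>"]
      by (simp add: thread_clock_def rel_clock_def)
  next
    case False
    have "lastpos lo n (known (Suc n) t u) = lastpos lo n (known n t u)"
      using * False by (intro lastpos_cong) simp
    then show ?thesis using nn False by (simp add: thread_clock_def)
  qed
qed

text \<open>The thread sets its own component before \<open>C_t\<close> is copied, so the lock clock
  includes the release \<open>n\<close> itself; hence the upper end \<open>Suc n\<close> on both
  sides.\<close>

lemma rel_clock_new:
  assumes "opn (\<sigma> ! n) = Rel l"
  shows "rel_clock lo (Suc n) n u = thread_clock lo (Suc n) (thr (\<sigma> ! n)) u"
proof -
  have "rel_by u p \<and> (p, n) \<in> hb \<sigma> \<longleftrightarrow> known (Suc n) (thr (\<sigma> ! n)) u p" if "p < Suc n" for p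
  proof (cases "p = n")
    case True
    then show ?thesis using n by (auto simp: known_Suc_self hb_thr)
  next
    case False
    with that have "p < n" by simp
    then show ?thesis using known_Suc hb_nonlock_iff assms by (auto simp: known_def)
  qed
  then show ?thesis unfolding rel_clock_def thread_clock_def
    by (intro arg_cong[of _ _ "idx w"] lastpos_cong) simp
qed

lemma last_read_Suc:
  "last_read lo (Suc n) x u = (if \<sigma> ! n = (u, Read x) then Some n else last_read lo n x u)"
  using lo by (simp add: last_read_def)

lemma last_write_Suc:
  "last_write lo (Suc n) x = (if opn (\<sigma> ! n) = Write x then Some n else last_write lo n x)"
  using lo by (simp add: last_write_def)

lemma ordered_iff_le_clock:
  assumes i: "lo \<le> i" "i < n" "thr (\<sigma> ! i) \<noteq> thr (\<sigma> ! n)"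
    and "\<And>l. opn (\<sigma> ! i) \<noteq> Rel l" "\<And>l. opn (\<sigma> ! n) \<noteq> Acq l"
  shows "le_win (int (n mod w)) (int (i mod w)) (thread_clock lo n (thr (\<sigma> ! n)) (thr (\<sigma> ! i))) \<longleftrightarrow>
    (i, n) \<in> hb \<sigma>"
proof -
  have "(\<exists>p. i \<le> p \<and> p < n \<and> known n (thr (\<sigma> ! n)) (thr (\<sigma> ! i)) p) \<longleftrightarrow> (i, n) \<in> hb \<sigma>"
  proof
    assume "\<exists>p. i \<le> p \<and> p < n \<and> known n (thr (\<sigma> ! n)) (thr (\<sigma> ! i)) p"
    then obtain p where p: "i \<le> p" "p < n" "thr (\<sigma> ! p) = thr (\<sigma> ! i)" "(p, n) \<in> hb \<sigma>"
      using hb_nonlock_iff assms(5) by (auto simp: known_def rel_by_def)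
    then show "(i, n) \<in> hb \<sigma>" using hb_thr[of i p \<sigma>] n hb_trans[of i p \<sigma> n] by auto
  next
    assume "(i, n) \<in> hb \<sigma>"
    then obtain p where p: "i \<le> p" "thr (\<sigma> ! p) = thr (\<sigma> ! i)" "\<exists>l. opn (\<sigma> ! p) = Rel l" "(p, n) \<in> hb \<sigma>"
      using hb_leaves_thread[of i n \<sigma>] i(3) by auto
    moreover have "p < n" using p i(3) hb_le[of p n \<sigma>] by (metis le_neq_implies_less)
    ultimately show "\<exists>p. i \<le> p \<and> p < n \<and> known n (thr (\<sigma> ! n)) (thr (\<sigma> ! i)) p"
      using hb_nonlock_iff[of p] assms(5) by (auto simp: known_def rel_by_def)
  qed
  then show ?thesis
    unfolding thread_clock_def by (simp add: le_win_idx[OF i(1,2) lo(2)])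
qed

end

end

section \<open>Effect of the handlers\<close>

context window_hb
begin

text \<open>With the costs settled, a program is replaced by its effect on the memory, and a loop
  becomes a \<open>fold\<close>.\<close>

lemma mem_for_each:
  assumes "\<And>x m. mem (p x m) = f x (mem m)"
  shows "mem (for_each xs p m) = fold f xs (mem m)"
  unfolding for_each_def by (induction xs arbitrary: m) (simp_all add: assms)

lemmas prog_defs = seq_def fetch_def skip_def

lemma mem_handle_read:
  "mem (handle_read t x m) = (mem m)\<lparr>race := race (mem m) \<or> \<not> epoch_ok t x (mem m),
     rclock := (rclock (mem m))(x := Some
       ((case rclock (mem m) x of None \<Rightarrow> bot_clock | Some R \<Rightarrow> R)(t := head (mem m))))\<rparr>"
  by (cases "epoch_ok t x (mem m)"; cases "rclock (mem m) x")
    (simp_all add: handle_read_def prog_defs declare_race_def set_rentry_def fun_upd_idem)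

lemma mem_handle_write:
  "mem (handle_write t x m) =
    (mem m)\<lparr>race := race (mem m) \<or> \<not> (reads_ok t x (mem m) \<and> epoch_ok t x (mem m)),
      epoch := (epoch (mem m))(x := Some (t, head (mem m)))\<rparr>"
  by (auto simp: handle_write_def prog_defs declare_race_def)

definition acq_step :: "'t \<Rightarrow> 'l \<Rightarrow> 't \<Rightarrow> ('t, 'x, 'l) state \<Rightarrow> ('t, 'x, 'l) state"
  where "acq_step t l u s = (let c = the (lentry s l u); a = tclock s t u in
    upd_refs (\<lambda>A. A - {Inr l}) c
      (if less_win (head s) a c
       then set_tentry t u c (upd_refs (\<lambda>A. A - {Inl t}) a (upd_refs (insert (Inl t)) c s))
       else s))"

lemma mem_handle_acq:
  fixes m :: "('t, 'x, 'l) machine"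
  shows "mem (handle_acq t l m) = (if lclock (mem m) l = None then mem m
     else let s = fold (acq_step t l) ts (mem m) in s\<lparr>lclock := (lclock s)(l := None)\<rparr>)"
proof -
  let ?p = "\<lambda>u. fetch 1 (\<lambda>s. the (lentry s l u)) (\<lambda>c.
         fetch 1 (\<lambda>s. tclock s t u) (\<lambda>a.
         fetch 1 (\<lambda>s. less_win (head s) a c) (\<lambda>newer. if newer
           then (add_ref c (Inl t) ;; del_ref a (Inl t) ;; exec 1 (set_tentry t u c))
           else skip) ;;
         del_ref c (Inr l)))"
  have "mem (?p u m) = acq_step t l u (mem m)" for u and m :: "('t, 'x, 'l) machine"
    by (simp add: prog_defs acq_step_def Let_def add_ref_def del_ref_def)
  then have fe: "mem (for_each ts ?p m) = fold (acq_step t l) ts (mem m)" for m :: "('t, 'x, 'l) machine"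
    by (rule mem_for_each)
  \<comment> \<open>Naming the loop keeps the simplifier from unfolding its body before
    \<open>fe\<close> applies.\<close>
  define q where "q = for_each ts ?p"
  show ?thesis
    unfolding handle_acq_def q_def[symmetric]
    using fe[folded q_def] by (simp add: prog_defs null_lclock_def Let_def)
qed

definition rel_step :: "'t \<Rightarrow> 'l \<Rightarrow> 't \<Rightarrow> ('t, 'x, 'l) state \<Rightarrow> ('t, 'x, 'l) state"
  where "rel_step t l u s = set_lentry l u (tclock s t u) (upd_refs (insert (Inr l)) (tclock s t u) s)"

text \<open>A closed form exists because the loop reads only the clock of \<open>t\<close>, which it
  does not change.\<close>

lemma fold_rel_step:
  assumes "lclock s l = Some C"
  shows "fold (rel_step t l) us s = s\<lparr>
    lclock := (lclock s)(l := Some (\<lambda>u. if u \<in> set us then tclock s t u else C u)),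
    refs := (\<lambda>i. if i \<noteq> -1 \<and> (\<exists>u\<in>set us. tclock s t u = i)
       then map_option (insert (Inr l)) (refs s i) else refs s i)\<rparr>"
  using assms
proof (induction us arbitrary: s C)
  case Nil
  then show ?case by (simp add: fun_upd_idem)
next
  case (Cons u us)
  let ?s = "rel_step t l u s"
  have 1: "lclock ?s l = Some (C(u := tclock s t u))"
    using Cons.prems by (simp add: rel_step_def set_lentry_def)
  have t: "tclock ?s = tclock s" by (simp add: rel_step_def)
  have r: "refs ?s = (\<lambda>i. if i \<noteq> -1 \<and> tclock s t u = i
       then map_option (insert (Inr l)) (refs s i) else refs s i)"
    by (auto simp: rel_step_def upd_refs_def)
  have "fold (rel_step t l) (u # us) s = fold (rel_step t l) us ?s" by simp
  also have "\<dots> = ?s\<lparr>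
    lclock := (lclock ?s)(l := Some (\<lambda>v. if v \<in> set us then tclock ?s t v else (C(u := tclock s t u)) v)),
    refs := (\<lambda>i. if i \<noteq> -1 \<and> (\<exists>u\<in>set us. tclock ?s t u = i)
       then map_option (insert (Inr l)) (refs ?s i) else refs ?s i)\<rparr>"
    by (rule Cons.IH[OF 1])
  also have "\<dots> = s\<lparr>
    lclock := (lclock s)(l := Some (\<lambda>v. if v \<in> set (u # us) then tclock s t v else C v)),
    refs := (\<lambda>i. if i \<noteq> -1 \<and> (\<exists>u\<in>set (u # us). tclock s t u = i)
       then map_option (insert (Inr l)) (refs s i) else refs s i)\<rparr>"
  proof (rule state.equality)
    show "refs (?s\<lparr>
      lclock := (lclock ?s)(l := Some (\<lambda>v. if v \<in> set us then tclock ?s t v else (C(u := tclock s t u)) v)),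
      refs := (\<lambda>i. if i \<noteq> -1 \<and> (\<exists>u\<in>set us. tclock ?s t u = i)
         then map_option (insert (Inr l)) (refs ?s i) else refs ?s i)\<rparr>) =
      refs (s\<lparr>
      lclock := (lclock s)(l := Some (\<lambda>v. if v \<in> set (u # us) then tclock s t v else C v)),
      refs := (\<lambda>i. if i \<noteq> -1 \<and> (\<exists>u\<in>set (u # us). tclock s t u = i)
         then map_option (insert (Inr l)) (refs s i) else refs s i)\<rparr>)"
      unfolding t r by (auto simp: fun_eq_iff option.map_comp o_def)
  qed (auto simp: rel_step_def set_lentry_def fun_eq_iff)
  finally show ?case .
qed

lemma mem_handle_rel:
  fixes m :: "('t, 'x, 'l) machine"
  shows "mem (handle_rel t l m) = (let s = mem m; T = (tclock s)(t := (tclock s t)(t := head s)) in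
    s\<lparr>tclock := T,
      lclock := (lclock s)(l := Some (\<lambda>u. if u \<in> set ts then T t u else -1)),
      refs := (\<lambda>i. (if i \<noteq> -1 \<and> (\<exists>u\<in>set ts. T t u = i) then map_option (insert (Inr l)) else id)
        (if i = head s then Some {Inl t}
         else if i \<noteq> -1 \<and> i = tclock s t t then map_option (\<lambda>A. A - {Inl t}) (refs s i)
         else refs s i))\<rparr>)"
proof -
  let ?p = "\<lambda>u. fetch 1 (\<lambda>s. tclock s t u) (\<lambda>a. add_ref a (Inr l) ;; exec 1 (set_lentry l u a))"
  have "mem (?p u m) = rel_step t l u (mem m)" for u and m :: "('t, 'x, 'l) machine"
    by (simp add: prog_defs rel_step_def add_ref_def)
  then have fe: "mem (for_each ts ?p m) = fold (rel_step t l) ts (mem m)" for m :: "('t, 'x, 'l) machine"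
    by (rule mem_for_each)
  let ?s = "mem m"
  let ?T = "(tclock ?s)(t := (tclock ?s t)(t := head ?s))"
  let ?R = "(refs (upd_refs (\<lambda>A. A - {Inl t}) (tclock ?s t t) ?s))(head ?s := Some {Inl t})"
  let ?s' = "?s\<lparr>tclock := ?T, lclock := (lclock ?s)(l := Some bot_clock), refs := ?R\<rparr>"
  have s': "(set_tentry t t (head ?s) ((upd_refs (\<lambda>A. A - {Inl t}) (tclock ?s t t) ?s)\<lparr>refs := ?R\<rparr>))
      \<lparr>lclock := (lclock ?s)(l := Some bot_clock)\<rparr> = ?s'"
    by (rule state.equality) (simp_all add: set_tentry_def)
  define P :: "('t, 'x, 'l) prog" where "P = for_each ts ?p"
  have "mem (handle_rel t l m) = fold (rel_step t l) ts ?s'"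
    unfolding s'[symmetric] handle_rel_def P_def[symmetric]
    using fe[folded P_def] by (simp add: prog_defs del_ref_def)
  also have "\<dots> = ?s'\<lparr>
    lclock := (lclock ?s')(l := Some (\<lambda>u. if u \<in> set ts then tclock ?s' t u else bot_clock u)),
    refs := (\<lambda>i. if i \<noteq> -1 \<and> (\<exists>u\<in>set ts. tclock ?s' t u = i)
       then map_option (insert (Inr l)) (refs ?s' i) else refs ?s' i)\<rparr>"
    by (rule fold_rel_step) simp
  finally show ?thesis
    by (simp add: Let_def bot_clock_def upd_refs_def fun_eq_iff)
qed

lemma mem_post_read:
  "mem (post_read t x m) = (let s = mem m;
      s' = (if rentry s x t = Some (head s) then set_rentry x t (-1) s else s)
    in if \<forall>u\<in>set ts. rentry s' x u = Some (-1) then s'\<lparr>rclock := (rclock s')(x := None)\<rparr> else s')"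
  by (simp add: post_read_def prog_defs Let_def null_rclock_def)

lemma mem_post_write:
  "mem (post_write t x m) = (if epoch (mem m) x = Some (t, head (mem m))
     then (mem m)\<lparr>epoch := (epoch (mem m))(x := None)\<rparr> else mem m)"
  by (simp add: post_write_def prog_defs)

definition clear_refs :: "'t \<Rightarrow> ('t + 'l) set \<Rightarrow> ('t, 'x, 'l) state \<Rightarrow> ('t, 'x, 'l) state"
  where "clear_refs t A s = s\<lparr>
    tclock := (\<lambda>u v. if Inl u \<in> A \<and> v = t then -1 else tclock s u v),
    lclock := (\<lambda>m. map_option (\<lambda>C v. if Inr m \<in> A \<and> v = t then -1 else C v) (lclock s m))\<rparr>"

text \<open>All visited entries receive the same value -1, so the arbitrary order chosen by
  \<open>elems\<close> does not influence the result.\<close>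

lemma fold_clear_refs:
  "fold (case_sum (\<lambda>u. set_tentry u t (-1)) (\<lambda>m. set_lentry m t (-1))) zs s = clear_refs t (set zs) s"
proof (induction zs arbitrary: s)
  case Nil
  show ?case
    by (rule state.equality) (simp_all add: clear_refs_def fun_eq_iff option.map_ident[unfolded id_def])
next
  case (Cons z zs)
  then show ?case
    by (cases z) (auto simp: clear_refs_def set_tentry_def set_lentry_def fun_eq_iff option.map_comp o_def
        intro!: state.equality map_option_cong)
qed

lemma mem_post_rel:
  fixes m :: "('t, 'x, 'l) machine"
  assumes "fin_refs (mem m)" and A: "refs (mem m) (head (mem m)) = Some A"
  shows "mem (post_rel t l m) = (let s = mem m; s1 = clear_refs t A s;
      s2 = (if lentry s l t = Some (head s) \<and> (\<forall>u\<in>set ts. lentry s1 l u = Some (-1))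
            then s1\<lparr>lclock := (lclock s1)(l := None)\<rparr> else s1)
    in s2\<lparr>refs := (refs s2)(head s2 := None)\<rparr>)"
proof -
  let ?p = "\<lambda>z. case z of Inl u \<Rightarrow> exec 1 (set_tentry u t (-1)) | Inr m \<Rightarrow> exec 1 (set_lentry m t (-1))"
  let ?q = "\<lambda>u. fetch 1 (\<lambda>s. the (lentry s l u)) (\<lambda>c. del_ref c (Inr l))"
  have "mem (?p z m) = case_sum (\<lambda>u. set_tentry u t (-1)) (\<lambda>m. set_lentry m t (-1)) z (mem m)"
    for z and m :: "('t, 'x, 'l) machine"
    by (cases z) simp_all
  then have p: "mem (for_each zs ?p m) = clear_refs t (set zs) (mem m)"
    for zs and m :: "('t, 'x, 'l) machine"
    unfolding fold_clear_refs[symmetric] by (rule mem_for_each)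
  have "mem (?q u m) = upd_refs (\<lambda>A. A - {Inr l}) (the (lentry (mem m) l u)) (mem m)"
    for u and m :: "('t, 'x, 'l) machine"
    by (simp add: fetch_def del_ref_def)
  then have q': "mem (for_each ts ?q m) =
      fold (\<lambda>u s. upd_refs (\<lambda>A. A - {Inr l}) (the (lentry s l u)) s) ts (mem m)"
    for m :: "('t, 'x, 'l) machine"
    by (rule mem_for_each)
  \<comment> \<open>When the clock is dropped all its entries are -1, and operations on
    \<open>S_{-1}\<close> do nothing, so this loop has no effect on the memory.\<close>
  have q: "mem (for_each ts ?q m) = mem m" if "\<forall>u\<in>set ts. lentry (mem m) l u = Some (-1)"
    for m :: "('t, 'x, 'l) machine"
  proof -
    have "fold (\<lambda>u s. upd_refs (\<lambda>A. A - {Inr l}) (the (lentry s l u)) s) us s = s"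
      if "\<forall>u\<in>set us. lentry s l u = Some (-1)" for us and s :: "('t, 'x, 'l) state"
      using that by (induction us) (auto simp: upd_refs_def)
    then show ?thesis using that q' by simp
  qed
  have "finite A" using assms by (auto simp: fin_refs_def)
  then have "set (elems A) = A" by (rule elems)
  then have p: "mem (for_each (elems A) ?p m) = clear_refs t A (mem m)"
    for m :: "('t, 'x, 'l) machine"
    using p by simp
  define P :: "('t, 'x, 'l) prog" where "P = for_each (elems A) ?p"
  define Q :: "('t, 'x, 'l) prog" where "Q = for_each ts ?q"
  have "post_rel t l m = exec 1 (\<lambda>s. s\<lparr>refs := (refs s)(head s := None)\<rparr>)
      (fetch (length ts) (\<lambda>s. \<forall>u\<in>set ts. lentry s l u = Some (-1)) (\<lambda>cleared.
         if lentry (mem m) l t = Some (head (mem m)) \<and> cleared then (Q ;; null_lclock l) else skip)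
       (P (spend 1 (spend 1 m))))"
    unfolding post_rel_def P_def Q_def seq_def fetch_def by (simp add: A)
  then show ?thesis
    using q[folded Q_def] p[folded P_def] by (simp add: prog_defs Let_def null_lclock_def)
qed

end

section \<open>Preservation of the prescribed state\<close>

context windowed_trace
begin

lemma le_win_minus1 [simp]: "le_win h (-1) b"
  by (simp add: le_win_def)

lemma refs_ok_Suc_lo:
  assumes "refs_ok lo n s" "\<And>l. opn (\<sigma> ! lo) \<noteq> Rel l" "lo < n"
    "refs s' = refs s" "tclock s' = tclock s" "lclock s' = lclock s"
  shows "refs_ok (Suc lo) n s'"
proof -
  have "pointers s' = pointers s" using assms by (simp add: pointers_def lentry_def fun_eq_iff)
  moreover have "refs s (int i) = None" if "i < w" "\<forall>p. Suc lo \<le> p \<and> p < n \<longrightarrow> p mod w \<noteq> i" for i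
  proof (cases "lo mod w = i")
    case True
    then show ?thesis using assms(1-3) by (auto simp: refs_ok_def)
  next
    case False
    then have "\<forall>p. lo \<le> p \<and> p < n \<longrightarrow> p mod w \<noteq> i" using that by (metis Suc_leI le_neq_implies_less)
    then show ?thesis using assms(1) that by (simp add: refs_ok_def)
  qed
  ultimately show ?thesis using assms(1,4) by (simp add: refs_ok_def)
qed

lemma refs_ok_Suc:
  assumes "refs_ok lo n s" "\<And>l. opn (\<sigma> ! n) \<noteq> Rel l" "n < lo + w"
    "refs s' = refs s" "tclock s' = tclock s" "lclock s' = lclock s"
  shows "refs_ok lo (Suc n) s'"
proof -
  have "pointers s' = pointers s" using assms by (simp add: pointers_def lentry_def fun_eq_iff)
  moreover have "p mod w \<noteq> n mod w" if "lo \<le> p" "p < n" for p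
    using mod_eq_window[of p w n] that assms(3) by auto
  then have "refs s (int (n mod w)) = None"
    using assms(1) w by (auto simp: refs_ok_def)
  ultimately show ?thesis using assms(1,2,4) by (auto simp: refs_ok_def less_Suc_eq)
qed

section \<open>Post-handlers establish the state prescribed after an eviction\<close>

context
  fixes lo n :: nat
  assumes lo: "lo < n" and n: "n \<le> lo + w" "n \<le> length \<sigma>"
begin

text \<open>A frame rule: evicting anything but a release affects neither thread clocks nor lock
  clocks nor reference sets, so only the tables of accesses remain to be checked.\<close>

lemma good_Suc_lo:
  assumes "good lo n s" "\<And>l. opn (\<sigma> ! lo) \<noteq> Rel l"
    "refs s' = refs s" "tclock s' = tclock s" "lclock s' = lclock s" "race s' = race s"
    "rclock s' = read_clock (Suc lo) n" "epoch s' = write_epoch (Suc lo) n"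
  shows "good (Suc lo) n s'"
proof -
  note ctx = lo n
  have "thread_clock (Suc lo) n = thread_clock lo n"
    using thread_clock_Suc_lo[OF ctx] thread_clock_eq_lo[OF ctx] assms(2) by (auto simp: fun_eq_iff)
  moreover have "lock_clock (Suc lo) n = lock_clock lo n"
  proof
    fix l
    have "open_rel lo n l \<noteq> Some lo" using open_rel_SomeD[of lo n l lo] assms(2)[of l] by auto
    moreover have "rel_clock (Suc lo) n = rel_clock lo n"
      using rel_clock_Suc_lo[OF ctx] rel_clock_eq_lo[OF ctx] assms(2) by (auto simp: fun_eq_iff)
    ultimately show "lock_clock (Suc lo) n l = lock_clock lo n l"
      by (simp add: lock_clock_def open_rel_Suc_lo[OF ctx])
  qed
  moreover have "refs_ok (Suc lo) n s'"
    using refs_ok_Suc_lo[OF _ assms(2) lo assms(3-5)] assms(1) by (simp add: good_def)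
  ultimately show ?thesis using assms by (simp add: good_def)
qed

lemma read_clock_Suc_lo:
  assumes "opn (\<sigma> ! lo) \<noteq> Read x"
  shows "read_clock (Suc lo) n x = read_clock lo n x"
proof -
  have "last_read lo n x u \<noteq> Some lo" for u
    using assms by (auto simp: last_read_def lastpos_Some opn_def)
  then show ?thesis by (simp add: read_clock_def last_read_Suc_lo[OF lo n])
qed

lemma write_epoch_Suc_lo:
  assumes "opn (\<sigma> ! lo) \<noteq> Write x"
  shows "write_epoch (Suc lo) n x = write_epoch lo n x"
proof -
  have "last_write lo n x \<noteq> Some lo"
    using assms by (auto simp: last_write_def lastpos_Some)
  then show ?thesis by (simp add: write_epoch_def last_write_Suc_lo[OF lo n])
qed

lemma last_read_eq_idx:
  "idx w (last_read lo n x u) = int (lo mod w) \<longleftrightarrow> last_read lo n x u = Some lo"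
  unfolding last_read_def using lo n by (intro idx_eq_mod) auto

lemma good_post_read:
  assumes "good lo n (mem m)" "head (mem m) = int (lo mod w)" "opn (\<sigma> ! lo) = Read x"
  shows "good (Suc lo) n (mem (post_read (thr (\<sigma> ! lo)) x m))"
proof -
  let ?s = "mem m" and ?t = "thr (\<sigma> ! lo)"
  let ?s' = "if rentry ?s x ?t = Some (head ?s) then set_rentry x ?t (-1) ?s else ?s"
  have rc: "rclock ?s = read_clock lo n" and ep: "epoch ?s = write_epoch lo n"
    using assms(1) by (auto simp: good_def)
  have lo_read: "\<sigma> ! lo = (?t, Read x)" using assms(3) by (simp add: event_eq_iff)
  have "last_read lo n x ?t \<noteq> None"
    using lo lo_read by (auto simp: last_read_def lastpos_None)
  then have ex: "\<exists>u. last_read lo n x u \<noteq> None" by blast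
  then have R: "rclock ?s x = Some (\<lambda>u. idx w (last_read lo n x u))" by (auto simp: rc read_clock_def)
  have other: "last_read lo n x u \<noteq> Some lo" if "u \<noteq> ?t" for u
    using that lo_read by (auto simp: last_read_def lastpos_Some thr_def)
  have s': "rclock ?s' = (rclock ?s)(x := Some (\<lambda>u. idx w (last_read (Suc lo) n x u)))"
  proof -
    have "(\<lambda>u. idx w (last_read (Suc lo) n x u)) = (\<lambda>u. idx w (last_read lo n x u))
        (?t := if last_read lo n x ?t = Some lo then -1 else idx w (last_read lo n x ?t))"
      using other by (auto simp: last_read_Suc_lo[OF lo n])
    then show ?thesis
      by (auto simp: rentry_def R assms(2) last_read_eq_idx set_rentry_def fun_upd_idem)
  qed
  \<comment> \<open>The emptiness test runs over \<open>ts\<close> only; a thread outside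
    \<open>ts\<close> has no event in the trace, hence no read.\<close>
  have none: "last_read (Suc lo) n x u = None" if "u \<notin> set ts" for u
  proof (rule ccontr)
    assume "last_read (Suc lo) n x u \<noteq> None"
    then obtain p where "p < n" "\<sigma> ! p = (u, Read x)" by (auto simp: last_read_def lastpos_Some)
    then have "u \<in> set ts" using n unfolding set_ts threads_def
      by (metis (no_types, lifting) fst_conv image_eqI nth_mem order_less_le_trans thr_def)
    with that show False by simp
  qed
  have all: "(\<forall>u\<in>set ts. rentry ?s' x u = Some (-1)) \<longleftrightarrow> (\<forall>u. last_read (Suc lo) n x u = None)"
  proof -
    have "rclock ?s' x = Some (\<lambda>u. idx w (last_read (Suc lo) n x u))" using fun_cong[OF s', of x] by simp
    then have "rentry ?s' x u = Some (-1) \<longleftrightarrow> last_read (Suc lo) n x u = None" for u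
      unfolding rentry_def by simp
    then show ?thesis using none by blast
  qed
  have fr: "refs ?s' = refs ?s" "tclock ?s' = tclock ?s" "lclock ?s' = lclock ?s" "race ?s' = race ?s"
    "epoch ?s' = epoch ?s" by simp_all
  have "rclock (mem (post_read ?t x m)) = read_clock (Suc lo) n"
  proof
    fix y
    show "rclock (mem (post_read ?t x m)) y = read_clock (Suc lo) n y"
    proof (cases "y = x")
      case True
      then show ?thesis
        unfolding mem_post_read Let_def all by (simp only: s' read_clock_def split: if_split) (simp add: s')
    next
      case False
      then have "opn (\<sigma> ! lo) \<noteq> Read y" using assms(3) by simp
      then have "read_clock (Suc lo) n y = read_clock lo n y" by (rule read_clock_Suc_lo)
      then show ?thesis
        unfolding mem_post_read Let_def using False
        by (simp only: s' split: if_split) (simp add: s' rc)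
    qed
  qed
  moreover have "epoch (mem (post_read ?t x m)) = write_epoch (Suc lo) n"
    using write_epoch_Suc_lo assms(3) ep by (auto simp: mem_post_read Let_def fun_eq_iff)
  ultimately show ?thesis
    by (intro good_Suc_lo[OF assms(1)]) (auto simp: assms(3) mem_post_read Let_def)
qed

lemma good_post_write:
  assumes "good lo n (mem m)" "head (mem m) = int (lo mod w)" "opn (\<sigma> ! lo) = Write x"
  shows "good (Suc lo) n (mem (post_write (thr (\<sigma> ! lo)) x m))"
proof -
  let ?s = "mem m" and ?t = "thr (\<sigma> ! lo)"
  have rc: "rclock ?s = read_clock lo n" and ep: "epoch ?s = write_epoch lo n"
    using assms(1) by (auto simp: good_def)
  have "epoch ?s x = Some (?t, head ?s) \<longleftrightarrow> last_write lo n x = Some lo"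
    using idx_eq_mod[OF order_refl lo n(1), of "\<lambda>p. opn (\<sigma> ! p) = Write x"] lo
    by (auto simp: ep write_epoch_def last_write_def assms(2))
  then have "epoch (mem (post_write ?t x m)) y = write_epoch (Suc lo) n y" for y
    using write_epoch_Suc_lo[of y] assms(3) ep last_write_Suc_lo[OF lo n, of x]
    by (cases "y = x") (auto simp: mem_post_write write_epoch_def)
  then have e: "epoch (mem (post_write ?t x m)) = write_epoch (Suc lo) n" by (rule ext)
  have "rclock (mem (post_write ?t x m)) = rclock ?s" by (simp add: mem_post_write)
  also have "\<dots> = read_clock (Suc lo) n"
    using read_clock_Suc_lo assms(3) rc by (auto simp: fun_eq_iff)
  finally show ?thesis
    using e by (intro good_Suc_lo[OF assms(1)]) (auto simp: assms(3) mem_post_write)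
qed

lemma good_post_acq:
  assumes "good lo n s" "opn (\<sigma> ! lo) = Acq l"
  shows "good (Suc lo) n s"
  using assms read_clock_Suc_lo write_epoch_Suc_lo
  by (intro good_Suc_lo[OF assms(1)]) (auto simp: good_def fun_eq_iff)

lemma good_post_rel:
  assumes good: "good lo n (mem m)" and h: "head (mem m) = int (lo mod w)"
    and rel: "opn (\<sigma> ! lo) = Rel l" and fin: "fin_refs (mem m)"
  shows "good (Suc lo) n (mem (post_rel (thr (\<sigma> ! lo)) l m))"
proof -
  note ctx = lo n
  let ?s = "mem m" and ?t = "thr (\<sigma> ! lo)" and ?h = "int (lo mod w)"
  let ?A = "pointers ?s lo"
  have tc: "tclock ?s = thread_clock lo n" and lc: "lclock ?s = lock_clock lo n"
    and rc: "rclock ?s = read_clock lo n" and ep: "epoch ?s = write_epoch lo n"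
    and refs: "refs_ok lo n ?s" and race: "race ?s = race_before n"
    using good by (auto simp: good_def)
  have A: "refs ?s (head ?s) = Some ?A" using refs lo rel by (auto simp: refs_ok_def h)
  let ?s1 = "clear_refs ?t ?A ?s"
  let ?s2 = "if lentry ?s l ?t = Some (head ?s) \<and> (\<forall>u\<in>set ts. lentry ?s1 l u = Some (-1))
            then ?s1\<lparr>lclock := (lclock ?s1)(l := None)\<rparr> else ?s1"
  let ?s' = "?s2\<lparr>refs := (refs ?s2)(head ?s2 := None)\<rparr>"
  have eq: "mem (post_rel ?t l m) = ?s'"
    using mem_post_rel[OF fin A] by (simp add: Let_def)
  have t1: "tclock ?s1 = thread_clock (Suc lo) n"
  proof (intro ext)
    fix t u
    show "tclock ?s1 t u = thread_clock (Suc lo) n t u"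
      using thread_clock_eq_lo[OF ctx, of t u]
      by (cases "u = ?t") (auto simp: clear_refs_def pointers_def tc thread_clock_Suc_lo[OF ctx])
  qed
  have l1: "lclock ?s1 m = map_option (rel_clock (Suc lo) n) (open_rel lo n m)" for m
  proof (cases "open_rel lo n m")
    case (Some r)
    have "(if Inr m \<in> ?A \<and> u = ?t then -1 else rel_clock lo n r u) = rel_clock (Suc lo) n r u" for u
      using rel_clock_eq_lo[OF ctx, of r u]
      by (cases "u = ?t")
        (auto simp: pointers_def lentry_def lc lock_clock_def Some rel_clock_Suc_lo[OF ctx])
    then show ?thesis by (simp add: clear_refs_def lc lock_clock_def Some)
  qed (simp add: clear_refs_def lc lock_clock_def)
  \<comment> \<open>The combined test holds exactly when the evicted release owns
    \<open>C_l\<close>: an owner that stays in the window keeps its own component, while an evicted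
    owner leaves nothing.\<close>
  have drop: "lentry ?s l ?t = Some (head ?s) \<and> (\<forall>u\<in>set ts. lentry ?s1 l u = Some (-1)) \<longleftrightarrow>
      open_rel lo n l = Some lo"
  proof
    assume *: "lentry ?s l ?t = Some (head ?s) \<and> (\<forall>u\<in>set ts. lentry ?s1 l u = Some (-1))"
    then obtain r where r: "open_rel lo n l = Some r"
      by (auto simp: lentry_def lc lock_clock_def)
    show "open_rel lo n l = Some lo"
    proof (rule ccontr)
      assume "open_rel lo n l \<noteq> Some lo"
      then have "r \<noteq> lo" using r by auto
      from rel_clock_creator[OF ctx r this] * show False
        by (auto simp: lentry_def l1 r)
    qed
  next
    assume o: "open_rel lo n l = Some lo"
    then show "lentry ?s l ?t = Some (head ?s) \<and> (\<forall>u\<in>set ts. lentry ?s1 l u = Some (-1))"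
      using rel_clock_open_lo[OF ctx rel] rel_clock_Suc_lo[OF ctx]
      by (auto simp: lentry_def l1 lc lock_clock_def h)
  qed
  have l': "lclock ?s' = lock_clock (Suc lo) n"
  proof
    fix k
    have "open_rel lo n k \<noteq> Some lo" if "k \<noteq> l" using that open_rel_SomeD[of lo n k lo] rel by auto
    then show "lclock ?s' k = lock_clock (Suc lo) n k"
      unfolding drop by (auto simp: l1 lock_clock_def open_rel_Suc_lo[OF ctx])
  qed
  have t': "tclock ?s' = thread_clock (Suc lo) n" using t1 by simp
  have r': "refs ?s' = (refs ?s)(?h := None)" using h by (simp add: clear_refs_def)
  have ne: "p mod w \<noteq> lo mod w" if "Suc lo \<le> p" "p < n" for p
    using mod_eq_window[of p w lo] that n by auto
  \<comment> \<open>Only entries with the index of \<open>lo\<close> change, and no remaining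
    position has that index. A dropped clock had no other entry, so no remaining set referred to
    it.\<close>
  have ptr: "pointers z p = pointers ?s p" if p: "Suc lo \<le> p" "p < n"
    and z: "tclock z = thread_clock (Suc lo) n" "lclock z = lock_clock (Suc lo) n" for p z
  proof -
    have "thread_clock (Suc lo) n t u = int (p mod w) \<longleftrightarrow> thread_clock lo n t u = int (p mod w)" for t u
      using ne[OF p] by (auto simp: thread_clock_Suc_lo[OF ctx] simp flip: of_nat_mod)
    moreover have "map_option (\<lambda>C. C u) (lock_clock (Suc lo) n k) = Some (int (p mod w)) \<longleftrightarrow>
        map_option (\<lambda>C. C u) (lock_clock lo n k) = Some (int (p mod w))" for k u
    proof (cases "open_rel lo n k")
      case None
      then show ?thesis by (simp add: lock_clock_def open_rel_Suc_lo[OF ctx])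
    next
      case (Some r)
      then have "opn (\<sigma> ! r) = Rel k" using open_rel_SomeD by blast
      then show ?thesis using ne[OF p] Some rel_clock_open_lo[OF ctx, of k u]
        by (auto simp: lock_clock_def open_rel_Suc_lo[OF ctx] rel_clock_Suc_lo[OF ctx]
            simp flip: of_nat_mod split: if_splits)
    qed
    ultimately show ?thesis
      unfolding pointers_def lentry_def z tc lc by simp
  qed
  have "refs_ok (Suc lo) n ?s'"
  proof -
    have "refs ?s' (int (p mod w)) = (if \<exists>l. opn (\<sigma> ! p) = Rel l then Some (pointers ?s' p) else None)"
      if p: "Suc lo \<le> p" "p < n" for p
      using refs ne[OF p] ptr[OF p t' l'] p unfolding refs_ok_def r' by (simp flip: of_nat_mod)
    moreover have "refs ?s' (int i) = None" if "i < w" "\<forall>p. Suc lo \<le> p \<and> p < n \<longrightarrow> p mod w \<noteq> i" for i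
    proof (cases "lo mod w = i")
      case False
      then have "\<forall>p. lo \<le> p \<and> p < n \<longrightarrow> p mod w \<noteq> i" using that by (metis Suc_leI le_neq_implies_less)
      then show ?thesis using refs that unfolding refs_ok_def r' by simp
    qed (simp add: r')
    ultimately show ?thesis unfolding refs_ok_def by blast
  qed
  moreover have "rclock ?s' = read_clock (Suc lo) n" "epoch ?s' = write_epoch (Suc lo) n"
      "race ?s' = race_before n"
    using read_clock_Suc_lo write_epoch_Suc_lo rel race
    by (auto simp: clear_refs_def rc ep fun_eq_iff)
  ultimately show ?thesis
    unfolding eq good_def using t' l' by blast
qed

lemma good_post_handle:
  assumes "good lo n (mem m)" "head (mem m) = int (lo mod w)" "fin_refs (mem m)"
  shows "good (Suc lo) n (mem (post_handle (\<sigma> ! lo) m))"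
  unfolding post_handle_def
  using assms good_post_read good_post_write good_post_acq good_post_rel
  by (cases "opn (\<sigma> ! lo)") (auto simp: skip_def)

end

text \<open>An entry stems from an event of each of the two threads. Outside \<open>ts\<close> all
  entries are therefore -1, and loops over \<open>ts\<close> reach everything that matters.\<close>

lemma good_threads:
  assumes "n \<le> length \<sigma>" "thread_clock lo n t u \<noteq> -1"
  shows "t \<in> set ts" "u \<in> set ts"
proof -
  have thr: "thr (\<sigma> ! k) \<in> set ts" if "k < n" for k
    using that assms(1) by (auto simp: set_ts threads_def)
  obtain p where "p < n" "known n t u p" using assms(2) by (auto simp: thread_clock_def lastpos_Some)
  then show "t \<in> set ts" "u \<in> set ts" using thr by (auto simp: known_def rel_by_def)
qed

lemma rel_clock_threads:
  assumes "n \<le> length \<sigma>" "rel_clock lo n r u \<noteq> -1"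
  shows "u \<in> set ts"
proof -
  obtain p where "p < n" "rel_by u p" using assms(2) by (auto simp: rel_clock_def lastpos_Some)
  then show ?thesis using assms(1) by (auto simp: rel_by_def set_ts threads_def)
qed

section \<open>Handlers establish the state prescribed after an arrival\<close>

context
  fixes lo n :: nat
  assumes lo: "lo = Suc n - w" and n: "n < length \<sigma>"
begin

lemma lo_le: "lo \<le> n" "n < lo + w"
  using lo w by auto

text \<open>With \<open>lo = Suc n - w\<close> the interval \<open>lo..<n\<close> consists exactly
  of the possible partners of \<open>n\<close> in a short race; truncated subtraction gives 0 while
  the window is still filling.\<close>

lemma race_before_Suc:
  "race_before (Suc n) \<longleftrightarrow> race_before n \<or> (\<exists>i. lo \<le> i \<and> i < n \<and> hb_race \<sigma> i n)"
proof -
  have "n - i + 1 \<le> w \<longleftrightarrow> lo \<le> i" if "i < n" for i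
    using that lo by auto
  moreover have "race_before (Suc n) \<longleftrightarrow>
      race_before n \<or> (\<exists>i. i < n \<and> hb_race \<sigma> i n \<and> n - i + 1 \<le> w)"
    unfolding race_before_def less_Suc_eq by blast
  ultimately show ?thesis by blast
qed

lemma hb_race_iff: "i < n \<Longrightarrow> hb_race \<sigma> i n \<longleftrightarrow> conflicting (\<sigma> ! i) (\<sigma> ! n) \<and> (i, n) \<notin> hb \<sigma>"
  using hb_le[of n i \<sigma>] by (auto simp: hb_race_def)

lemma idx_pos_iff:
  assumes "lo \<le> p" "p < n"
  shows "idx w (lastpos lo n P) = int (p mod w) \<longleftrightarrow> lastpos lo n P = Some p"
  using assms lo_le by (intro idx_eq_mod) auto

lemma idx_ne_n: "idx w (lastpos lo n P) \<noteq> int (n mod w)"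
proof (cases "lastpos lo n P")
  case (Some p)
  then have "lo \<le> p" "p < n" by (auto simp: lastpos_Some)
  then show ?thesis using Some mod_eq_window[of p w n] lo_le by auto
qed simp

lemma thread_clock_posD:
  assumes "lo \<le> p" "p < n" "thread_clock lo n t u = int (p mod w)"
  shows "thr (\<sigma> ! p) = u"
  using assms by (auto simp: thread_clock_def idx_pos_iff lastpos_Some known_def rel_by_def)

lemma rel_clock_posD:
  assumes "lo \<le> p" "p < n" "rel_clock lo n r u = int (p mod w)"
  shows "thr (\<sigma> ! p) = u"
  using assms by (auto simp: rel_clock_def idx_pos_iff lastpos_Some rel_by_def)

lemma thread_clock_ne_n: "thread_clock lo n t u \<noteq> int (n mod w)"
  unfolding thread_clock_def by (rule idx_ne_n)

lemma rel_clock_ne_n: "rel_clock lo n r u \<noteq> int (n mod w)"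
  unfolding rel_clock_def by (rule idx_ne_n)

lemma good_Suc_access:
  assumes "good lo n s" "opn (\<sigma> ! n) \<in> {Read x, Write x}"
    "refs s' = refs s" "tclock s' = tclock s" "lclock s' = lclock s"
    "rclock s' = read_clock lo (Suc n)" "epoch s' = write_epoch lo (Suc n)"
    "race s' = race_before (Suc n)"
  shows "good lo (Suc n) s'"
proof -
  note ctx = lo_le n
  have nl: "opn (\<sigma> ! n) \<noteq> Rel l" "opn (\<sigma> ! n) \<noteq> Acq l" for l using assms(2) by auto
  have "thread_clock lo (Suc n) = thread_clock lo n"
    using thread_clock_Suc_nonacq[OF ctx nl(2)] nl by (auto simp: fun_eq_iff rel_by_def)
  moreover have "lock_clock lo (Suc n) = lock_clock lo n"
  proof
    fix l
    show "lock_clock lo (Suc n) l = lock_clock lo n l"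
    proof (cases "open_rel lo n l")
      case (Some r)
      then have "r < n" using open_rel_SomeD by blast
      then show ?thesis
        using rel_clock_Suc[OF ctx] by (auto simp: lock_clock_def open_rel_Suc[OF ctx] nl Some)
    qed (simp add: lock_clock_def open_rel_Suc[OF ctx] nl)
  qed
  moreover have "refs_ok lo (Suc n) s'"
    using refs_ok_Suc[OF _ nl(1) lo_le(2) assms(3-5)] assms(1) by (simp add: good_def)
  ultimately show ?thesis using assms by (simp add: good_def)
qed

lemma read_clock_Suc_other:
  assumes "opn (\<sigma> ! n) \<noteq> Read x"
  shows "read_clock lo (Suc n) x = read_clock lo n x"
proof -
  have "\<sigma> ! n \<noteq> (u, Read x)" for u using assms by (auto simp: opn_def)
  then show ?thesis by (simp add: read_clock_def last_read_Suc[OF lo_le n])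
qed

lemma write_epoch_Suc_other:
  "opn (\<sigma> ! n) \<noteq> Write x \<Longrightarrow> write_epoch lo (Suc n) x = write_epoch lo n x"
  by (simp add: write_epoch_def last_write_Suc[OF lo_le n])

lemma epoch_ok_iff:
  assumes "good lo n s" "head s = int (n mod w)" "opn (\<sigma> ! n) \<in> {Read y, Write y}"
  shows "epoch_ok (thr (\<sigma> ! n)) x s \<longleftrightarrow>
    (\<forall>i. last_write lo n x = Some i \<longrightarrow> thr (\<sigma> ! i) = thr (\<sigma> ! n) \<or> (i, n) \<in> hb \<sigma>)"
proof (cases "last_write lo n x")
  case None
  then show ?thesis using assms(1) by (simp add: epoch_ok_def good_def write_epoch_def)
next
  case (Some i)
  then have "lo \<le> i" "i < n" "opn (\<sigma> ! i) = Write x" by (auto simp: last_write_def lastpos_Some)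
  then have "thr (\<sigma> ! i) \<noteq> thr (\<sigma> ! n) \<Longrightarrow>
     le_win (int (n mod w)) (int (i mod w)) (thread_clock lo n (thr (\<sigma> ! n)) (thr (\<sigma> ! i))) \<longleftrightarrow>
     (i, n) \<in> hb \<sigma>"
    using assms(3) by (intro ordered_iff_le_clock[OF lo_le n]) auto
  then show ?thesis using assms(1,2) Some by (auto simp: epoch_ok_def good_def write_epoch_def)
qed

lemma reads_ok_iff:
  assumes "good lo n s" "head s = int (n mod w)" "opn (\<sigma> ! n) \<in> {Read y, Write y}"
  shows "reads_ok (thr (\<sigma> ! n)) x s \<longleftrightarrow>
    (\<forall>u i. u \<noteq> thr (\<sigma> ! n) \<and> last_read lo n x u = Some i \<longrightarrow> (i, n) \<in> hb \<sigma>)"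
proof -
  have *: "le_win (int (n mod w)) (int (i mod w)) (thread_clock lo n (thr (\<sigma> ! n)) u) \<longleftrightarrow> (i, n) \<in> hb \<sigma>"
    and mem_ts: "u \<in> set ts"
    if u: "u \<noteq> thr (\<sigma> ! n)" "last_read lo n x u = Some i" for u i
  proof -
    have i: "lo \<le> i" "i < n" "opn (\<sigma> ! i) = Read x" "thr (\<sigma> ! i) = u"
      using u by (auto simp: last_read_def lastpos_Some opn_def thr_def)
    then show "le_win (int (n mod w)) (int (i mod w)) (thread_clock lo n (thr (\<sigma> ! n)) u) \<longleftrightarrow> (i, n) \<in> hb \<sigma>"
      using assms(3) u ordered_iff_le_clock[OF lo_le n, of i] by auto
    show "u \<in> set ts" using i n by (auto simp: set_ts threads_def)
  qed
  have "le_win (int (n mod w)) (idx w (last_read lo n x u)) (thread_clock lo n (thr (\<sigma> ! n)) u) \<longleftrightarrow>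
      (\<forall>i. last_read lo n x u = Some i \<longrightarrow> (i, n) \<in> hb \<sigma>)" if "u \<noteq> thr (\<sigma> ! n)" for u
    using * that by (cases "last_read lo n x u") auto
  moreover have "rclock s = read_clock lo n" "tclock s = thread_clock lo n"
    using assms(1) by (auto simp: good_def)
  ultimately have r: "reads_ok (thr (\<sigma> ! n)) x s \<longleftrightarrow> (\<exists>u. last_read lo n x u \<noteq> None) \<longrightarrow>
      (\<forall>u\<in>set ts. u \<noteq> thr (\<sigma> ! n) \<longrightarrow> (\<forall>i. last_read lo n x u = Some i \<longrightarrow> (i, n) \<in> hb \<sigma>))"
    using assms(2) by (simp add: reads_ok_def read_clock_def)
  show ?thesis unfolding r using mem_ts by blast
qed

text \<open>Checking the last write suffices: an earlier write of the window which races with the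
  current event, but whose race is masked by a later write, races with that later write.\<close>

lemma race_with_last_write:
  assumes "\<not> race_before n" and i: "lo \<le> i" "i < n" "opn (\<sigma> ! i) = Write x"
    and race: "hb_race \<sigma> i n" and opn_n: "opn (\<sigma> ! n) \<in> {Read x, Write x}"
  shows "\<exists>k. last_write lo n x = Some k \<and> thr (\<sigma> ! k) \<noteq> thr (\<sigma> ! n) \<and> (k, n) \<notin> hb \<sigma>"
proof -
  have nhb: "(i, n) \<notin> hb \<sigma>" and "thr (\<sigma> ! i) \<noteq> thr (\<sigma> ! n)"
    using race by (auto simp: hb_race_def conflicting_def)
  obtain k where k: "last_write lo n x = Some k"
    using i unfolding last_write_def by (metis (mono_tags, lifting) lastpos_None not_None_eq)
  then have k': "k < n" "opn (\<sigma> ! k) = Write x" "i \<le> k"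
    using i unfolding last_write_def lastpos_Some by (auto simp: not_less[symmetric])
  have ik: "(i, k) \<in> hb \<sigma>"
  proof (rule ccontr)
    assume no: "(i, k) \<notin> hb \<sigma>"
    then have "thr (\<sigma> ! i) \<noteq> thr (\<sigma> ! k)" using hb_thr[of i k \<sigma>] k' n by auto
    then have "hb_race \<sigma> i k"
      using no k' i hb_le[of k i \<sigma>] hb_thr[of i i \<sigma>] n
      by (auto simp: hb_race_def conflicting_def)
    moreover have "i < k" using k'(3) no hb_thr[of i i \<sigma>] i n by (cases "i = k") auto
    ultimately have "race_before n"
      using k' i lo unfolding race_before_def by (intro exI[of _ i] exI[of _ k]) auto
    with assms(1) show False by simp
  qed
  then have "(k, n) \<notin> hb \<sigma>" using nhb hb_trans by blast
  moreover have "thr (\<sigma> ! k) \<noteq> thr (\<sigma> ! n)" using calculation hb_thr[of k n \<sigma>] k' n by auto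
  ultimately show ?thesis using k by blast
qed

lemma last_write_race:
  assumes "last_write lo n x = Some k" "thr (\<sigma> ! k) \<noteq> thr (\<sigma> ! n)" "(k, n) \<notin> hb \<sigma>"
    "opn (\<sigma> ! n) \<in> {Read x, Write x}"
  shows "\<exists>i. lo \<le> i \<and> i < n \<and> hb_race \<sigma> i n"
proof -
  have k: "lo \<le> k" "k < n" "opn (\<sigma> ! k) = Write x"
    using assms(1) by (auto simp: last_write_def lastpos_Some)
  then have "hb_race \<sigma> k n" using assms by (auto simp: hb_race_iff conflicting_def)
  with k show ?thesis by blast
qed

lemma good_handle_read:
  assumes good: "good lo n (mem m)" and h: "head (mem m) = int (n mod w)" and r: "opn (\<sigma> ! n) = Read x"
  shows "good lo (Suc n) (mem (handle_read (thr (\<sigma> ! n)) x m))"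
proof (rule good_Suc_access[OF good, of x])
  let ?s = "mem m" and ?t = "thr (\<sigma> ! n)"
  have rc: "rclock ?s = read_clock lo n" and ep: "epoch ?s = write_epoch lo n"
    and race: "race ?s = race_before n"
    using good by (auto simp: good_def)
  show "opn (\<sigma> ! n) \<in> {Read x, Write x}" using r by simp
  have ev: "\<sigma> ! n = (u, Read y) \<longleftrightarrow> u = ?t \<and> y = x" for u y using r by (auto simp: event_eq_iff)
  show "rclock (mem (handle_read ?t x m)) = read_clock lo (Suc n)"
  proof
    fix y
    show "rclock (mem (handle_read ?t x m)) y = read_clock lo (Suc n) y"
    proof (cases "y = x")
      case True
      have "(case rclock ?s x of None \<Rightarrow> bot_clock | Some R \<Rightarrow> R) = (\<lambda>u. idx w (last_read lo n x u))"
        by (auto simp: rc read_clock_def bot_clock_def fun_eq_iff)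
      then show ?thesis using True
        by (auto simp: mem_handle_read read_clock_def last_read_Suc[OF lo_le n] ev h fun_eq_iff)
    next
      case False
      then show ?thesis using read_clock_Suc_other[of y] r by (simp add: mem_handle_read rc)
    qed
  qed
  show "epoch (mem (handle_read ?t x m)) = write_epoch lo (Suc n)"
    using write_epoch_Suc_other r by (simp add: mem_handle_read ep fun_eq_iff)
  have "race_before n \<or> \<not> epoch_ok ?t x ?s \<longleftrightarrow> race_before (Suc n)"
  proof -
    have "\<exists>k. last_write lo n x = Some k \<and> thr (\<sigma> ! k) \<noteq> ?t \<and> (k, n) \<notin> hb \<sigma>"
      if "\<not> race_before n" "lo \<le> i" "i < n" "hb_race \<sigma> i n" for i
    proof (rule race_with_last_write[OF that(1-3) _ that(4)])
      show "opn (\<sigma> ! i) = Write x" using that(4) r by (auto simp: hb_race_def conflicting_def)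
    qed (simp add: r)
    moreover have "epoch_ok ?t x ?s \<longleftrightarrow>
        (\<forall>i. last_write lo n x = Some i \<longrightarrow> thr (\<sigma> ! i) = ?t \<or> (i, n) \<in> hb \<sigma>)"
      by (rule epoch_ok_iff[OF good h, of x]) (simp add: r)
    ultimately show ?thesis
      using last_write_race[of x] r unfolding race_before_Suc by (metis insertI1)
  qed
  then show "race (mem (handle_read ?t x m)) = race_before (Suc n)"
    by (simp add: mem_handle_read race)
qed (simp_all add: mem_handle_read)

lemma good_handle_write:
  assumes good: "good lo n (mem m)" and h: "head (mem m) = int (n mod w)" and r: "opn (\<sigma> ! n) = Write x"
  shows "good lo (Suc n) (mem (handle_write (thr (\<sigma> ! n)) x m))"
proof (rule good_Suc_access[OF good, of x])
  let ?s = "mem m" and ?t = "thr (\<sigma> ! n)"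
  have rc: "rclock ?s = read_clock lo n" and ep: "epoch ?s = write_epoch lo n"
    and race: "race ?s = race_before n"
    using good by (auto simp: good_def)
  show rw: "opn (\<sigma> ! n) \<in> {Read x, Write x}" using r by simp
  show "rclock (mem (handle_write ?t x m)) = read_clock lo (Suc n)"
    using read_clock_Suc_other r by (simp add: mem_handle_write rc fun_eq_iff)
  show "epoch (mem (handle_write ?t x m)) = write_epoch lo (Suc n)"
    using write_epoch_Suc_other r last_write_Suc[OF lo_le n, of x]
    by (auto simp: mem_handle_write ep fun_eq_iff write_epoch_def h)
  have e: "epoch_ok ?t x ?s \<longleftrightarrow>
      (\<forall>i. last_write lo n x = Some i \<longrightarrow> thr (\<sigma> ! i) = ?t \<or> (i, n) \<in> hb \<sigma>)"
    by (rule epoch_ok_iff[OF good h rw])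
  have ro: "reads_ok ?t x ?s \<longleftrightarrow>
      (\<forall>u i. u \<noteq> ?t \<and> last_read lo n x u = Some i \<longrightarrow> (i, n) \<in> hb \<sigma>)"
    by (rule reads_ok_iff[OF good h rw])
  have "race_before n \<or> \<not> (reads_ok ?t x ?s \<and> epoch_ok ?t x ?s) \<longleftrightarrow> race_before (Suc n)"
  proof
    assume *: "race_before n \<or> \<not> (reads_ok ?t x ?s \<and> epoch_ok ?t x ?s)"
    consider "race_before n" | "\<not> epoch_ok ?t x ?s" | "\<not> reads_ok ?t x ?s" using * by blast
    then show "race_before (Suc n)"
    proof cases
      case 2
      then show ?thesis using last_write_race[OF _ _ _ rw] e by (auto simp: race_before_Suc)
    next
      case 3
      then obtain u i where "u \<noteq> ?t" "last_read lo n x u = Some i" "(i, n) \<notin> hb \<sigma>" using ro by auto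
      then have "lo \<le> i" "i < n" "hb_race \<sigma> i n"
        using r by (auto simp: last_read_def lastpos_Some hb_race_iff conflicting_def thr_def opn_def)
      then show ?thesis by (auto simp: race_before_Suc)
    qed (simp add: race_before_Suc)
  next
    assume "race_before (Suc n)"
    then consider "race_before n"
      | i where "\<not> race_before n" "lo \<le> i" "i < n" "hb_race \<sigma> i n"
      by (auto simp: race_before_Suc)
    then show "race_before n \<or> \<not> (reads_ok ?t x ?s \<and> epoch_ok ?t x ?s)"
    proof cases
      case (2 i)
      then have c: "conflicting (\<sigma> ! i) (\<sigma> ! n)" "(i, n) \<notin> hb \<sigma>" by (auto simp: hb_race_def)
      then consider "opn (\<sigma> ! i) = Write x" | "opn (\<sigma> ! i) = Read x"
        using r by (auto simp: conflicting_def)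
      then show ?thesis
      proof cases
        case 1
        then show ?thesis using race_with_last_write[OF 2(1-3) _ 2(4) rw] e by blast
      next
        case read: 2
        let ?u = "thr (\<sigma> ! i)"
        have ei: "\<sigma> ! i = (?u, Read x)" using read by (simp add: event_eq_iff)
        then obtain k where k: "last_read lo n x ?u = Some k"
          using 2 unfolding last_read_def by (metis (mono_tags, lifting) lastpos_None not_None_eq)
        then have k': "i \<le> k" "k < n" "thr (\<sigma> ! k) = ?u"
          using ei 2 unfolding last_read_def lastpos_Some
          by (auto simp: not_less[symmetric])
        \<comment> \<open>A later read that masks \<open>i\<close> is by the same thread and hence
          ordered after \<open>i\<close>. It races with \<open>n\<close> itself, so no earlier race
          has to be invoked, unlike for writes.\<close>
        then have "(i, k) \<in> hb \<sigma>" using n by (intro hb_thr) auto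
        then have "(k, n) \<notin> hb \<sigma>" using c hb_trans by blast
        moreover have "?u \<noteq> ?t" using c by (simp add: conflicting_def)
        ultimately show ?thesis using ro k by blast
      qed
    qed simp
  qed
  then show "race (mem (handle_write ?t x m)) = race_before (Suc n)"
    by (simp add: mem_handle_write race)
qed (simp_all add: mem_handle_write)

lemma no_race_at_lock:
  assumes "\<And>x. opn (\<sigma> ! n) \<notin> {Read x, Write x}"
  shows "race_before (Suc n) = race_before n"
  using assms by (auto simp: race_before_Suc hb_race_def conflicting_def)

lemma good_handle_rel:
  assumes good: "good lo n (mem m)" and h: "head (mem m) = int (n mod w)" and r: "opn (\<sigma> ! n) = Rel l"
  shows "good lo (Suc n) (mem (handle_rel (thr (\<sigma> ! n)) l m))"
proof -
  note ctx = lo_le n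
  let ?s = "mem m" and ?t = "thr (\<sigma> ! n)" and ?h = "int (n mod w)"
  define T where "T = (tclock ?s)(?t := (tclock ?s ?t)(?t := ?h))"
  define s' where "s' = mem (handle_rel ?t l m)"
  have tc: "tclock ?s = thread_clock lo n" and lc: "lclock ?s = lock_clock lo n"
    and rc: "rclock ?s = read_clock lo n" and ep: "epoch ?s = write_epoch lo n"
    and refs: "refs_ok lo n ?s" and race: "race ?s = race_before n"
    using good by (auto simp: good_def)
  have s': "tclock s' = T" "rclock s' = rclock ?s" "epoch s' = epoch ?s" "race s' = race ?s"
    "lclock s' = (lclock ?s)(l := Some (\<lambda>u. if u \<in> set ts then T ?t u else -1))"
    "refs s' i = (if i \<noteq> -1 \<and> (\<exists>u\<in>set ts. T ?t u = i) then map_option (insert (Inr l)) else id)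
        (if i = ?h then Some {Inl ?t}
         else if i \<noteq> -1 \<and> i = tclock ?s ?t ?t then map_option (\<lambda>A. A - {Inl ?t}) (refs ?s i)
         else refs ?s i)" for i
  proof -
    have "(tclock ?s)(?t := (tclock ?s ?t)(?t := head ?s)) = T" by (simp add: T_def h)
    then show "tclock s' = T" "rclock s' = rclock ?s" "epoch s' = epoch ?s" "race s' = race ?s"
    "lclock s' = (lclock ?s)(l := Some (\<lambda>u. if u \<in> set ts then T ?t u else -1))"
    "refs s' i = (if i \<noteq> -1 \<and> (\<exists>u\<in>set ts. T ?t u = i) then map_option (insert (Inr l)) else id)
        (if i = ?h then Some {Inl ?t}
         else if i \<noteq> -1 \<and> i = tclock ?s ?t ?t then map_option (\<lambda>A. A - {Inl ?t}) (refs ?s i)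
         else refs ?s i)" for i
      unfolding s'_def mem_handle_rel Let_def by (simp_all only: h) simp_all
  qed
  have T: "T = thread_clock lo (Suc n)"
    using thread_clock_Suc_nonacq[OF ctx] r
    by (auto simp: T_def tc fun_eq_iff rel_by_def)
  have Tt: "T ?t u = -1" if "u \<notin> set ts" for u
    using good_threads(2)[of "Suc n" lo ?t u] n T that by auto
  have l': "lclock s' = lock_clock lo (Suc n)"
  proof
    fix k
    show "lclock s' k = lock_clock lo (Suc n) k"
    proof (cases "k = l")
      case True
      have "(\<lambda>u. if u \<in> set ts then T ?t u else -1) = rel_clock lo (Suc n) n"
        using Tt by (auto simp: rel_clock_new[OF ctx r] T[symmetric] fun_eq_iff)
      then show ?thesis using True by (simp add: s'(5) lock_clock_def open_rel_Suc[OF ctx] r)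
    next
      case False
      show ?thesis
      proof (cases "open_rel lo n k")
        case (Some q)
        then have "q < n" using open_rel_SomeD by blast
        then show ?thesis using False rel_clock_Suc[OF ctx, of q]
          by (auto simp: s'(5) lock_clock_def open_rel_Suc[OF ctx] r lc Some fun_eq_iff)
      qed (use False in \<open>simp add: s'(5) lock_clock_def open_rel_Suc[OF ctx] r lc\<close>)
    qed
  qed
  have old_l: "lclock ?s l = None"
    using open_rel_before_rel[OF ctx r] by (simp add: lc lock_clock_def)
  have ptr_old: "refs s' (int (p mod w)) = (if \<exists>l. opn (\<sigma> ! p) = Rel l then Some (pointers s' p) else None)"
    if p: "lo \<le> p" "p < n" for p
  proof -
    let ?i = "int (p mod w)" and ?u = "thr (\<sigma> ! p)"
    have ne: "?i \<noteq> ?h" using mod_eq_window[of p w n] p lo_le by auto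
    \<comment> \<open>Entries pointing to \<open>p\<close> occur only in the component of its
      thread; for \<open>?t\<close> itself that component has just been redirected to
      \<open>n\<close>.\<close>
    have ti: "T ?t u = ?i \<longleftrightarrow> u \<noteq> ?t \<and> u = ?u \<and> thread_clock lo n ?t ?u = ?i" for u
      using thread_clock_posD[OF p, of ?t u] ne by (auto simp: T_def tc)
    have tt: "tclock ?s ?t ?t = ?i \<longleftrightarrow> ?u = ?t \<and> thread_clock lo n ?t ?u = ?i"
      using thread_clock_posD[OF p, of ?t ?t] by (auto simp: tc)
    have uts: "?u \<in> set ts" using p n by (auto simp: set_ts threads_def)
    show ?thesis
    proof (cases "\<exists>l. opn (\<sigma> ! p) = Rel l")
      case False
      then have "refs ?s ?i = None" using refs p by (auto simp: refs_ok_def)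
      then show ?thesis using False ne by (cases "?i = tclock ?s ?t ?t") (auto simp: s'(6))
    next
      case True
      then have R: "refs ?s ?i = Some (pointers ?s p)" using refs p by (auto simp: refs_ok_def)
      \<comment> \<open>\<open>b\<close>: the new lock clock copies an entry pointing to
        \<open>p\<close>, so \<open>l\<close> joins its set. \<open>c\<close>: the overwritten own
        component of \<open>?t\<close> pointed to \<open>p\<close>, so \<open>?t\<close> leaves
        it.\<close>
      define b where "b \<longleftrightarrow> (\<exists>u\<in>set ts. T ?t u = ?i)"
      define c where "c \<longleftrightarrow> ?i = tclock ?s ?t ?t"
      have ptr: "pointers s' p = (if b then insert (Inr l) else id)
          (if c then pointers ?s p - {Inl ?t} else pointers ?s p)"
      proof (rule set_eqI)
        fix z
        show "z \<in> pointers s' p \<longleftrightarrow> z \<in> (if b then insert (Inr l) else id)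
          (if c then pointers ?s p - {Inl ?t} else pointers ?s p)"
        proof (cases z)
          case (Inl t')
          have "T t' ?u = ?i \<longleftrightarrow> tclock ?s t' ?u = ?i \<and> \<not> (t' = ?t \<and> c)"
          proof (cases "t' = ?t \<and> ?u = ?t")
            case True
            then show ?thesis using ne by (auto simp: T_def c_def)
          next
            case False
            then have "T t' ?u = tclock ?s t' ?u" by (auto simp: T_def)
            moreover have "\<not> (t' = ?t \<and> c)" if "tclock ?s t' ?u = ?i"
              using False tt c_def by auto
            ultimately show ?thesis by auto
          qed
          moreover have "z \<in> pointers s' p \<longleftrightarrow> T t' ?u = ?i" "z \<in> pointers ?s p \<longleftrightarrow> tclock ?s t' ?u = ?i"
            by (auto simp: pointers_def s'(1) Inl)
          ultimately show ?thesis using Inl by (cases b; cases c) auto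
        next
          case (Inr k)
          have "lentry s' k ?u = Some ?i \<longleftrightarrow> k = l \<and> b \<or> lentry ?s k ?u = Some ?i"
            using ti uts old_l by (auto simp: lentry_def s'(5) b_def)
          moreover have "z \<in> pointers s' p \<longleftrightarrow> lentry s' k ?u = Some ?i"
            "z \<in> pointers ?s p \<longleftrightarrow> lentry ?s k ?u = Some ?i"
            by (auto simp: pointers_def Inr)
          ultimately show ?thesis using Inr by (cases b; cases c) auto
        qed
      qed
      have "refs s' ?i = (if b then map_option (insert (Inr l)) else id)
          (if c then map_option (\<lambda>A. A - {Inl ?t}) (refs ?s ?i) else refs ?s ?i)"
        using ne unfolding s'(6) b_def[symmetric] c_def[symmetric] by simp
      then show ?thesis using True unfolding ptr R by simp
    qed
  qed
  \<comment> \<open>No older entry carries the index of the vacated slot, so only the releasing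
    thread and its lock refer to the new release.\<close>
  have ptr_new: "refs s' ?h = Some (pointers s' n)"
  proof -
    have "T t' ?t = ?h \<longleftrightarrow> t' = ?t" for t'
      using thread_clock_ne_n by (auto simp: T_def tc)
    moreover have "lentry s' k ?t = Some ?h \<longleftrightarrow> k = l" for k
    proof (cases "k = l")
      case True
      then show ?thesis using thr_n[OF ctx] by (simp add: lentry_def s'(5) T_def)
    next
      case False
      then show ?thesis using rel_clock_ne_n
        by (auto simp: lentry_def s'(5) lc lock_clock_def)
    qed
    ultimately have "pointers s' n = {Inl ?t, Inr l}"
      by (auto simp: pointers_def s'(1))
    moreover have "\<exists>u\<in>set ts. T ?t u = ?h"
      using thr_n[OF ctx] by (intro bexI[of _ ?t]) (simp_all add: T_def)
    ultimately show ?thesis by (auto simp: s'(6))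
  qed
  have "refs s' (int i) = None" if i: "i < w" "\<forall>p. lo \<le> p \<and> p < Suc n \<longrightarrow> p mod w \<noteq> i" for i
  proof -
    have "refs ?s (int i) = None" using refs i by (simp add: refs_ok_def)
    moreover have "int i \<noteq> ?h" using i(2) lo_le by auto
    ultimately show ?thesis by (cases "int i = tclock ?s ?t ?t") (auto simp: s'(6))
  qed
  then have "refs_ok lo (Suc n) s'"
    using ptr_old ptr_new r by (auto simp: refs_ok_def less_Suc_eq)
  moreover have "race_before (Suc n) = race_before n" by (rule no_race_at_lock) (simp add: r)
  moreover have "rclock s' = read_clock lo (Suc n)" "epoch s' = write_epoch lo (Suc n)"
    using read_clock_Suc_other write_epoch_Suc_other r by (simp_all add: s' rc ep fun_eq_iff)
  ultimately show ?thesis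
    unfolding s'_def[symmetric] good_def using T l' s'(1,4) race by simp
qed

lemma good_handle_acq:
  assumes good: "good lo n (mem m)" and h: "head (mem m) = int (n mod w)" and r: "opn (\<sigma> ! n) = Acq l"
  shows "good lo (Suc n) (mem (handle_acq (thr (\<sigma> ! n)) l m))"
proof -
  note ctx = lo_le n
  let ?s = "mem m" and ?t = "thr (\<sigma> ! n)"
  have tc: "tclock ?s = thread_clock lo n" and lc: "lclock ?s = lock_clock lo n"
    and rc: "rclock ?s = read_clock lo n" and ep: "epoch ?s = write_epoch lo n"
    and refs: "refs_ok lo n ?s" and race: "race ?s = race_before n"
    using good by (auto simp: good_def)
  have same: "race_before (Suc n) = race_before n" "read_clock lo (Suc n) = read_clock lo n"
     "write_epoch lo (Suc n) = write_epoch lo n"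
    using no_race_at_lock read_clock_Suc_other write_epoch_Suc_other r by (simp_all add: fun_eq_iff)
  have nrel: "opn (\<sigma> ! n) \<noteq> Rel k" for k using r by simp
  have lc_Suc: "lock_clock lo (Suc n) = (lock_clock lo n)(l := None)"
  proof
    fix k
    show "lock_clock lo (Suc n) k = ((lock_clock lo n)(l := None)) k"
    proof (cases "open_rel lo n k")
      case (Some q)
      then have "q < n" using open_rel_SomeD by blast
      then show ?thesis
        using rel_clock_Suc[OF ctx] by (auto simp: lock_clock_def open_rel_Suc[OF ctx] r Some)
    qed (simp add: lock_clock_def open_rel_Suc[OF ctx] r)
  qed
  show ?thesis
  proof (cases "open_rel lo n l")
    case None
    then have "lclock ?s l = None" by (simp add: lc lock_clock_def)
    moreover have "thread_clock lo (Suc n) = thread_clock lo n"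
      using thread_clock_Suc_acq_None[OF ctx r None] by (simp add: fun_eq_iff)
    moreover have "refs_ok lo (Suc n) ?s" using refs_ok_Suc[OF refs nrel lo_le(2)] by simp
    ultimately show ?thesis
      using tc lc rc ep race same lc_Suc None
      by (simp add: mem_handle_acq good_def fun_upd_idem)
  next
    case (Some q)
    let ?C = "rel_clock lo n q" and ?T = "thread_clock lo n" and ?T' = "thread_clock lo (Suc n)"
    have ll: "lclock ?s l = Some ?C" using Some by (simp add: lc lock_clock_def)
    have T': "?T' t u = (if t = ?t \<and> less_win (int (n mod w)) (?T ?t u) (?C u) then ?C u else ?T t u)" for t u
      using thread_clock_Suc_acq_Some[OF ctx r Some, of t u] by auto
    \<comment> \<open>The loop invariant after the threads in \<open>X\<close>: their components of
      \<open>C_t\<close> are final, and \<open>l\<close> is already withdrawn from the sets of their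
      releases although \<open>C_l\<close> is still present. Hence these sets are not given by
      \<open>pointers\<close> before the loop ends.\<close>
    define P :: "'t set \<Rightarrow> ('t, 'x, 'l) state \<Rightarrow> bool" where "P X s \<longleftrightarrow> head s = int (n mod w) \<and> lclock s = lclock ?s \<and> rclock s = rclock ?s \<and>
      epoch s = epoch ?s \<and> race s = race ?s \<and>
      tclock s = ?T(?t := \<lambda>u. if u \<in> X then ?T' ?t u else ?T ?t u) \<and>
      (\<forall>p. lo \<le> p \<and> p < n \<longrightarrow> refs s (int (p mod w)) =
        (if \<exists>k. opn (\<sigma> ! p) = Rel k then Some (
          Inl ` {t. tclock s t (thr (\<sigma> ! p)) = int (p mod w)} \<union>
          Inr ` {k. \<not> (k = l \<and> thr (\<sigma> ! p) \<in> X) \<and> lentry ?s k (thr (\<sigma> ! p)) = Some (int (p mod w))})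
         else None)) \<and>
      (\<forall>i<w. (\<forall>p. lo \<le> p \<and> p < n \<longrightarrow> p mod w \<noteq> i) \<longrightarrow> refs s (int i) = None)" for X s
    have step: "P (insert u X) (acq_step ?t l u s)" if Ps: "P X s" and u: "u \<notin> X" for X s u
    proof -
      let ?s' = "acq_step ?t l u s"
      let ?newer = "less_win (int (n mod w)) (?T ?t u) (?C u)"
      have c: "the (lentry s l u) = ?C u" using Ps ll by (simp add: P_def lentry_def)
      have a: "tclock s ?t u = ?T ?t u" using Ps u by (simp add: P_def)
      have hd: "head s = int (n mod w)" using Ps by (simp add: P_def)
      have s': "?s' = upd_refs (\<lambda>A. A - {Inr l}) (?C u)
        (if ?newer then set_tentry ?t u (?C u) (upd_refs (\<lambda>A. A - {Inl ?t}) (?T ?t u)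
            (upd_refs (insert (Inl ?t)) (?C u) s)) else s)"
        by (simp add: acq_step_def c a hd Let_def)
      have fr: "head ?s' = head s" "lclock ?s' = lclock s" "rclock ?s' = rclock s"
        "epoch ?s' = epoch s" "race ?s' = race s"
        by (simp_all add: s')
      have t': "tclock ?s' = ?T(?t := \<lambda>v. if v \<in> insert u X then ?T' ?t v else ?T ?t v)"
        using Ps u by (auto simp: s' set_tentry_def T' P_def fun_eq_iff)
      have upd: "refs (upd_refs f j z) i = (if i = j \<and> i \<noteq> -1 then map_option f (refs z i) else refs z i)"
        for f i j and z :: "('t, 'x, 'l) state" by (simp add: upd_refs_def)
      have r': "refs ?s' i = (if ?C u = i then map_option (\<lambda>A. A - {Inr l}) else id)
         ((if ?newer \<and> ?T ?t u = i then map_option (\<lambda>A. A - {Inl ?t}) else id)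
          ((if ?newer \<and> ?C u = i then map_option (insert (Inl ?t)) else id) (refs s i)))"
        if "i \<noteq> -1" for i
        using that by (auto simp: s' upd)
      have "refs ?s' (int (p mod w)) =
        (if \<exists>k. opn (\<sigma> ! p) = Rel k then Some (
          Inl ` {t. tclock ?s' t (thr (\<sigma> ! p)) = int (p mod w)} \<union>
          Inr ` {k. \<not> (k = l \<and> thr (\<sigma> ! p) \<in> insert u X) \<and>
            lentry ?s k (thr (\<sigma> ! p)) = Some (int (p mod w))})
         else None)" if p: "lo \<le> p" "p < n" for p
      proof (cases "\<exists>k. opn (\<sigma> ! p) = Rel k")
        case False
        then have "refs s (int (p mod w)) = None" using Ps p by (auto simp: P_def)
        then show ?thesis using False by (auto simp: r')
      next
        case True
        let ?i = "int (p mod w)" and ?u = "thr (\<sigma> ! p)"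
        have R: "refs s ?i = Some (Inl ` {t. tclock s t ?u = ?i} \<union>
            Inr ` {k. \<not> (k = l \<and> ?u \<in> X) \<and> lentry ?s k ?u = Some ?i})"
          using Ps p True by (auto simp: P_def)
        show ?thesis
        proof (cases "?u = u")
          case False
          \<comment> \<open>Iteration \<open>u\<close> touches only sets of releases by
            \<open>u\<close>.\<close>
          then have "?C u \<noteq> ?i" "?T ?t u \<noteq> ?i"
            using rel_clock_posD[OF p, of q u] thread_clock_posD[OF p, of ?t u] by auto
          then have "refs ?s' ?i = refs s ?i" by (simp add: r')
          moreover have "tclock ?s' t ?u = tclock s t ?u" for t
            using False t' Ps by (auto simp: P_def)
          ultimately show ?thesis using R True False by simp
        next
          case eq: True
          have 1: "tclock ?s' t u = ?i \<longleftrightarrow> (if t = ?t \<and> ?newer then ?C u = ?i else tclock s t u = ?i)" for t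
            using u Ps unfolding t' by (auto simp: P_def T')
          \<comment> \<open>The strict order makes the two indices differ, so the deletion from the
            old set does not undo the insertion into the new one.\<close>
          have 2: "?newer \<Longrightarrow> ?T ?t u \<noteq> ?C u" by (auto simp: less_win_def)
          have 3: "lentry ?s l u = Some ?i \<longleftrightarrow> ?C u = ?i" by (simp add: lentry_def ll)
          have "Inl ` {t. tclock ?s' t u = ?i} \<union>
              Inr ` {k. \<not> (k = l \<and> u \<in> insert u X) \<and> lentry ?s k u = Some ?i} =
            (if ?C u = ?i then (\<lambda>A. A - {Inr l}) else id)
             ((if ?newer \<and> ?T ?t u = ?i then (\<lambda>A. A - {Inl ?t}) else id)
              ((if ?newer \<and> ?C u = ?i then (insert (Inl ?t)) else id)
               (Inl ` {t. tclock s t u = ?i} \<union>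
                Inr ` {k. \<not> (k = l \<and> u \<in> X) \<and> lentry ?s k u = Some ?i})))"
          proof (rule set_eqI)
            fix z
            show "z \<in> Inl ` {t. tclock ?s' t u = ?i} \<union>
              Inr ` {k. \<not> (k = l \<and> u \<in> insert u X) \<and> lentry ?s k u = Some ?i} \<longleftrightarrow> z \<in>
            (if ?C u = ?i then (\<lambda>A. A - {Inr l}) else id)
             ((if ?newer \<and> ?T ?t u = ?i then (\<lambda>A. A - {Inl ?t}) else id)
              ((if ?newer \<and> ?C u = ?i then (insert (Inl ?t)) else id)
               (Inl ` {t. tclock s t u = ?i} \<union>
                Inr ` {k. \<not> (k = l \<and> u \<in> X) \<and> lentry ?s k u = Some ?i})))"
              using a u 2 3 by (cases z) (auto simp: 1)
          qed
          then show ?thesis using True R unfolding eq by (auto simp: r')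
        qed
      qed
      moreover have "refs ?s' (int i) = None"
        if "i < w" "\<forall>p. lo \<le> p \<and> p < n \<longrightarrow> p mod w \<noteq> i" for i
        using that Ps by (simp add: P_def r')
      ultimately show ?thesis
        unfolding P_def using Ps t' fr by (simp add: P_def)
    qed
    have fold: "P (X \<union> set us) (fold (acq_step ?t l) us s)"
      if "P X s" "distinct us" "X \<inter> set us = {}" for X us s
      using that
    proof (induction us arbitrary: X s)
      case (Cons u us)
      then have "P (insert u X) (acq_step ?t l u s)" using step by auto
      from Cons.IH[OF this] Cons.prems show ?case by auto
    qed simp
    have "P {} ?s"
      using refs tc h by (auto simp: P_def refs_ok_def pointers_def)
    from fold[OF this distinct_ts]
    have P: "P (set ts) (fold (acq_step ?t l) ts ?s)" by simp
    define s' where "s' = fold (acq_step ?t l) ts ?s"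
    let ?f = "s'\<lparr>lclock := (lclock s')(l := None)\<rparr>"
    have m': "mem (handle_acq ?t l m) = ?f"
      by (simp add: mem_handle_acq ll s'_def Let_def)
    note P = P[folded s'_def]
    \<comment> \<open>The loop skips components outside \<open>ts\<close>; there the lock clock is
      -1 and never newer.\<close>
    have "?T' t u = ?T t u" if "t \<noteq> ?t \<or> u \<notin> set ts" for t u
    proof (cases "t = ?t")
      case True
      then have "?C u = -1" using that rel_clock_threads[of n lo q u] n by auto
      then show ?thesis by (simp add: T' less_win_def)
    qed (simp add: T')
    then have t: "tclock ?f = ?T'" using P by (auto simp: P_def fun_eq_iff)
    have l: "lclock ?f = lock_clock lo (Suc n)" using P by (simp add: P_def lc lc_Suc)
    have uts: "thr (\<sigma> ! p) \<in> set ts" if "p < n" for p using that n by (auto simp: set_ts threads_def)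
    have "refs_ok lo n ?f"
    proof -
      have "pointers ?f p = Inl ` {t. tclock s' t (thr (\<sigma> ! p)) = int (p mod w)} \<union>
          Inr ` {k. \<not> (k = l \<and> thr (\<sigma> ! p) \<in> set ts) \<and>
            lentry ?s k (thr (\<sigma> ! p)) = Some (int (p mod w))}" if "p < n" for p
      proof -
        have "lentry ?f k u = Some i \<longleftrightarrow> k \<noteq> l \<and> lentry ?s k u = Some i" for k u i
          using P by (simp add: P_def lentry_def)
        then show ?thesis using uts[OF that] by (simp add: pointers_def)
      qed
      then show ?thesis using P by (simp add: refs_ok_def P_def)
    qed
    then have "refs_ok lo (Suc n) ?f" using refs_ok_Suc nrel lo_le(2) by blast
    moreover have "rclock ?f = read_clock lo (Suc n)" "epoch ?f = write_epoch lo (Suc n)"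
      "race ?f = race_before (Suc n)"
      using P rc ep race same by (simp_all add: P_def)
    ultimately show ?thesis unfolding m' good_def using t l by blast
  qed
qed

lemma good_handle:
  assumes "good lo n (mem m)" "head (mem m) = int (n mod w)"
  shows "good lo (Suc n) (mem (handle (\<sigma> ! n) m))"
proof (cases "opn (\<sigma> ! n)")
  case (Read x)
  then show ?thesis using good_handle_read[OF assms] by (simp add: handle_def)
next
  case (Write x)
  then show ?thesis using good_handle_write[OF assms] by (simp add: handle_def)
next
  case (Acq l)
  then show ?thesis using good_handle_acq[OF assms] by (simp add: handle_def)
next
  case (Rel l)
  then show ?thesis using good_handle_rel[OF assms] by (simp add: handle_def)
qed

end

end

section \<open>Runs of the algorithm\<close>

text \<open>Passing from \<open>w + 1\<close> to \<open>w\<close> costs at most 1 and the ceiling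
  another 1, and \<open>2 + log 2 w\<close> is at most three times the maximum. The bound by
  \<open>w\<close>, from \<open>w + 1 \<le> 2 ^ w\<close>, absorbs index sizes that are not
  multiplied by the number of threads.\<close>

lemma bits_bounds:
  assumes "w \<ge> 1"
  shows "real (bits w) \<le> 3 * max 1 (log 2 (real w))" "bits w \<le> w"
proof -
  have "log 2 (real w + 1) \<le> log 2 (2 * real w)" using assms by simp
  also have "\<dots> = 1 + log 2 (real w)" using assms by (simp add: log_mult)
  finally have le: "log 2 (real w + 1) \<le> 1 + log 2 (real w)" .
  have "log 2 (real w + 1) \<ge> 0" using assms by simp
  then have "real (bits w) = of_int \<lceil>log 2 (real w + 1)\<rceil>" by (simp add: bits_def)
  also have "\<dots> \<le> log 2 (real w + 1) + 1" by linarith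
  finally show "real (bits w) \<le> 3 * max 1 (log 2 (real w))" using le by linarith
  have "real w + 1 \<le> 2 ^ w"
    using of_nat_mono[OF Suc_leI[OF less_exp[of w]], where 'a = real] by simp
  then have "log 2 (real w + 1) \<le> real w" by (simp add: log_le_iff powr_realpow)
  then show "bits w \<le> w" by (simp add: bits_def ceiling_le_iff nat_le_iff)
qed

context windowed_trace
begin

lemma good_cong:
  assumes "good lo n s" "tclock s' = tclock s" "lclock s' = lclock s" "rclock s' = rclock s"
    "epoch s' = epoch s" "refs s' = refs s" "race s' = race s"
  shows "good lo n s'"
proof -
  have "pointers s' = pointers s" using assms by (simp add: pointers_def lentry_def fun_eq_iff)
  then show ?thesis using assms by (simp add: good_def refs_ok_def)
qed

lemma good_init: "good 0 0 init_state"
  by (simp add: good_def init_state_def thread_clock_def lock_clock_def open_rel_def read_clock_def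
      last_read_def write_epoch_def last_write_def refs_ok_def race_before_def bot_clock_def fun_eq_iff)

lemma win_handle:
  fixes m :: "('t, 'x, 'l) machine"
  shows "win (mem (handle e m)) = win (mem m)"
proof -
  have "win (fold (acq_step t l) us s) = win s" for t l us and s :: "('t, 'x, 'l) state"
    by (induction us arbitrary: s) (simp_all add: acq_step_def Let_def)
  then show ?thesis
    by (cases "opn e")
      (simp_all add: handle_def mem_handle_read mem_handle_write mem_handle_acq mem_handle_rel Let_def)
qed

lemma win_post_handle:
  assumes "good lo n (mem m)" "fin_refs (mem m)" "head (mem m) = int (lo mod w)" "lo < n"
  shows "win (mem (post_handle (\<sigma> ! lo) m)) = win (mem m)"
proof (cases "opn (\<sigma> ! lo)")
  case (Rel l)
  then have "refs (mem m) (head (mem m)) = Some (pointers (mem m) lo)"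
    using assms by (auto simp: good_def refs_ok_def)
  then show ?thesis
    using Rel assms(2) by (simp add: post_handle_def mem_post_rel Let_def clear_refs_def)
qed (simp_all add: post_handle_def mem_post_read mem_post_write skip_def Let_def)

text \<open>Describing the head through its successor also covers its initial value -1. The stored
  events include position \<open>n - w\<close>, which the next step evicts.\<close>

definition win_ok :: "nat \<Rightarrow> ('t, 'x, 'l) state \<Rightarrow> bool"
  where "win_ok n s \<longleftrightarrow> (head s + 1) mod int w = int (n mod w) \<and>
    (\<forall>p<n. n \<le> p + w \<longrightarrow> win s (int (p mod w)) = Some (\<sigma> ! p)) \<and>
    (\<forall>i<w. n \<le> i \<longrightarrow> win s (int i) = None)"

lemma good_process:
  assumes good: "good (n - w) n (mem m)" and win: "win_ok n (mem m)"
    and fin: "fin_refs (mem m)" and n: "n < length \<sigma>"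
  shows "good (Suc n - w) (Suc n) (mem (process (\<sigma> ! n) m))" "win_ok (Suc n) (mem (process (\<sigma> ! n) m))"
proof -
  define m1 where "m1 = spend 1 (exec 1 (\<lambda>s. s\<lparr>head := (head s + 1) mod int w\<rparr>) m)"
  define m2 where "m2 = (case win (mem m1) (head (mem m1)) of None \<Rightarrow> skip | Some e \<Rightarrow> post_handle e) m1"
  have eq: "process (\<sigma> ! n) m = exec 1 (\<lambda>s. s\<lparr>win := (win s)(head s := Some (\<sigma> ! n))\<rparr>) (handle (\<sigma> ! n) m2)"
    by (simp add: process_def prog_defs m1_def m2_def)
  have h1: "head (mem m1) = int (n mod w)" using win by (simp add: m1_def win_ok_def)
  have w1: "win (mem m1) = win (mem m)" by (simp add: m1_def)
  have f1: "fin_refs (mem m1)" using fin by (simp add: m1_def fin_refs_def)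
  have g1: "good (n - w) n (mem m1)" by (rule good_cong[OF good]) (simp_all add: m1_def)
  have h1': "head (mem m1) \<in> {0..<int w}" using h1 w by simp
  have m2: "good (Suc n - w) n (mem m2) \<and> head (mem m2) = int (n mod w) \<and> win (mem m2) = win (mem m) \<and>
      fin_refs (mem m2)"
  proof (cases "n < w")
    case True
    then have "win (mem m1) (head (mem m1)) = None" using win by (simp add: w1 h1 win_ok_def)
    then have "m2 = m1" by (simp add: m2_def skip_def)
    then show ?thesis using g1 h1 w1 f1 True by (simp add: Suc_leI)
  next
    case False
    \<comment> \<open>Once the array is full, the slot of \<open>n\<close> holds the event
      \<open>w\<close> positions earlier.\<close>
    have mod: "(n - w) mod w = n mod w" using False by (simp add: le_mod_geq)
    have "win (mem m) (int ((n - w) mod w)) = Some (\<sigma> ! (n - w))"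
      using win False w by (simp add: win_ok_def)
    then have m2: "m2 = post_handle (\<sigma> ! (n - w)) m1" by (simp add: m2_def w1 h1 mod)
    have c: "cost_on {} (4 + 4 * length ts) 0 m1 m2"
      unfolding m2 by (rule cost_on_post_handle[OF h1'])
    have "good (Suc (n - w)) n (mem m2)"
      unfolding m2 using False w n h1 mod f1 by (intro good_post_handle g1) auto
    moreover have "win (mem m2) = win (mem m1)"
      unfolding m2 using False w h1 mod by (intro win_post_handle[OF g1 f1]) auto
    ultimately show ?thesis using c f1 h1 w1 False by (simp add: cost_on_def Suc_diff_le)
  qed
  let ?m3 = "handle (\<sigma> ! n) m2"
  have g3: "good (Suc n - w) (Suc n) (mem ?m3)"
    using m2 by (intro good_handle[OF refl n]) auto
  have h3: "head (mem ?m3) = int (n mod w)"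
    using m2 cost_onD[OF cost_handle, of "{}" m2 "\<sigma> ! n"] by (simp add: cost_on_def)
  have w3: "win (mem ?m3) = win (mem m)" using m2 by (simp add: win_handle)
  show "good (Suc n - w) (Suc n) (mem (process (\<sigma> ! n) m))"
    unfolding eq by (rule good_cong[OF g3]) simp_all
  have "(int (n mod w) + 1) mod int w = int (Suc n mod w)"
    by (simp add: zmod_int mod_simps ac_simps)
  moreover have "p mod w \<noteq> n mod w" if "p < n" "Suc n \<le> p + w" for p
    using mod_eq_window[of p w n] that by auto
  ultimately show "win_ok (Suc n) (mem (process (\<sigma> ! n) m))"
    using win by (auto simp: win_ok_def eq h3 w3 less_Suc_eq)
qed

section \<open>Size of a prescribed state\<close>

lemma card_window:
  assumes "inj c" "n - lo \<le> w" "\<And>x. x \<in> A \<Longrightarrow> \<exists>p. lo \<le> p \<and> p < n \<and> opn (\<sigma> ! p) = c x"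
  shows "finite A" "card A \<le> w"
proof -
  \<comment> \<open>Each key is charged to an operation in the window; as \<open>c\<close> is
    injective, the operation determines the key.\<close>
  have sub: "c ` A \<subseteq> (\<lambda>p. opn (\<sigma> ! p)) ` {lo..<n}"
  proof
    fix y assume "y \<in> c ` A"
    then obtain x where x: "x \<in> A" "y = c x" by blast
    obtain p where "lo \<le> p" "p < n" "opn (\<sigma> ! p) = c x" using assms(3)[OF x(1)] by blast
    then show "y \<in> (\<lambda>p. opn (\<sigma> ! p)) ` {lo..<n}" by (intro image_eqI[of _ _ p]) (simp_all add: x(2))
  qed
  have c: "inj_on c A" using assms(1) by (rule inj_on_subset) simp
  have "finite (c ` A)" using sub by (rule finite_subset) simp
  then show "finite A" using c by (rule finite_imageD)
  have "card A = card (c ` A)" using c by (simp add: card_image)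
  also have "\<dots> \<le> card ((\<lambda>p. opn (\<sigma> ! p)) ` {lo..<n})" using sub by (intro card_mono) simp_all
  also have "\<dots> \<le> n - lo" using card_image_le[of "{lo..<n}" "\<lambda>p. opn (\<sigma> ! p)"] by simp
  finally show "card A \<le> w" using assms(2) by simp
qed

lemma finite_locations: "finite (locations \<sigma>)" and finite_locks: "finite (locks \<sigma>)"
proof -
  have "locations \<sigma> \<subseteq> (\<lambda>e. case opn e of Read x \<Rightarrow> x | Write x \<Rightarrow> x) ` set \<sigma>"
    by (force simp: locations_def)
  then show "finite (locations \<sigma>)" by (rule finite_subset) simp
  have "locks \<sigma> \<subseteq> (\<lambda>e. case opn e of Acq x \<Rightarrow> x | Rel x \<Rightarrow> x) ` set \<sigma>"
    by (force simp: locks_def)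
  then show "finite (locks \<sigma>)" by (rule finite_subset) simp
qed

context
  fixes lo n :: nat and s :: "('t, 'x, 'l) state"
  assumes good: "good lo n s" and lo: "n \<le> lo + w" and n: "n \<le> length \<sigma>"
begin

lemma dom_lclock: "finite (dom (lclock s))"
    "card (dom (lclock s)) \<le> min w (card (locations \<sigma>) + card (locks \<sigma>))"
proof -
  have *: "\<exists>p. lo \<le> p \<and> p < n \<and> opn (\<sigma> ! p) = Rel l" if l: "l \<in> dom (lclock s)" for l
  proof -
    have "lclock s = lock_clock lo n" using good by (simp add: good_def)
    then obtain r where "open_rel lo n l = Some r" using l by (auto simp: lock_clock_def)
    from open_rel_SomeD[OF this] show ?thesis by blast
  qed
  have w': "n - lo \<le> w" using lo by simp
  have fin: "finite (dom (lclock s))" "card (dom (lclock s)) \<le> w"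
    by (rule card_window[OF _ w' *]; simp add: inj_def)+
  have "dom (lclock s) \<subseteq> locks \<sigma>"
  proof
    fix l assume "l \<in> dom (lclock s)"
    then obtain p where p: "p < n" "opn (\<sigma> ! p) = Rel l" using * by blast
    then have "\<sigma> ! p \<in> set \<sigma>" using n by simp
    with p show "l \<in> locks \<sigma>" unfolding locks_def by auto
  qed
  then have "card (dom (lclock s)) \<le> card (locks \<sigma>)" by (intro card_mono finite_locks)
  with fin show "finite (dom (lclock s))"
    "card (dom (lclock s)) \<le> min w (card (locations \<sigma>) + card (locks \<sigma>))" by simp_all
qed

lemma dom_access:
  assumes "inj c" "\<And>x. c x \<in> {Read x, Write x}"
    and *: "\<And>x. x \<in> A \<Longrightarrow> \<exists>p. lo \<le> p \<and> p < n \<and> opn (\<sigma> ! p) = c x"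
  shows "card A \<le> min w (card (locations \<sigma>) + card (locks \<sigma>))"
proof -
  have "n - lo \<le> w" using lo by simp
  from card_window(2)[OF assms(1) this *] have "card A \<le> w" .
  moreover have "A \<subseteq> locations \<sigma>"
  proof
    fix x assume "x \<in> A"
    then obtain p where p: "p < n" "opn (\<sigma> ! p) = c x" using * by blast
    then have "\<sigma> ! p \<in> set \<sigma>" "opn (\<sigma> ! p) \<in> {Read x, Write x}" using n assms(2)[of x] by simp_all
    then show "x \<in> locations \<sigma>" unfolding locations_def by blast
  qed
  then have "card A \<le> card (locations \<sigma>)" by (intro card_mono finite_locations)
  ultimately show ?thesis by simp
qed

lemma dom_rclock: "card (dom (rclock s)) \<le> min w (card (locations \<sigma>) + card (locks \<sigma>))"
proof (rule dom_access[of Read])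
  fix x assume "x \<in> dom (rclock s)"
  then obtain u p where "last_read lo n x u = Some p"
    using good by (auto simp: good_def read_clock_def split: if_splits)
  then show "\<exists>p. lo \<le> p \<and> p < n \<and> opn (\<sigma> ! p) = Read x"
    by (auto simp: last_read_def lastpos_Some event_eq_iff)
qed (simp_all add: inj_def)

lemma dom_epoch: "card (dom (epoch s)) \<le> min w (card (locations \<sigma>) + card (locks \<sigma>))"
proof (rule dom_access[of Write])
  fix x assume "x \<in> dom (epoch s)"
  then obtain p where "last_write lo n x = Some p" using good by (auto simp: good_def write_epoch_def)
  then show "\<exists>p. lo \<le> p \<and> p < n \<and> opn (\<sigma> ! p) = Write x"
    by (auto simp: last_write_def lastpos_Some)
qed (simp_all add: inj_def)

text \<open>An element of \<open>S_i\<close> is a clock having an entry with value \<open>i\<close>,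
  and an entry has only one value. All sets together are thus no larger than the number of entries
  of thread and lock clocks, a bound without a factor \<open>w\<close>.\<close>

lemma pot_le: "pot w {} s \<le> (length ts + card (dom (lclock s))) * length ts"
proof -
  define Z where "Z = (Inl ` set ts \<union> Inr ` dom (lclock s)) \<times> set ts"
  define val where "val z = (case fst z of Inl t \<Rightarrow> Some (tclock s t (snd z))
    | Inr l \<Rightarrow> lentry s l (snd z))" for z
  have finZ: "finite Z" using dom_lclock(1) by (simp add: Z_def)
  have "(case refs s i of None \<Rightarrow> 0 | Some A \<Rightarrow> card A) \<le> card {z \<in> Z. val z = Some i}"
    if i: "i \<in> {0..<int w}" for i
  proof (cases "refs s i")
    case (Some A)
    have "nat i < w" "int (nat i) = i" using i by auto
    then obtain p where p: "lo \<le> p" "p < n" "i = int (p mod w)"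
    proof -
      have "\<exists>p. lo \<le> p \<and> p < n \<and> p mod w = nat i"
      proof (rule ccontr)
        assume "\<not> ?thesis"
        then have "refs s (int (nat i)) = None" using good \<open>nat i < w\<close> by (auto simp: good_def refs_ok_def)
        with Some \<open>int (nat i) = i\<close> show False by simp
      qed
      with that \<open>int (nat i) = i\<close> show thesis by auto
    qed
    have "refs s (int (p mod w)) =
        (if \<exists>l. opn (\<sigma> ! p) = Rel l then Some (pointers s p) else None)"
      using good p by (simp add: good_def refs_ok_def)
    then have A: "A = pointers s p" using Some p(3) by (simp split: if_splits)
    have u: "thr (\<sigma> ! p) \<in> set ts" using p n by (auto simp: set_ts threads_def)
    have "t \<in> set ts" if "tclock s t u = int (p mod w)" for t u
      using that good good_threads(1)[OF n, of lo t u] by (auto simp: good_def)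
    then have "(z, thr (\<sigma> ! p)) \<in> {z \<in> Z. val z = Some i}" if "z \<in> A" for z
      using that u unfolding A p(3) by (cases z) (auto simp: pointers_def Z_def val_def lentry_def)
    from imageI[OF this, of _ fst] have "A \<subseteq> fst ` {z \<in> Z. val z = Some i}" by auto
    then have "card A \<le> card (fst ` {z \<in> Z. val z = Some i})"
      using finZ by (intro card_mono) auto
    also have "\<dots> \<le> card {z \<in> Z. val z = Some i}" using finZ by (intro card_image_le) auto
    finally show ?thesis using Some by simp
  qed simp
  then have "pot w {} s \<le> (\<Sum>i\<in>{0..<int w}. card {z \<in> Z. val z = Some i})"
    unfolding pot_def Diff_empty by (rule sum_mono)
  also have "\<dots> = card (\<Union>i\<in>{0..<int w}. {z \<in> Z. val z = Some i})"
    using finZ by (intro card_UN_disjoint[symmetric]) auto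
  also have "\<dots> \<le> card Z" using finZ by (intro card_mono) auto
  also have "\<dots> = (length ts + card (dom (lclock s))) * length ts"
    using dom_lclock(1) distinct_card[OF distinct_ts] unfolding Z_def card_cartesian_product
    by (subst card_Un_disjoint) (auto simp: card_image)
  finally show ?thesis .
qed

lemma footprint_le:
  assumes "M = min w (card (locations \<sigma>) + card (locks \<sigma>))"
  shows "footprint s \<le> 2 * w + bits w + 1 + (length ts + 2 * M) * clock_size + M * (2 + bits w)
    + (length ts + M) * length ts"
proof -
  have "card (dom (lclock s)) * clock_size \<le> M * clock_size" "card (dom (rclock s)) * clock_size \<le> M * clock_size"
    "card (dom (epoch s)) * (2 + bits w) \<le> M * (2 + bits w)"
    unfolding assms using dom_lclock(2) dom_rclock dom_epoch by (simp_all only: mult_le_mono1)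
  moreover have "(length ts + card (dom (lclock s))) * length ts \<le> (length ts + M) * length ts"
    unfolding assms using dom_lclock(2) by (intro mult_le_mono1 add_left_mono)
  ultimately show ?thesis using pot_le unfolding footprint_pot by (simp only: distrib_right mult_2)
qed

end

text \<open>The potential starts at 0, so the amortised costs add up to the running time. The peak
  bound is the largest footprint of a prescribed state plus the growth during a single event, and
  does not depend on \<open>n\<close>.\<close>

lemma run_invariant:
  assumes "M = min w (card (locations \<sigma>) + card (locks \<sigma>))" "n \<le> length \<sigma>"
  shows "let m = fold process (take n \<sigma>) init_machine in
    good (n - w) n (mem m) \<and> win_ok n (mem m) \<and> fin_refs (mem m) \<and>
    ticks m + 2 * pot w {} (mem m) \<le> length ts * length ts + n * (13 + 14 * length ts) \<and>
    peak m \<le> 2 * w + bits w + 1 + (length ts + 2 * M) * clock_size + M * (2 + bits w)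
      + (length ts + M) * length ts + (3 + bits w + clock_size + length ts)"
  using assms(2)
proof (induction n)
  case 0
  let ?i = "init_state :: ('t, 'x, 'l) state"
  have "win_ok 0 ?i" by (simp add: win_ok_def init_state_def)
  moreover have "fin_refs ?i" "pot w {} ?i = 0"
    by (simp_all add: fin_refs_def init_state_def pot_def)
  moreover have "footprint ?i \<le> 2 * w + bits w + 1 + (length ts + 2 * M) * clock_size + M * (2 + bits w)
      + (length ts + M) * length ts"
    by (rule footprint_le[OF good_init _ _ assms(1)]) simp_all
  ultimately show ?case using good_init by (simp add: init_machine_def)
next
  case (Suc n)
  define m where "m = fold process (take n \<sigma>) init_machine"
  have n: "n < length \<sigma>" using Suc.prems by simp
  have run: "fold process (take (Suc n) \<sigma>) init_machine = process (\<sigma> ! n) m"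
    using n by (simp add: take_Suc_conv_app_nth m_def)
  have IH: "good (n - w) n (mem m)" "win_ok n (mem m)" "fin_refs (mem m)"
    "ticks m + 2 * pot w {} (mem m) \<le> length ts * length ts + n * (13 + 14 * length ts)"
    "peak m \<le> 2 * w + bits w + 1 + (length ts + 2 * M) * clock_size + M * (2 + bits w)
      + (length ts + M) * length ts + (3 + bits w + clock_size + length ts)"
    using Suc by (simp_all add: m_def Let_def)
  note c = process_cost[OF IH(3) w, of "\<sigma> ! n"]
  have "footprint (mem m) \<le> 2 * w + bits w + 1 + (length ts + 2 * M) * clock_size + M * (2 + bits w)
      + (length ts + M) * length ts"
    using n by (intro footprint_le[OF IH(1) _ _ assms(1)]) auto
  then have "peak (process (\<sigma> ! n) m) \<le> 2 * w + bits w + 1 + (length ts + 2 * M) * clock_size + M * (2 + bits w)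
      + (length ts + M) * length ts + (3 + bits w + clock_size + length ts)"
    using c(3) IH(5) by linarith
  moreover have "ticks (process (\<sigma> ! n) m) + 2 * pot w {} (mem (process (\<sigma> ! n) m))
      \<le> length ts * length ts + Suc n * (13 + 14 * length ts)"
    using c(2) IH(4) by simp
  ultimately show ?case
    using good_process[OF IH(1-3) n] c(1) unfolding run Let_def by blast
qed

lemma run_correct:
  assumes "M = min w (card (locations \<sigma>) + card (locks \<sigma>))"
  shows "race (mem (fold process \<sigma> init_machine)) \<longleftrightarrow> short_hb_race \<sigma> w"
    "ticks (fold process \<sigma> init_machine) \<le> length ts * length ts + length \<sigma> * (13 + 14 * length ts)"
    "peak (fold process \<sigma> init_machine) \<le> 2 * w + bits w + 1 + (length ts + 2 * M) * clock_size + M * (2 + bits w)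
      + (length ts + M) * length ts + (3 + bits w + clock_size + length ts)"
proof -
  define m where "m = fold process \<sigma> init_machine"
  note inv = run_invariant[OF assms order_refl, unfolded take_all[OF order_refl] Let_def, folded m_def]
  show "race (mem m) \<longleftrightarrow> short_hb_race \<sigma> w"
    using inv by (simp add: good_def race_before_def short_hb_race_def)
  show "ticks m \<le> length ts * length ts + length \<sigma> * (13 + 14 * length ts)"
    using inv by linarith
  show "peak m \<le> 2 * w + bits w + 1 + (length ts + 2 * M) * clock_size + M * (2 + bits w)
      + (length ts + M) * length ts + (3 + bits w + clock_size + length ts)"
    using inv by blast
qed

end

section \<open>From runs to asymptotic bounds\<close>

lemma WindowHB_correct:
  fixes \<sigma> :: "('t, 'x, 'l) trace"
  assumes "w \<ge> 1" "well_formed \<sigma>"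
    and "T = card (threads \<sigma>)" "M = min w (card (locations \<sigma>) + card (locks \<sigma>))"
  shows "answer w \<sigma> \<longleftrightarrow> short_hb_race \<sigma> w"
    "running_time w \<sigma> \<le> T * T + length \<sigma> * (13 + 14 * T)"
    "space w \<sigma> \<le> 2 * w + bits w + 1 + (T + 2 * M) * (1 + T * bits w) + M * (2 + bits w)
      + (T + M) * T + (3 + bits w + (1 + T * bits w) + T)"
proof -
  interpret windowed_trace w "remdups (map thr \<sigma>)" \<sigma>
    using assms by unfold_locales (simp_all add: threads_def)
  have T: "length (remdups (map thr \<sigma>)) = T"
    by (simp add: assms(3) threads_def length_remdups_card_conv)
  show "answer w \<sigma> \<longleftrightarrow> short_hb_race \<sigma> w"
    "running_time w \<sigma> \<le> T * T + length \<sigma> * (13 + 14 * T)"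
    "space w \<sigma> \<le> 2 * w + bits w + 1 + (T + 2 * M) * (1 + T * bits w) + M * (2 + bits w)
      + (T + M) * T + (3 + bits w + (1 + T * bits w) + T)"
    using run_correct[OF assms(4)] unfolding T
    by (simp_all add: answer_def running_time_def space_def WindowHB_def Let_def)
qed

theorem theorem5:
  shows "(\<forall>(w::nat) (\<sigma>::('t, 'x, 'l) trace). w \<ge> 1 \<longrightarrow> well_formed \<sigma> \<longrightarrow>
            (answer w \<sigma> \<longleftrightarrow> short_hb_race \<sigma> w)) \<and>
         (\<exists>c::real. \<forall>(w::nat) (\<sigma>::('t, 'x, 'l) trace). w \<ge> 1 \<longrightarrow> well_formed \<sigma> \<longrightarrow>
            real (running_time w \<sigma>) \<le> c * (real (length \<sigma>) * real (card (threads \<sigma>)))) \<and>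
         (\<exists>c::real. \<forall>(w::nat) (\<sigma>::('t, 'x, 'l) trace). w \<ge> 1 \<longrightarrow> well_formed \<sigma> \<longrightarrow>
            real (space w \<sigma>) \<le>
              c * (real w +
                   (real (min w (card (locations \<sigma>) + card (locks \<sigma>))) + real (card (threads \<sigma>)))
                   * real (card (threads \<sigma>)) * max 1 (log 2 (real w))))"
proof (intro conjI exI allI impI)
  fix w :: nat and \<sigma> :: "('t, 'x, 'l) trace"
  assume w: "w \<ge> 1" and wf: "well_formed \<sigma>"
  show "answer w \<sigma> \<longleftrightarrow> short_hb_race \<sigma> w"
    by (rule WindowHB_correct(1)[OF w wf refl refl])
next
  fix w :: nat and \<sigma> :: "('t, 'x, 'l) trace"
  assume w: "w \<ge> 1" and wf: "well_formed \<sigma>"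
  let ?N = "length \<sigma>" and ?T = "card (threads \<sigma>)"
  have "?T \<le> ?N" unfolding threads_def
    by (metis card_image_le card_length finite_set order_trans)
  then have "?T * ?T \<le> ?N * ?T" by simp
  moreover have "?N \<le> ?N * ?T"
  proof (cases "\<sigma> = []")
    case False
    then have "?T > 0" by (simp add: threads_def card_gt_0_iff)
    then show ?thesis by simp
  qed simp
  moreover have "running_time w \<sigma> \<le> ?T * ?T + (13 * ?N + 14 * (?N * ?T))"
    using WindowHB_correct(2)[OF w wf refl refl] by (simp add: algebra_simps)
  \<comment> \<open>28 is 1 + 13 + 14. Every thread has an event, so \<open>?T \<le> ?N\<close> pays
    for initialising the clocks; a nonempty trace has a thread, which turns \<open>?N\<close> into
    \<open>?N * ?T\<close>.\<close>
  ultimately have "running_time w \<sigma> \<le> 28 * (?N * ?T)" by linarith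
  then show "real (running_time w \<sigma>) \<le> 28 * (real ?N * real ?T)"
    by (metis of_nat_le_iff of_nat_mult of_nat_numeral)
next
  fix w :: nat and \<sigma> :: "('t, 'x, 'l) trace"
  assume w: "w \<ge> 1" and wf: "well_formed \<sigma>"
  define T where "T = real (card (threads \<sigma>))"
  define M where "M = real (min w (card (locations \<sigma>) + card (locks \<sigma>)))"
  define L where "L = max 1 (log 2 (real w))"
  define b where "b = real (bits w)"
  have "real (space w \<sigma>) \<le> real (2 * w + bits w + 1
      + (card (threads \<sigma>) + 2 * min w (card (locations \<sigma>) + card (locks \<sigma>))) * (1 + card (threads \<sigma>) * bits w)
      + min w (card (locations \<sigma>) + card (locks \<sigma>)) * (2 + bits w)
      + (card (threads \<sigma>) + min w (card (locations \<sigma>) + card (locks \<sigma>))) * card (threads \<sigma>)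
      + (3 + bits w + (1 + card (threads \<sigma>) * bits w) + card (threads \<sigma>)))"
    by (rule of_nat_mono[OF WindowHB_correct(3)[OF w wf refl refl]])
  also have "\<dots> = 2 * real w + b + 1 + (T + 2 * M) * (1 + T * b) + M * (2 + b) + (T + M) * T
      + (3 + b + (1 + T * b) + T)"
    unfolding T_def M_def b_def by (simp add: algebra_simps)
  finally have s: "real (space w \<sigma>) \<le> \<dots>" .
  have L: "L \<ge> 1" and b: "0 \<le> b" "b \<le> 3 * L" "b \<le> real w" and w': "real w \<ge> 1" and M: "M \<ge> 0"
    using bits_bounds[OF w] w by (simp_all add: L_def b_def M_def)
  have "real (space w \<sigma>) \<le> 14 * (real w + (M + T) * T * L)"
  proof (cases "\<sigma> = []")
    case True
    then have "T = 0" "M = 0" by (simp_all add: T_def M_def threads_def locations_def locks_def)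
    \<comment> \<open>Without threads the product vanishes, and the remaining terms must fit under
      \<open>w\<close> by means of \<open>bits w \<le> w\<close> and
      \<open>w \<ge> 1\<close>.\<close>
    then show ?thesis using s b w' by simp
  next
    case False
    then have T: "T \<ge> 1" by (simp add: T_def threads_def Suc_le_eq card_gt_0_iff)
    have TL: "T \<le> T * L" "L \<le> T * L" using T L by simp_all
    have Tb: "1 + T * b \<le> 4 * (T * L)"
    proof -
      have "T * b \<le> T * (3 * L)" using T b by (intro mult_left_mono) auto
      also have "\<dots> = 3 * (T * L)" by simp
      finally show ?thesis using TL T by linarith
    qed
    define X where "X = T * (T * L)"
    define Y where "Y = M * (T * L)"
    have "(T + 2 * M) * (1 + T * b) \<le> (T + 2 * M) * (4 * (T * L))"
      using Tb T M by (intro mult_left_mono) auto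
    also have "\<dots> = 4 * X + 8 * Y" by (simp add: X_def Y_def algebra_simps)
    finally have 1: "(T + 2 * M) * (1 + T * b) \<le> 4 * X + 8 * Y" .
    have "2 + b \<le> 5 * (T * L)" using b L TL by linarith
    from mult_left_mono[OF this M] have 2: "M * (2 + b) \<le> 5 * Y" by (simp add: Y_def algebra_simps)
    have "(T + M) * T \<le> (T + M) * (T * L)" using TL(1) T M by (intro mult_left_mono) auto
    also have "\<dots> = X + Y" by (simp add: X_def Y_def algebra_simps)
    finally have 3: "(T + M) * T \<le> X + Y" .
    have "1 * (T * L) \<le> X" unfolding X_def using T L by (intro mult_right_mono) auto
    then have 4: "(1 + T * b) + T \<le> 5 * X" using Tb TL by linarith
    have "X \<ge> 0" using T L by (simp add: X_def)
    \<comment> \<open>Variables for the products make the estimate linear. The constant 14 is the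
      coefficient 8 + 5 + 1 of \<open>Y\<close>; that of \<open>X\<close> is 4 + 1 + 5, and the
      terms outside the products are at most \<open>8 * real w\<close>.\<close>
    have bound: "x \<le> 14 * real w + 14 * (X + Y)"
      if "x \<le> 2 * real w + b + 1 + p + q + r + (3 + b + u + T)"
        "p \<le> 4 * X + 8 * Y" "q \<le> 5 * Y" "r \<le> X + Y" "u + T \<le> 5 * X" for x p q r u :: real
      using that \<open>X \<ge> 0\<close> b(3) w' by (simp add: algebra_simps)
    have "real (space w \<sigma>) \<le> 14 * real w + 14 * (X + Y)"
      by (rule bound[OF s 1 2 3 4])
    also have "\<dots> = 14 * (real w + (M + T) * T * L)"
      by (simp add: X_def Y_def algebra_simps)
    finally show ?thesis .
  qed
  then show "real (space w \<sigma>) \<le> 14 * (real w +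
      (real (min w (card (locations \<sigma>) + card (locks \<sigma>))) + real (card (threads \<sigma>)))
        * real (card (threads \<sigma>)) * max 1 (log 2 (real w)))"
    unfolding T_def M_def L_def .
qed

end
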